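(* Let $n\ge1$, $a_1,\ldots,a_n$ positive integers, $\lambda=\sum a_i\omega_i$. A vertex of the type $C$ FFLV polytope $P_\lambda$ is simple if and only if it has the form $\varphi^{-1}(x(E))$ for some $E\in\mathbf R^C_s$.
   Context: $U=\mathbb R^{n^2}$ has coordinates $x_{i,j}$, $1\le i<j\le 2n+1-i$. A type $C$ Dyck path is a sequence $d=((i_1,j_1),\ldots,(i_N,j_N))$ of such pairs with $j_1-i_1=1$, each $(i_{k+1},j_{k+1})$ equal to $(i_k+1,j_k)$ or $(i_k,j_k+1)$, and $j_N-i_N=1$ or $i_N+j_N=2n+1$; $S(x,d)=\sum_{(i,j)\in d}x_{i,j}$; $M(\lambda,d)=a_{i_1}+\ldots+a_{i_N}$ if $j_N-i_N=1$, else $a_{i_1}+\ldots+a_n$. $P_\lambda=\{x\in U:x\ge0,\ S(x,d)\le M(\lambda,d)\ \forall d\}$. A vertex is simple if the tangent cone at it is simplicial and unimodular. Let $U_A=\mathbb R^{n(2n-1)}$ with coordinates $x_{i,j}$, $1\le i<j\le 2n$, and $\varphi:U\to U_A$ the injective linear map with $\varphi(x)_{i,j}=x_{i,j}$ if $i+j<2n+1$, $2x_{i,j}$ if $i+j=2n+1$, $x_{2n+1-j,2n+1-i}$ if $i+j>2n+1$. Let $(\bar a_1,\ldots,\bar a_{2n-1})=(a_1,\ldots,a_{n-1},2a_n,a_{n-1},\ldots,a_1)$. For $i<j\le 2n$ let $d^{i,j}=((i,i+1),\ldots,(i,j),(i+1,j),\ldots,(j-1,j))$ and for $y\in U_A$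 let $S(y,d^{i,j})$ be the sum of the coordinates of $y$ along $d^{i,j}$. Let $R$ be the set of segments $[i,j]$, integers $1\le i<j\le 2n$; for $E\subset R$, $x(E)\in U_A$ is the unique point with $x(E)_{i,j}=0$ for $[i,j]\notin E$ and $S(x(E),d^{i,j})=\bar a_i+\ldots+\bar a_{j-1}$ for $[i,j]\in E$. $\mathbf R_p$ is the set of $E\subset R$ such that the intersection of any two segments of $E$ with nonempty intersection lies in $E$; $E$ is symmetric if $[2n+1-j,2n+1-i]\in E$ implies $[i,j]\in E$. $\mathbf R^C_s$ is the set of symmetric $E\in\mathbf R_p$ such that any two segments $[i,j],[k,l]\in E$ with $i+j\le 2n+1$ and $k+l\le 2n+1$ either do not intersect or one contains the other. (For symmetric $E$, $x(E)\in\varphi(U)$.) *)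

theory Defs
  imports "HOL-Analysis.Analysis" "HOL-Analysis.Finite_Function_Topology"
begin

text \<open>Points of a coordinate space with coordinates labelled by pairs are finitely supported
  functions; the space itself is the subspace of functions supported in the index set.\<close>

type_synonym point = "(nat \<times> nat) \<Rightarrow>\<^sub>0 real"

definition coord_space :: "(nat \<times> nat) set \<Rightarrow> point set" where
  "coord_space I = {x. \<forall>p. p \<notin> I \<longrightarrow> Poly_Mapping.lookup x p = 0}"

definition int_lattice :: "(nat \<times> nat) set \<Rightarrow> point set" where
  "int_lattice I = {x \<in> coord_space I. \<forall>p. Poly_Mapping.lookup x p \<in> \<int>}"

text \<open>The tangent cone is taken with its apex translated to the origin.\<close>

definition tangent_cone :: "'a::real_vector set \<Rightarrow> 'a \<Rightarrow> 'a set" where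
  "tangent_cone P v = conic hull ((\<lambda>x. x - v) ` P)"

definition simplicial_cone :: "'a::real_vector set \<Rightarrow> bool" where
  "simplicial_cone C \<longleftrightarrow> (\<exists>B. finite B \<and> independent B \<and> C = convex_cone hull B)"

definition lattice_basis :: "'a::real_vector set \<Rightarrow> 'a set \<Rightarrow> bool" where
  "lattice_basis B L \<longleftrightarrow> finite B \<and> independent B \<and>
     L = {\<Sum>b\<in>B. of_int (c b) *\<^sub>R b | c :: 'a \<Rightarrow> int. True}"

definition unimodular_cone :: "'a::real_vector set \<Rightarrow> 'a set \<Rightarrow> bool" where
  "unimodular_cone L C \<longleftrightarrow> (\<exists>B. lattice_basis B L \<and> C = convex_cone hull B)"

definition simple_vertex :: "'a::real_vector set \<Rightarrow> 'a set \<Rightarrow> 'a \<Rightarrow> bool" where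
  "simple_vertex L P v \<longleftrightarrow> v extreme_point_of P \<and>
     simplicial_cone (tangent_cone P v) \<and> unimodular_cone L (tangent_cone P v)"

definition index_C :: "nat \<Rightarrow> (nat \<times> nat) set" where
  "index_C n = {(i, j). 1 \<le> i \<and> i < j \<and> i + j \<le> 2 * n + 1}"

definition index_A :: "nat \<Rightarrow> (nat \<times> nat) set" where
  "index_A n = {(i, j). 1 \<le> i \<and> i < j \<and> j \<le> 2 * n}"

definition dyck_path_C :: "nat \<Rightarrow> (nat \<times> nat) list \<Rightarrow> bool" where
  "dyck_path_C n d \<longleftrightarrow> d \<noteq> [] \<and> set d \<subseteq> index_C n \<and>
     snd (hd d) = fst (hd d) + 1 \<and>
     successively (\<lambda>(i, j) q. q = (i + 1, j) \<or> q = (i, j + 1)) d \<and>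
     (snd (last d) = fst (last d) + 1 \<or> fst (last d) + snd (last d) = 2 * n + 1)"

definition path_sum :: "point \<Rightarrow> (nat \<times> nat) list \<Rightarrow> real" where
  "path_sum x d = (\<Sum>p\<leftarrow>d. Poly_Mapping.lookup x p)"

text \<open>The weight \<open>\<lambda> = a\<^sub>1 \<omega>\<^sub>1 + \<dots> + a\<^sub>n \<omega>\<^sub>n\<close> is represented by its coefficients.
  Both sums run over consecutive indices, not over the entries of the path.\<close>

definition path_bound :: "nat \<Rightarrow> (nat \<Rightarrow> nat) \<Rightarrow> (nat \<times> nat) list \<Rightarrow> nat" where
  "path_bound n a d =
     (if snd (last d) = fst (last d) + 1 then \<Sum>k = fst (hd d)..fst (last d). a k
      else \<Sum>k = fst (hd d)..n. a k)"

definition FFLV_C :: "nat \<Rightarrow> (nat \<Rightarrow> nat) \<Rightarrow> point set" where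
  "FFLV_C n a = {x \<in> coord_space (index_C n).
     (\<forall>p \<in> index_C n. 0 \<le> Poly_Mapping.lookup x p) \<and>
     (\<forall>d. dyck_path_C n d \<longrightarrow> path_sum x d \<le> real (path_bound n a d))}"

definition phi :: "nat \<Rightarrow> point \<Rightarrow> point" where
  "phi n x = (\<Sum>(i, j) \<in> index_A n. Poly_Mapping.single (i, j)
     (if i + j < 2 * n + 1 then Poly_Mapping.lookup x (i, j)
      else if i + j = 2 * n + 1 then 2 * Poly_Mapping.lookup x (i, j)
      else Poly_Mapping.lookup x (2 * n + 1 - j, 2 * n + 1 - i)))"

definition abar :: "nat \<Rightarrow> (nat \<Rightarrow> nat) \<Rightarrow> nat \<Rightarrow> nat" where
  "abar n a k = (if k < n then a k else if k = n then 2 * a n else a (2 * n - k))"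

definition hook :: "nat \<Rightarrow> nat \<Rightarrow> (nat \<times> nat) list" where
  "hook i j = map (\<lambda>k. (i, k)) [i + 1..<j + 1] @ map (\<lambda>k. (k, j)) [i + 1..<j]"

text \<open>A segment is the set of its integer points, so segments sharing only an endpoint do
  intersect, and their one-point intersection is not itself a segment.\<close>

definition segments :: "nat \<Rightarrow> nat set set" where
  "segments n = {{i..j} | i j. 1 \<le> i \<and> i < j \<and> j \<le> 2 * n}"

definition x_of :: "nat \<Rightarrow> (nat \<Rightarrow> nat) \<Rightarrow> nat set set \<Rightarrow> point" where
  "x_of n a E = (THE y. y \<in> coord_space (index_A n) \<and>
     (\<forall>(i, j) \<in> index_A n.
        ({i..j} \<notin> E \<longrightarrow> Poly_Mapping.lookup y (i, j) = 0) \<and>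
        ({i..j} \<in> E \<longrightarrow> path_sum y (hook i j) = real (\<Sum>k = i..<j. abar n a k))))"

definition R_p :: "nat \<Rightarrow> nat set set set" where
  "R_p n = {E. E \<subseteq> segments n \<and> (\<forall>s\<in>E. \<forall>t\<in>E. s \<inter> t \<noteq> {} \<longrightarrow> s \<inter> t \<in> E)}"

definition symmetric_segs :: "nat \<Rightarrow> nat set set \<Rightarrow> bool" where
  "symmetric_segs n E \<longleftrightarrow>
     (\<forall>(i, j) \<in> index_A n. {2 * n + 1 - j..2 * n + 1 - i} \<in> E \<longrightarrow> {i..j} \<in> E)"

definition R_s_C :: "nat \<Rightarrow> nat set set set" where
  "R_s_C n = {E \<in> R_p n. symmetric_segs n E \<and>
     (\<forall>(i, j) \<in> index_A n. \<forall>(k, l) \<in> index_A n.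
        {i..j} \<in> E \<and> {k..l} \<in> E \<and> i + j \<le> 2 * n + 1 \<and> k + l \<le> 2 * n + 1 \<longrightarrow>
        {i..j} \<inter> {k..l} = {} \<or> {i..j} \<subseteq> {k..l} \<or> {k..l} \<subseteq> {i..j})}"

end

theory Submission
  imports Defs
begin

text \<open>
  The tangent cone at a vertex \<open>v\<close> is cut out by the tight inequalities: the coordinates vanishing at
  \<open>v\<close> and the tight Dyck paths.  Comparing how often each antidiagonal level is covered shows that no
  tight inequality is a nonnegative combination of the others, so if the cone is simplicial and
  full-dimensional, the tight inequalities are linearly independent.  Exchanging the tails of two tight
  paths at a common point, and flipping a corner of a tight path at which \<open>v\<close> vanishes, produce linear
  relations.  Independence therefore forces every corner of a tight path into the support of \<open>v\<close> and
  excludes the crossing of two tight paths.  On the other hand a vertex is determined by its tight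
  paths; expressing the indicator of an edge through support coordinates above and to the right of it,
  one finds that a tight path cannot have a lower corner.  Hence the tight paths are exactly the hooks
  (cut off at the antidiagonal) of the support points, and the support is laminar.

  Conversely, for a laminar family the members met by a path split into groups lying on hooks, which
  bounds every path sum and shows that only the hooks of the family are tight.  These hooks together
  with the remaining coordinates form a unitriangular system, whose dual basis is a lattice basis
  generating the tangent cone.
\<close>

section \<open>Linear algebra of cones and lattices\<close>

text \<open>Independence is then used in dual form: each tight path has a vector annihilated by all
  other tight paths and by the coordinates vanishing at \<open>v\<close>, but not by the path
  itself. Upper and lower corners behave differently because the expression of edges starts in the
  empty row above the index triangle. It yields, through every support point, a tight path that
  neither enters from above nor leaves to the right; a lower corner does both, and exchanging tails
  gives a forbidden relation. Cutting hooks at the antidiagonal makes all segments with the same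
  left end that reach past \<open>n\<close> share one bound. This is why laminarity is accompanied
  by a second condition, that the antidiagonal end of each hook belongs to the family.\<close>

abbreviation coef :: "point \<Rightarrow> nat \<times> nat \<Rightarrow> real" where
  "coef \<equiv> Poly_Mapping.lookup"

lemma coef_scaleR [simp]: "coef (c *\<^sub>R x) p = c * coef x p"
proof -
  have "finite {q. c *\<^sub>R coef x q \<noteq> 0}"
    by (rule finite_subset[OF _ finite_lookup[of x]]) auto
  then show ?thesis
    by (simp add: scaleR_poly_mapping_def)
qed

lemma linear_sum_coef: "linear (\<lambda>w. \<Sum>p\<in>D. coef w p)"
  by (rule linearI) (simp_all add: lookup_add sum.distrib sum_distrib_left)

lemma subspace_coord_space: "subspace (coord_space I)"
  by (auto simp: subspace_def coord_space_def lookup_add)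

lemma coord_space_eqI:
  assumes "x \<in> coord_space I" "y \<in> coord_space I" "\<And>p. p \<in> I \<Longrightarrow> coef x p = coef y p"
  shows "x = y"
  using assms by (intro poly_mapping_eqI) (metis (mono_tags, lifting) coord_space_def mem_Collect_eq)

definition point_of :: "(nat \<times> nat) set \<Rightarrow> (nat \<times> nat \<Rightarrow> real) \<Rightarrow> point" where
  "point_of I f = (\<Sum>p\<in>I. Poly_Mapping.single p (f p))"

lemma coef_point_of: "finite I \<Longrightarrow> coef (point_of I f) p = (if p \<in> I then f p else 0)"
  by (simp add: point_of_def lookup_sum lookup_single when_def if_distrib cong: if_cong)

lemma point_of_in_coord_space: "finite I \<Longrightarrow> point_of I f \<in> coord_space I"
  by (simp add: coord_space_def coef_point_of)

lemma convex_cone_hull_finite: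
  fixes B :: "'a::real_vector set"
  assumes "finite B"
  shows "convex_cone hull B = {\<Sum>b\<in>B. c b *\<^sub>R b | c. \<forall>b\<in>B. 0 \<le> c b}" (is "_ = ?R")
proof (rule hull_unique)
  show "B \<subseteq> ?R"
  proof
    fix b assume "b \<in> B"
    then have "b = (\<Sum>b'\<in>B. (if b' = b then 1 else 0) *\<^sub>R b')"
      using assms by (simp add: if_distrib[of "\<lambda>t. t *\<^sub>R _"] cong: if_cong)
    then show "b \<in> ?R"
      by (intro CollectI exI[of _ "\<lambda>b'. if b' = b then 1 else 0"]) auto
  qed
  show "convex_cone ?R"
    unfolding convex_cone_iff
  proof (intro conjI ballI allI impI)
    show "0 \<in> ?R"
      by (intro CollectI exI[of _ "\<lambda>_. 0"]) auto
  next
    fix x y assume "x \<in> ?R" "y \<in> ?R"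
    then obtain c d where c: "x = (\<Sum>b\<in>B. c b *\<^sub>R b)" "\<forall>b\<in>B. 0 \<le> c b"
      and d: "y = (\<Sum>b\<in>B. d b *\<^sub>R b)" "\<forall>b\<in>B. 0 \<le> d b"
      by blast
    show "x + y \<in> ?R"
      by (intro CollectI exI[of _ "\<lambda>b. c b + d b"])
        (auto simp: c d scaleR_add_left sum.distrib)
  next
    fix x and r :: real assume "x \<in> ?R" "0 \<le> r"
    then obtain c where c: "x = (\<Sum>b\<in>B. c b *\<^sub>R b)" "\<forall>b\<in>B. 0 \<le> c b"
      by blast
    show "r *\<^sub>R x \<in> ?R"
      by (intro CollectI exI[of _ "\<lambda>b. r * c b"])
        (use \<open>0 \<le> r\<close> in \<open>auto simp: c scaleR_sum_right\<close>)
  qed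
  fix T assume T: "B \<subseteq> T" "convex_cone T"
  show "?R \<subseteq> T"
  proof safe
    fix c assume c: "\<forall>b\<in>B. 0 \<le> (c b :: real)"
    have "A \<subseteq> B \<Longrightarrow> (\<Sum>b\<in>A. c b *\<^sub>R b) \<in> T" if "finite A" for A
      using that
    proof (induction A rule: finite_induct)
      case empty
      then show ?case using T by (simp add: convex_cone_iff)
    next
      case (insert b A)
      then show ?case using T c
        by (auto intro!: convex_cone_add convex_cone_scaleR)
    qed
    then show "(\<Sum>b\<in>B. c b *\<^sub>R b) \<in> T" using assms by blast
  qed
qed

text \<open>Each generator of a simplicial cone spans the complement of a facet, which must be cut out by
  one of the given inequalities; extremality makes this assignment exhaust all inequalities.\<close>

lemma simplicial_cone_separates_inequalities:
  fixes F :: "('a::real_vector \<Rightarrow> real) set"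
  assumes finF: "finite F" and lin: "\<And>f. f \<in> F \<Longrightarrow> linear f"
    and finB: "finite B" and ind: "independent B" and spanB: "span B = U"
    and C: "convex_cone hull B = {w \<in> U. \<forall>f\<in>F. 0 \<le> f w}"
    and extremal: "\<And>f t g b. \<lbrakk>f \<in> F; \<And>b. b \<in> B \<Longrightarrow> 0 \<le> t b; \<And>b. b \<in> B \<Longrightarrow> g b \<in> F;
        \<And>w. w \<in> U \<Longrightarrow> f w = (\<Sum>b\<in>B. t b * g b w); b \<in> B; 0 < t b\<rbrakk> \<Longrightarrow> g b = f"
    and nonzero: "\<And>f. f \<in> F \<Longrightarrow> \<exists>w\<in>U. f w \<noteq> 0"
    and f: "f \<in> F"
  obtains w where "w \<in> U" "0 < f w" "\<And>f'. f' \<in> F \<Longrightarrow> f' \<noteq> f \<Longrightarrow> f' w = 0"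
proof -
  have BU: "B \<subseteq> U" using spanB span_superset by blast
  have BC: "0 \<le> h b" if "h \<in> F" "b \<in> B" for h b
    using C that hull_inc[of b B convex_cone] by blast
  \<comment> \<open>Otherwise every inequality positive at \<open>b\<close> is also positive at the
    sum \<open>w\<close> of the other generators, so \<open>w\<close> minus a small multiple of
    \<open>b\<close> stays in the cone; by independence its coefficient at \<open>b\<close> is
    negative, which is impossible.\<close>
  have "\<exists>h\<in>F. 0 < h b \<and> (\<forall>b'\<in>B - {b}. h b' = 0)" if b: "b \<in> B" for b
  proof (rule ccontr)
    assume *: "\<not> ?thesis"
    define w where "w = (\<Sum>b'\<in>B - {b}. b')"
    have wU: "w \<in> U"
      unfolding w_def spanB[symmetric] by (intro span_sum) (simp add: span_base)
    have hw: "h w = (\<Sum>b'\<in>B - {b}. h b')" if "h \<in> F" for h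
      using lin[OF that] by (simp add: w_def linear_sum)
    have pos: "0 < h w" if "h \<in> F" "0 < h b" for h
    proof -
      have "\<exists>b'\<in>B - {b}. h b' \<noteq> 0" using * that by blast
      then obtain b' where "b' \<in> B - {b}" "h b' \<noteq> 0" by blast
      then have "0 < h b'" using BC[OF that(1), of b'] by force
      then show ?thesis
        unfolding hw[OF that(1)] using BC[OF that(1)] finB \<open>b' \<in> B - {b}\<close>
        by (intro sum_pos2[of _ b']) auto
    qed
    define G where "G = {h \<in> F. 0 < h b}"
    obtain e :: real where e: "0 < e" "\<And>h. h \<in> G \<Longrightarrow> e * h b \<le> h w"
    proof
      have finG: "finite ((\<lambda>h. h w / h b) ` G)" using finF by (simp add: G_def)
      \<comment> \<open>The inserted 1 is the step taken when no inequality is positive at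
        \<open>b\<close>.\<close>
      let ?e = "Min (insert 1 ((\<lambda>h. h w / h b) ` G))"
      show "0 < ?e" using finG pos by (auto simp: G_def)
      fix h assume "h \<in> G"
      then have "?e \<le> h w / h b" using finG by (intro Min_le) auto
      then show "?e * h b \<le> h w" using \<open>h \<in> G\<close> by (simp add: G_def field_simps)
    qed
    have "w - e *\<^sub>R b \<in> convex_cone hull B"
      unfolding C
    proof (intro CollectI conjI ballI)
      show "w - e *\<^sub>R b \<in> U"
        using wU b BU unfolding spanB[symmetric] by (auto intro: span_diff span_scale span_base)
      fix h assume h: "h \<in> F"
      have eq: "h (w - e *\<^sub>R b) = h w - e * h b"
        using lin[OF h] by (simp add: linear_diff linear_scale)
      show "0 \<le> h (w - e *\<^sub>R b)"
      proof (cases "0 < h b")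
        case True
        then show ?thesis using e(2)[of h] h by (simp add: eq G_def)
      next
        case False
        then have "h b = 0" using BC[OF h b] by simp
        moreover have "0 \<le> h w" unfolding hw[OF h] by (intro sum_nonneg) (use BC[OF h] in auto)
        ultimately show ?thesis by (simp add: eq)
      qed
    qed
    then obtain c where c: "w - e *\<^sub>R b = (\<Sum>b'\<in>B. c b' *\<^sub>R b')" "\<forall>b'\<in>B. 0 \<le> c b'"
      unfolding convex_cone_hull_finite[OF finB] by blast
    have "(\<Sum>b'\<in>B. (c b' - (if b' = b then - e else 1)) *\<^sub>R b') = 0"
    proof -
      have "(\<Sum>b'\<in>B. (if b' = b then - e else 1) *\<^sub>R b') = w - e *\<^sub>R b"
        unfolding w_def sum.remove[OF finB b] by (simp cong: sum.cong_simp)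
      then show ?thesis
        using c(1) by (simp add: scaleR_diff_left sum_subtractf)
    qed
    then have "c b - (if b = b then - e else 1) = 0"
      by (rule independentD[OF ind finB subset_refl _ b])
    then show False using c(2) b e(1) by auto
  qed
  then obtain g where g: "\<And>b. b \<in> B \<Longrightarrow> g b \<in> F" "\<And>b. b \<in> B \<Longrightarrow> 0 < g b b"
    "\<And>b b'. b \<in> B \<Longrightarrow> b' \<in> B \<Longrightarrow> b' \<noteq> b \<Longrightarrow> g b b' = 0"
    by (metis DiffI singletonD)
  \<comment> \<open>The \<open>g b\<close> form a rescaled dual basis, so every inequality is a
    combination of them; the coefficients are nonnegative because generators lie in the
    cone.\<close>
  have expand: "h w = (\<Sum>b\<in>B. h b / g b b * g b w)" if h: "h \<in> F" and w: "w \<in> U" for h w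
  proof -
    have "w \<in> range (\<lambda>u. \<Sum>b\<in>B. u b *\<^sub>R b)"
      using w span_finite[OF finB] spanB by simp
    then obtain u where u: "w = (\<Sum>b\<in>B. u b *\<^sub>R b)" by blast
    have "g b w = u b * g b b" if "b \<in> B" for b
    proof -
      have "g b w = (\<Sum>b'\<in>B. u b' * g b b')"
        using lin[OF g(1)[OF that]] by (simp add: u linear_sum linear_scale)
      also have "\<dots> = (\<Sum>b'\<in>B. if b' = b then u b * g b b else 0)"
        using g(3)[OF that] by (intro sum.cong) auto
      finally show ?thesis using finB that by simp
    qed
    moreover have "h w = (\<Sum>b\<in>B. u b * h b)"
      using lin[OF h] by (simp add: u linear_sum linear_scale)
    ultimately show ?thesis
      using g(2) by (simp add: less_imp_neq[THEN not_sym] mult.commute)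
  qed
  have ext: "g b = h" if "h \<in> F" "b \<in> B" "0 < h b" for h b
  proof (rule extremal[OF that(1), of "\<lambda>b. h b / g b b" g])
    show "0 \<le> h b / g b b" if "b \<in> B" for b
      using BC[OF \<open>h \<in> F\<close> that] g(2)[OF that] by simp
  qed (use that g expand in auto)
  obtain b where b: "b \<in> B" "f b \<noteq> 0"
  proof -
    obtain w where w: "w \<in> U" "f w \<noteq> 0" using nonzero[OF f] by blast
    have "\<exists>b\<in>B. f b \<noteq> 0"
    proof (rule ccontr)
      assume "\<not> ?thesis"
      then have "f w = 0" using expand[OF f w(1)] by simp
      then show False using w by simp
    qed
    then show ?thesis using that by blast
  qed
  have fb: "0 < f b" using BC[OF f b(1)] b(2) by simp
  \<comment> \<open>The generator \<open>b\<close> itself is the required vector: by extremality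
    every inequality positive at \<open>b\<close> equals \<open>g b\<close>, so only
    \<open>f\<close> is positive there.\<close>
  show ?thesis
  proof
    show "b \<in> U" using b BU by blast
    show "0 < f b" by (rule fb)
    fix f' assume f': "f' \<in> F" "f' \<noteq> f"
    show "f' b = 0"
    proof (rule ccontr)
      assume "f' b \<noteq> 0"
      then have "0 < f' b" using BC[OF f'(1) b(1)] by simp
      then have "g b = f'" using ext f'(1) b(1) by blast
      moreover have "g b = f" using ext f b(1) fb by blast
      ultimately show False using f'(2) by simp
    qed
  qed
qed

text \<open>The values \<open>f p w\<close> are the coordinates of \<open>w\<close> in the dual
  family \<open>b\<close>. Hence one family serves both purposes: integral coordinates describe the
  lattice and nonnegative coordinates the cone.\<close>

lemma dual_family_unimodular:
  fixes f :: "'i \<Rightarrow> 'a::real_vector \<Rightarrow> real"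
  assumes finI: "finite I" and lin: "\<And>p. p \<in> I \<Longrightarrow> linear (f p)"
    and dual: "\<And>p q. p \<in> I \<Longrightarrow> q \<in> I \<Longrightarrow> f q (b p) = (if p = q then 1 else 0)"
    and bU: "\<And>p. p \<in> I \<Longrightarrow> b p \<in> U" and U: "subspace U"
    and sep: "\<And>w. w \<in> U \<Longrightarrow> (\<And>p. p \<in> I \<Longrightarrow> f p w = 0) \<Longrightarrow> w = 0"
    and L: "L = {w \<in> U. \<forall>p\<in>I. f p w \<in> \<int>}"
    and C: "C = {w \<in> U. \<forall>p\<in>I. 0 \<le> f p w}"
  shows "lattice_basis (b ` I) L" "C = convex_cone hull (b ` I)"
proof -
  have inj: "inj_on b I"
    by (rule inj_onI) (metis dual one_neq_zero)
  have f_comb: "f q (\<Sum>p\<in>I. c p *\<^sub>R b p) = c q" if "q \<in> I" for c q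
  proof -
    have "f q (\<Sum>p\<in>I. c p *\<^sub>R b p) = (\<Sum>p\<in>I. c p * f q (b p))"
      using lin[OF that] by (simp add: linear_sum linear_scale)
    also have "\<dots> = (\<Sum>p\<in>I. if p = q then c p else 0)"
      using that by (intro sum.cong) (auto simp: dual)
    finally show ?thesis using finI that by simp
  qed
  have comb_U: "(\<Sum>p\<in>I. c p *\<^sub>R b p) \<in> U" for c
    using U bU by (intro subspace_sum subspace_scale) auto
  have rep: "w = (\<Sum>p\<in>I. f p w *\<^sub>R b p)" if w: "w \<in> U" for w
  proof -
    have "w - (\<Sum>p\<in>I. f p w *\<^sub>R b p) = 0"
    proof (rule sep)
      show "w - (\<Sum>p\<in>I. f p w *\<^sub>R b p) \<in> U" using w comb_U U by (intro subspace_diff)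
      fix q assume "q \<in> I"
      then show "f q (w - (\<Sum>p\<in>I. f p w *\<^sub>R b p)) = 0"
        using lin f_comb by (simp add: linear_diff)
    qed
    then show ?thesis by simp
  qed
  have reindex: "(\<Sum>x\<in>b ` I. c x *\<^sub>R x) = (\<Sum>p\<in>I. c (b p) *\<^sub>R b p)" for c
    by (simp add: sum.reindex[OF inj])
  have "independent (b ` I)"
  proof (rule independent_if_scalars_zero)
    fix c x assume "(\<Sum>x\<in>b ` I. c x *\<^sub>R x) = 0" "x \<in> b ` I"
    then obtain q where q: "q \<in> I" "x = b q" and "(\<Sum>p\<in>I. c (b p) *\<^sub>R b p) = 0"
      by (auto simp: reindex)
    then have "f q (\<Sum>p\<in>I. c (b p) *\<^sub>R b p) = f q 0" by simp
    then show "c x = 0" using q f_comb[of q "\<lambda>p. c (b p)"] lin[of q] by (simp add: linear_0)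
  qed (use finI in auto)
  moreover have "L = {\<Sum>x\<in>b ` I. of_int (c x) *\<^sub>R x | c :: 'a \<Rightarrow> int. True}"
  proof (intro equalityI subsetI)
    fix w assume "w \<in> L"
    then have w: "w \<in> U" "\<And>p. p \<in> I \<Longrightarrow> f p w \<in> \<int>" by (auto simp: L)
    \<comment> \<open>The value is an integer for lattice points, so the floor is exact;
      \<open>the_inv_into\<close> passes from coefficients on indices to coefficients on
      vectors.\<close>
    define c where "c x = \<lfloor>f (the_inv_into I b x) w\<rfloor>" for x
    have "f p w = of_int (c (b p))" if "p \<in> I" for p
      using w(2)[OF that] that by (auto simp: c_def the_inv_into_f_f[OF inj] elim: Ints_cases)
    then have "w = (\<Sum>x\<in>b ` I. of_int (c x) *\<^sub>R x)"
      unfolding reindex by (subst rep[OF w(1)]) simp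
    then show "w \<in> {\<Sum>x\<in>b ` I. of_int (c x) *\<^sub>R x | c :: 'a \<Rightarrow> int. True}" by blast
  next
    fix w assume "w \<in> {\<Sum>x\<in>b ` I. of_int (c x) *\<^sub>R x | c :: 'a \<Rightarrow> int. True}"
    then obtain c :: "'a \<Rightarrow> int" where "w = (\<Sum>x\<in>b ` I. of_int (c x) *\<^sub>R x)" by blast
    then have "w = (\<Sum>p\<in>I. of_int (c (b p)) *\<^sub>R b p)" by (simp only: reindex)
    then show "w \<in> L" by (simp add: L comb_U f_comb)
  qed
  ultimately show "lattice_basis (b ` I) L"
    using finI by (simp add: lattice_basis_def)
  show "C = convex_cone hull (b ` I)"
    unfolding convex_cone_hull_finite[OF finite_imageI[OF finI]] reindex
  proof (intro equalityI subsetI)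
    fix w assume "w \<in> C"
    then have w: "w \<in> U" "\<And>p. p \<in> I \<Longrightarrow> 0 \<le> f p w" by (auto simp: C)
    show "w \<in> {\<Sum>p\<in>I. c (b p) *\<^sub>R b p | c. \<forall>x\<in>b ` I. 0 \<le> c x}"
    proof (intro CollectI exI conjI)
      show "w = (\<Sum>p\<in>I. f (the_inv_into I b (b p)) w *\<^sub>R b p)"
        using rep[OF w(1)] by (simp add: the_inv_into_f_f[OF inj])
    qed (use w(2) in \<open>auto simp: the_inv_into_f_f[OF inj]\<close>)
  next
    fix w assume "w \<in> {\<Sum>p\<in>I. c (b p) *\<^sub>R b p | c. \<forall>x\<in>b ` I. 0 \<le> c x}"
    then show "w \<in> C" by (auto simp: C comb_U f_comb)
  qed
qed

text \<open>Equation \<open>p\<close> involves, besides the unknown \<open>p\<close> with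
  coefficient 1, only unknowns of smaller rank. Solving by rank needs no division, so integral
  right-hand sides give integral solutions. The lemma serves both the point \<open>x_of\<close> and
  the dual lattice basis.\<close>

lemma triangular_system:
  fixes c :: "nat \<times> nat \<Rightarrow> real" and rank :: "nat \<times> nat \<Rightarrow> nat"
  assumes fin: "finite I" and sub: "\<And>p. p \<in> I \<Longrightarrow> H p \<subseteq> I" and self: "\<And>p. p \<in> I \<Longrightarrow> p \<in> H p"
    and rank: "\<And>p q. p \<in> I \<Longrightarrow> q \<in> H p \<Longrightarrow> q \<noteq> p \<Longrightarrow> rank q < rank p"
  shows triangular_system_unique: "\<lbrakk>x \<in> coord_space I; y \<in> coord_space I;
      \<And>p. p \<in> I \<Longrightarrow> (\<Sum>q\<in>H p. coef x q) = (\<Sum>q\<in>H p. coef y q)\<rbrakk> \<Longrightarrow> x = y"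
    and triangular_system_exists: "\<exists>x \<in> coord_space I. (\<forall>p\<in>I. (\<Sum>q\<in>H p. coef x q) = c p) \<and>
      ((\<forall>p\<in>I. c p \<in> \<int>) \<longrightarrow> (\<forall>p. coef x p \<in> \<int>))"
proof -
  have finH: "finite (H p)" if "p \<in> I" for p
    using fin sub[OF that] finite_subset by blast
  have split: "(\<Sum>q\<in>H p. g q) = g p + (\<Sum>q\<in>H p - {p}. g q)" if "p \<in> I" for p and g :: "_ \<Rightarrow> real"
    using sum.remove[OF finH[OF that] self[OF that]] .
  {
    assume xy: "x \<in> coord_space I" "y \<in> coord_space I"
      "\<And>p. p \<in> I \<Longrightarrow> (\<Sum>q\<in>H p. coef x q) = (\<Sum>q\<in>H p. coef y q)"
    have "p \<in> I \<Longrightarrow> coef x p = coef y p" for p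
    proof (induction "rank p" arbitrary: p rule: less_induct)
      case less
      have "(\<Sum>q\<in>H p - {p}. coef x q) = (\<Sum>q\<in>H p - {p}. coef y q)"
        using less sub[OF less(2)] rank[OF less(2)] by (intro sum.cong) auto
      then show ?case using xy(3)[OF less(2)] split[OF less(2)] by simp
    qed
    then show "x = y" using xy coord_space_eqI by blast
  }
  have "\<exists>x \<in> coord_space I. (\<forall>p\<in>I. rank p < N \<longrightarrow> (\<Sum>q\<in>H p. coef x q) = c p) \<and>
      ((\<forall>p\<in>I. c p \<in> \<int>) \<longrightarrow> (\<forall>p. coef x p \<in> \<int>))" for N
  proof (induction N)
    case 0
    have "0 \<in> coord_space I" by (simp add: coord_space_def)
    then show ?case by (intro bexI[of _ 0]) simp_all
  next
    case (Suc N)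
    then obtain x where x: "x \<in> coord_space I" "\<forall>p\<in>I. rank p < N \<longrightarrow> (\<Sum>q\<in>H p. coef x q) = c p"
      "(\<forall>p\<in>I. c p \<in> \<int>) \<longrightarrow> (\<forall>p. coef x p \<in> \<int>)" by blast
    \<comment> \<open>Equations of rank below \<open>N\<close> see only coordinates of rank below
      \<open>N\<close>, so overwriting those of rank \<open>N\<close> leaves them valid.\<close>
    define y where "y = point_of I (\<lambda>p. if rank p = N then c p - (\<Sum>q\<in>H p - {p}. coef x q) else coef x p)"
    have y: "coef y p = (if p \<in> I then if rank p = N then c p - (\<Sum>q\<in>H p - {p}. coef x q) else coef x p else 0)"
      for p by (simp add: y_def coef_point_of[OF fin])
    have "(\<Sum>q\<in>H p. coef y q) = c p" if p: "p \<in> I" "rank p < Suc N" for p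
    proof -
      have "(\<Sum>q\<in>H p - {p}. coef y q) = (\<Sum>q\<in>H p - {p}. coef x q)"
      proof (intro sum.cong refl)
        fix q assume "q \<in> H p - {p}"
        then have "q \<in> I" "rank q < N" using sub[OF p(1)] rank[OF p(1), of q] p(2) by auto
        then show "coef y q = coef x q" by (simp add: y)
      qed
      then show ?thesis
        using p x(2) split[OF p(1)] by (auto simp: y less_Suc_eq)
    qed
    moreover have "(\<forall>p\<in>I. c p \<in> \<int>) \<longrightarrow> (\<forall>p. coef y p \<in> \<int>)"
      using x(3) by (auto simp: y intro!: Ints_diff Ints_sum)
    ultimately show ?case
      using point_of_in_coord_space[OF fin] y_def by blast
  qed
  from this[of "Suc (Max (rank ` I))"]
  show "\<exists>x \<in> coord_space I. (\<forall>p\<in>I. (\<Sum>q\<in>H p. coef x q) = c p) \<and>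
      ((\<forall>p\<in>I. c p \<in> \<int>) \<longrightarrow> (\<forall>p. coef x p \<in> \<int>))"
    using fin by (auto simp: less_Suc_eq_le)
qed

section \<open>Dyck paths by levels\<close>

text \<open>A path meets each antidiagonal level \<open>i + j = l\<close> at most once, so it is recorded by the
  function \<open>g\<close> sending \<open>l\<close> to the row in which the path crosses that level.  The levels run from
  \<open>2 i + 1\<close> to \<open>2 m + 1\<close> and the bound is \<open>a\<^sub>i + \<dots> + a\<^sub>m\<close>, also when the path ends on the antidiagonal
  (then \<open>m = n\<close>).\<close>

definition level_path :: "nat \<Rightarrow> nat \<Rightarrow> nat \<Rightarrow> (nat \<Rightarrow> nat) \<Rightarrow> bool" where
  "level_path n i m g \<longleftrightarrow> 1 \<le> i \<and> i \<le> m \<and> m \<le> n \<and> g (2*i+1) = i \<and>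
     (\<forall>l. 2*i+1 \<le> l \<and> l < 2*m+1 \<longrightarrow> g (Suc l) = g l \<or> g (Suc l) = Suc (g l)) \<and>
     (\<forall>l. 2*i+1 \<le> l \<and> l \<le> 2*m+1 \<longrightarrow> 2 * g l < l) \<and> (m < n \<longrightarrow> g (2*m+1) = m)"

definition track :: "nat \<Rightarrow> nat \<Rightarrow> (nat \<Rightarrow> nat) \<Rightarrow> (nat \<times> nat) set" where
  "track i m g = {(p, q). 2*i+1 \<le> p + q \<and> p + q \<le> 2*m+1 \<and> g (p + q) = p}"

definition dyck_set :: "nat \<Rightarrow> nat \<Rightarrow> nat \<Rightarrow> (nat \<times> nat) set \<Rightarrow> bool" where
  "dyck_set n i m D \<longleftrightarrow> (\<exists>g. level_path n i m g \<and> D = track i m g)"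

lemma level_path_mono:
  assumes "level_path n i m g" "2*i+1 \<le> l" "l \<le> l'" "l' \<le> 2*m+1"
  shows "g l \<le> g l'" "g l' \<le> g l + (l' - l)"
proof -
  have "l' \<le> 2*m+1 \<longrightarrow> g l \<le> g l' \<and> g l' \<le> g l + (l' - l)"
    using assms(3)
  proof (induction l' rule: dec_induct)
    case (step k)
    then have "k < 2*m+1 \<longrightarrow> g (Suc k) = g k \<or> g (Suc k) = Suc (g k)"
      using assms(1,2) by (auto simp: level_path_def)
    then show ?case using step by auto
  qed simp
  then show "g l \<le> g l'" "g l' \<le> g l + (l' - l)" using assms(4) by auto
qed

lemma level_path_ge: "level_path n i m g \<Longrightarrow> 2*i+1 \<le> l \<Longrightarrow> l \<le> 2*m+1 \<Longrightarrow> i \<le> g l"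
  using level_path_mono(1)[of n i m g "2*i+1" l] by (simp add: level_path_def)

lemma track_eq_image:
  assumes "level_path n i m g"
  shows "track i m g = (\<lambda>l. (g l, l - g l)) ` {2*i+1..2*m+1}"
proof (intro equalityI subsetI)
  fix r assume "r \<in> track i m g"
  then obtain p q where "r = (p, q)" "2*i+1 \<le> p + q" "p + q \<le> 2*m+1" "g (p + q) = p"
    by (auto simp: track_def)
  then show "r \<in> (\<lambda>l. (g l, l - g l)) ` {2*i+1..2*m+1}"
    by (intro image_eqI[of _ _ "p + q"]) auto
next
  fix r assume "r \<in> (\<lambda>l. (g l, l - g l)) ` {2*i+1..2*m+1}"
  then obtain l where l: "r = (g l, l - g l)" "2*i+1 \<le> l" "l \<le> 2*m+1" by auto
  then have "2 * g l < l" using assms by (simp add: level_path_def)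
  then have "g l + (l - g l) = l" by linarith
  then show "r \<in> track i m g" using l by (simp add: track_def)
qed

lemma sum_track:
  assumes "level_path n i m g"
  shows "(\<Sum>r\<in>track i m g. f r) = (\<Sum>l=2*i+1..2*m+1. f (g l, l - g l))"
proof -
  have "inj_on (\<lambda>l. (g l, l - g l)) {2*i+1..2*m+1}"
  proof (rule inj_onI)
    fix k l assume "k \<in> {2*i+1..2*m+1}" "l \<in> {2*i+1..2*m+1}" and eq: "(g k, k - g k) = (g l, l - g l)"
    then have "2 * g k < k" "2 * g l < l" using assms by (auto simp: level_path_def)
    moreover have "g k = g l" "k - g k = l - g l" using eq by auto
    ultimately show "k = l" by linarith
  qed
  then show ?thesis by (simp add: track_eq_image[OF assms] sum.reindex)
qed

lemma finite_index_C: "finite (index_C n)"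
  by (rule finite_subset[of _ "{..2*n+1} \<times> {..2*n+1}"]) (auto simp: index_C_def)

lemma track_subset:
  assumes "level_path n i m g"
  shows "track i m g \<subseteq> index_C n"
proof safe
  fix p q assume "(p, q) \<in> track i m g"
  then have l: "2*i+1 \<le> p + q" "p + q \<le> 2*m+1" "g (p + q) = p" by (auto simp: track_def)
  have "i \<le> p" using level_path_ge[OF assms l(1,2)] l(3) by simp
  moreover have "2 * p < p + q" using assms l unfolding level_path_def by metis
  moreover have "1 \<le> i" "m \<le> n" using assms by (auto simp: level_path_def)
  ultimately show "(p, q) \<in> index_C n" using l by (auto simp: index_C_def)
qed

lemma level_path_list:
  assumes g: "level_path n i m g"
  defines "d \<equiv> map (\<lambda>l. (g l, l - g l)) [2*i+1..<2*m+2]"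
  shows "dyck_path_C n d" "path_sum x d = (\<Sum>r\<in>track i m g. coef x r)"
    "path_bound n a d = (\<Sum>k=i..m. a k)"
proof -
  have im: "1 \<le> i" "i \<le> m" "m \<le> n" and gi: "g (2*i+1) = i" and gm: "m < n \<Longrightarrow> g (2*m+1) = m"
    and step: "\<And>l. 2*i+1 \<le> l \<Longrightarrow> l < 2*m+1 \<Longrightarrow> g (Suc l) = g l \<or> g (Suc l) = Suc (g l)"
    and less: "\<And>l. 2*i+1 \<le> l \<Longrightarrow> l \<le> 2*m+1 \<Longrightarrow> 2 * g l < l"
    using g by (auto simp: level_path_def)
  have ne: "d \<noteq> []" using im by (simp add: d_def del: upt_Suc)
  have hd: "hd d = (i, i + 1)" using im gi by (simp add: d_def hd_map del: upt_Suc)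
  have last: "last d = (g (2*m+1), 2*m+1 - g (2*m+1))" using im by (simp add: d_def last_map)
  have setd: "set d = track i m g"
    by (auto simp: d_def track_eq_image[OF g] simp del: upt_Suc)
  have lm: "2 * g (2*m+1) < 2*m+1" using less[of "2*m+1"] im by simp
  show "dyck_path_C n d"
    unfolding dyck_path_C_def
  proof (intro conjI)
    show "set d \<subseteq> index_C n" using setd track_subset[OF g] by simp
    show "snd (hd d) = fst (hd d) + 1" by (simp add: hd)
    show "successively (\<lambda>(i, j) q. q = (i + 1, j) \<or> q = (i, j + 1)) d"
      unfolding successively_conv_nth
    proof (intro allI impI)
      fix t assume t: "Suc t < length d"
      then have "Suc t < 2*m+2 - (2*i+1)" by (simp add: d_def del: upt_Suc)
      moreover define l where "l = 2*i+1 + t"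
      ultimately have l: "2*i+1 \<le> l" "l < 2*m+1" by auto
      have nth: "d ! t = (g l, l - g l)" "d ! Suc t = (g (Suc l), Suc l - g (Suc l))"
        using t by (simp_all add: d_def l_def del: upt_Suc)
      have "2 * g l < l" using less[of l] l by simp
      then show "(case d ! t of (i, j) \<Rightarrow> \<lambda>q. q = (i + 1, j) \<or> q = (i, j + 1)) (d ! Suc t)"
        using step[OF l] by (auto simp: nth)
    qed
    show "snd (last d) = fst (last d) + 1 \<or> fst (last d) + snd (last d) = 2 * n + 1"
      using gm im lm by (cases "m < n") (auto simp: last)
  qed (use ne in simp)
  have "path_sum x d = (\<Sum>l\<leftarrow>[2*i+1..<2*m+2]. coef x (g l, l - g l))"
    by (simp add: path_sum_def d_def comp_def del: upt_Suc)
  also have "\<dots> = (\<Sum>l=2*i+1..2*m+1. coef x (g l, l - g l))"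
    by (subst sum_list_distinct_conv_sum_set)
      (auto simp del: upt_Suc sum.op_ivl_Suc sum.cl_ivl_Suc intro!: sum.cong)
  finally show "path_sum x d = (\<Sum>r\<in>track i m g. coef x r)" by (simp add: sum_track[OF g])
  show "path_bound n a d = (\<Sum>k=i..m. a k)"
  proof (cases "snd (last d) = fst (last d) + 1")
    case True
    then have "g (2*m+1) = m" using lm by (simp add: last)
    then show ?thesis using True by (simp add: path_bound_def hd last)
  next
    case False
    then have "m = n" using gm im by (cases "m < n") (auto simp: last)
    then show ?thesis using False by (simp add: path_bound_def hd)
  qed
qed

lemma dyck_path_level:
  assumes "dyck_path_C n d"
  obtains i m g where "level_path n i m g" "d = map (\<lambda>l. (g l, l - g l)) [2*i+1..<2*m+2]"
proof -
  have ne: "d \<noteq> []" and sub: "set d \<subseteq> index_C n" and hd: "snd (hd d) = fst (hd d) + 1"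
    and step: "\<And>t. Suc t < length d \<Longrightarrow> d ! Suc t = (fst (d ! t) + 1, snd (d ! t)) \<or> d ! Suc t = (fst (d ! t), snd (d ! t) + 1)"
    and last: "snd (last d) = fst (last d) + 1 \<or> fst (last d) + snd (last d) = 2 * n + 1"
    using assms by (auto simp: dyck_path_C_def successively_conv_nth case_prod_beta)
  define i where "i = fst (hd d)"
  define g where "g l = fst (d ! (l - (2*i+1)))" for l
  have lev: "t < length d \<Longrightarrow> fst (d ! t) + snd (d ! t) = 2*i+1 + t" for t
  proof (induction t)
    case 0
    then show ?case using hd ne by (simp add: i_def hd_conv_nth)
  next
    case (Suc t)
    then show ?case using step[of t] by auto
  qed
  have idx: "1 \<le> fst (d ! t) \<and> fst (d ! t) < snd (d ! t) \<and> fst (d ! t) + snd (d ! t) \<le> 2*n+1" if "t < length d" for t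
    using sub nth_mem[OF that] by (auto simp: index_C_def case_prod_beta)
  define N where "N = length d - 1"
  have N: "length d = Suc N" "last d = d ! N" using ne by (simp_all add: N_def last_conv_nth)
  \<comment> \<open>The final level is odd: it is \<open>2*m+1\<close> with \<open>m\<close> the
    last row if the path ends next to the diagonal, and \<open>2*n+1\<close> if it ends on the
    antidiagonal.\<close>
  obtain m where m: "2*m+1 = 2*i+1 + N" "m < n \<Longrightarrow> fst (last d) = m" "m \<le> n"
  proof (cases "snd (last d) = fst (last d) + 1")
    case True
    then show ?thesis
      using lev[of N] idx[of N] N by (intro that[of "fst (last d)"]) auto
  next
    case False
    then show ?thesis
      using lev[of N] last N by (intro that[of n]) auto
  qed
  have g: "g (2*i+1 + t) = fst (d ! t)" for t by (simp add: g_def)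
  have i: "1 \<le> i" using idx[of 0] ne by (simp add: i_def hd_conv_nth)
  have "level_path n i m g"
    unfolding level_path_def
  proof (intro conjI allI impI)
    show "i \<le> m" using m by simp
    show "g (2*i+1) = i" using ne by (simp add: g_def i_def hd_conv_nth)
  next
    fix l assume l: "2*i+1 \<le> l \<and> l < 2*m+1"
    then obtain t where t: "l = 2*i+1 + t" using le_Suc_ex by blast
    then show "g (Suc l) = g l \<or> g (Suc l) = Suc (g l)"
      using step[of t] l m N g[of t] g[of "Suc t"] by auto
  next
    fix l assume l: "2*i+1 \<le> l \<and> l \<le> 2*m+1"
    then obtain t where t: "l = 2*i+1 + t" using le_Suc_ex by blast
    then show "2 * g l < l"
      using l m(1) N g[of t] lev[of t] idx[of t] by auto
  next
    assume "m < n"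
    then show "g (2*m+1) = m" using m N by (simp add: g_def)
  qed (use i m in auto)
  moreover have "d = map (\<lambda>l. (g l, l - g l)) [2*i+1..<2*m+2]"
  proof (rule nth_equalityI)
    show "length d = length (map (\<lambda>l. (g l, l - g l)) [2*i+1..<2*m+2])" using m N by (simp del: upt_Suc)
    fix t assume t: "t < length d"
    have "map (\<lambda>l. (g l, l - g l)) [2*i+1..<2*m+2] ! t = (g (2*i+1+t), 2*i+1+t - g (2*i+1+t))"
      using m N t by (simp del: upt_Suc)
    then show "d ! t = map (\<lambda>l. (g l, l - g l)) [2*i+1..<2*m+2] ! t"
      using g[of t] lev[OF t] by (simp add: prod_eq_iff del: upt_Suc)
  qed
  ultimately show ?thesis using that by blast
qed

text \<open>Sets replace lists because the later exchanges insert, delete and recombine points;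
  nothing is lost, since a path visits each level once and hence no point twice.\<close>

lemma FFLV_C_eq:
  "FFLV_C n a = {x \<in> coord_space (index_C n). (\<forall>p\<in>index_C n. 0 \<le> coef x p) \<and>
     (\<forall>i m D. dyck_set n i m D \<longrightarrow> (\<Sum>p\<in>D. coef x p) \<le> (\<Sum>k=i..m. real (a k)))}"
proof -
  have "(\<forall>d. dyck_path_C n d \<longrightarrow> path_sum x d \<le> real (path_bound n a d)) \<longleftrightarrow>
    (\<forall>i m D. dyck_set n i m D \<longrightarrow> (\<Sum>p\<in>D. coef x p) \<le> (\<Sum>k=i..m. real (a k)))" for x
  proof (intro iffI allI impI)
    fix i m D assume *: "\<forall>d. dyck_path_C n d \<longrightarrow> path_sum x d \<le> real (path_bound n a d)"
      and "dyck_set n i m D"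
    then obtain g where g: "level_path n i m g" "D = track i m g" by (auto simp: dyck_set_def)
    then show "(\<Sum>p\<in>D. coef x p) \<le> (\<Sum>k=i..m. real (a k))"
      using level_path_list(1)[OF g(1)] level_path_list(2)[OF g(1), of x]
        level_path_list(3)[OF g(1), of a] * by (metis of_nat_sum)
  next
    fix d assume *: "\<forall>i m D. dyck_set n i m D \<longrightarrow> (\<Sum>p\<in>D. coef x p) \<le> (\<Sum>k=i..m. real (a k))"
      and "dyck_path_C n d"
    then obtain i m g where g: "level_path n i m g" "d = map (\<lambda>l. (g l, l - g l)) [2*i+1..<2*m+2]"
      using dyck_path_level by blast
    then have "(\<Sum>p\<in>track i m g. coef x p) \<le> (\<Sum>k=i..m. real (a k))"
      using * dyck_set_def by blast
    then show "path_sum x d \<le> real (path_bound n a d)"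
      using level_path_list(2)[OF g(1), of x] level_path_list(3)[OF g(1), of a] g(2)
      by (simp del: upt_Suc)
  qed
  then show ?thesis by (auto simp: FFLV_C_def)
qed

lemma dyck_set_range: "dyck_set n i m D \<Longrightarrow> 1 \<le> i \<and> i \<le> m \<and> m \<le> n"
  by (auto simp: dyck_set_def level_path_def)

lemma dyck_set_subset: "dyck_set n i m D \<Longrightarrow> D \<subseteq> index_C n"
  by (auto simp: dyck_set_def dest: track_subset)

lemma dyck_set_finite: "dyck_set n i m D \<Longrightarrow> finite D"
  by (rule finite_subset[OF dyck_set_subset finite_index_C])

lemma finite_dyck_sets: "finite {D. \<exists>i m. dyck_set n i m D}"
  by (rule finite_subset[of _ "Pow (index_C n)"]) (auto simp: finite_index_C dest: dyck_set_subset)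

lemma dyck_set_level: "dyck_set n i m D \<Longrightarrow> (p, q) \<in> D \<Longrightarrow> 2*i+1 \<le> p + q \<and> p + q \<le> 2*m+1"
  by (auto simp: dyck_set_def track_def)

lemma dyck_set_level_unique: "dyck_set n i m D \<Longrightarrow> (p, q) \<in> D \<Longrightarrow> (p', q') \<in> D \<Longrightarrow> p + q = p' + q' \<Longrightarrow> p' = p \<and> q' = q"
  by (auto simp: dyck_set_def track_def)

lemma dyck_set_level_ex:
  assumes "dyck_set n i m D" "2*i+1 \<le> l" "l \<le> 2*m+1"
  obtains p q where "(p, q) \<in> D" "p + q = l"
proof -
  obtain g where g: "level_path n i m g" "D = track i m g" using assms by (auto simp: dyck_set_def)
  have "2 * g l < l" using g(1) assms by (simp add: level_path_def)
  then have "(g l, l - g l) \<in> D" "g l + (l - g l) = l"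
    using g assms by (auto simp: track_def)
  then show ?thesis using that by blast
qed

lemma dyck_set_mono:
  assumes "dyck_set n i m D" "(p, q) \<in> D" "(p', q') \<in> D" "p + q \<le> p' + q'"
  shows "p \<le> p' \<and> q \<le> q'"
proof -
  obtain g where g: "level_path n i m g" "D = track i m g" using assms by (auto simp: dyck_set_def)
  then have "g (p + q) = p" "g (p' + q') = p'" "2*i+1 \<le> p + q" "p' + q' \<le> 2*m+1"
    using assms by (auto simp: track_def)
  then show ?thesis using level_path_mono[OF g(1), of "p + q" "p' + q'"] assms(4) by auto
qed

lemma dyck_set_start: "dyck_set n i m D \<Longrightarrow> (i, Suc i) \<in> D"
  by (auto simp: dyck_set_def level_path_def track_def mult_2)

lemma dyck_set_end: "dyck_set n i m D \<Longrightarrow> m < n \<Longrightarrow> (m, Suc m) \<in> D"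
  by (auto simp: dyck_set_def level_path_def track_def mult_2)

lemma dyck_set_next:
  assumes "dyck_set n i m D" "(p, q) \<in> D" "p + q < 2*m+1"
  shows "(p, Suc q) \<in> D \<longleftrightarrow> (Suc p, q) \<notin> D"
proof -
  obtain g where g: "level_path n i m g" "D = track i m g" using assms by (auto simp: dyck_set_def)
  then have "2*i+1 \<le> p + q" "g (p + q) = p" using assms by (auto simp: track_def)
  then have "g (Suc (p + q)) = p \<or> g (Suc (p + q)) = Suc p"
    using g(1) assms(3) unfolding level_path_def by metis
  then show ?thesis using assms(3) \<open>2*i+1 \<le> p + q\<close> by (auto simp: g(2) track_def)
qed

lemma dyck_set_prev:
  assumes "dyck_set n i m D" "(p, q) \<in> D" "2*i+1 < p + q"
  shows "(p, q - 1) \<in> D \<longleftrightarrow> (p - 1, q) \<notin> D"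
proof -
  obtain g where g: "level_path n i m g" "D = track i m g" using assms by (auto simp: dyck_set_def)
  then have l: "p + q \<le> 2*m+1" "g (p + q) = p" using assms by (auto simp: track_def)
  have pq: "1 \<le> p" "1 \<le> q" using dyck_set_subset[OF assms(1)] assms(2) by (auto simp: index_C_def)
  obtain k where k: "p + q = Suc k" using assms(3) by (cases "p + q") auto
  have "g (Suc k) = g k \<or> g (Suc k) = Suc (g k)"
    using g(1) k l assms(3) unfolding level_path_def by (metis Suc_le_eq less_Suc_eq_le)
  then have "g k = p \<or> g k = p - 1" using l(2) k pq by auto
  moreover have "p + (q - 1) = k" "p - 1 + q = k" using k pq by auto
  then have "(p, q - 1) \<in> D \<longleftrightarrow> g k = p" "(p - 1, q) \<in> D \<longleftrightarrow> g k = p - 1"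
    using assms(3) k l(1) by (simp_all add: g(2) track_def)
  moreover have "p - 1 \<noteq> p" using pq by simp
  ultimately show ?thesis by metis
qed

text \<open>Both paths meet every level of the same range exactly once, so an inclusion leaves no
  room. A path is thus identified by one inclusion.\<close>

lemma dyck_set_subset_eq:
  assumes "dyck_set n i m D" "dyck_set n i m D'" "D' \<subseteq> D"
  shows "D' = D"
proof
  show "D \<subseteq> D'"
  proof safe
    fix p q assume pq: "(p, q) \<in> D"
    then obtain p' q' where "(p', q') \<in> D'" "p' + q' = p + q"
      using dyck_set_level_ex[OF assms(2)] dyck_set_level[OF assms(1)] by metis
    then show "(p, q) \<in> D'"
      using dyck_set_level_unique[OF assms(1) pq, of p' q'] assms(3) by auto
  qed
qed fact

section \<open>Exchanging tails, flipping corners, cutting and gluing at the diagonal\<close>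

definition join :: "nat \<Rightarrow> (nat \<times> nat) set \<Rightarrow> (nat \<times> nat) set \<Rightarrow> (nat \<times> nat) set" where
  "join l D D' = {(p, q). (p, q) \<in> D \<and> p + q \<le> l \<or> (p, q) \<in> D' \<and> l \<le> p + q}"

lemma dyck_set_join:
  assumes "dyck_set n i m D" "dyck_set n i' m' D'" "(p, q) \<in> D" "(p, q) \<in> D'"
  shows "dyck_set n i m' (join (p + q) D D')"
proof -
  obtain g where g: "level_path n i m g" "D = track i m g" using assms by (auto simp: dyck_set_def)
  obtain g' where g': "level_path n i' m' g'" "D' = track i' m' g'" using assms by (auto simp: dyck_set_def)
  let ?h = "\<lambda>k. if k \<le> p + q then g k else g' k"
  have l: "2*i+1 \<le> p + q" "p + q \<le> 2*m+1" "g (p + q) = p"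
    "2*i'+1 \<le> p + q" "p + q \<le> 2*m'+1" "g' (p + q) = p"
    using assms by (auto simp: g(2) g'(2) track_def)
  have gi: "1 \<le> i" "m' \<le> n" "g (2*i+1) = i" using g(1) g'(1) by (auto simp: level_path_def)
  have "level_path n i m' ?h"
    unfolding level_path_def
  proof (intro conjI allI impI)
    fix k assume k: "2*i+1 \<le> k \<and> k < 2*m'+1"
    show "?h (Suc k) = ?h k \<or> ?h (Suc k) = Suc (?h k)"
    proof (cases "k < p + q")
      case True
      then show ?thesis using g(1) k l(2) by (auto simp: level_path_def)
    next
      case False
      then have "g' (Suc k) = g' k \<or> g' (Suc k) = Suc (g' k)"
        using g'(1) k l(4) by (auto simp: level_path_def)
      then show ?thesis using False l(3,6) by (cases "k = p + q") auto
    qed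
  next
    fix k assume k: "2*i+1 \<le> k \<and> k \<le> 2*m'+1"
    show "2 * ?h k < k"
    proof (cases "k \<le> p + q")
      case True
      then show ?thesis using g(1) k l(2) by (auto simp: level_path_def)
    next
      case False
      then show ?thesis using g'(1) k l(4) by (auto simp: level_path_def)
    qed
  next
    assume "m' < n"
    then have "g' (2*m'+1) = m'" using g'(1) by (simp add: level_path_def)
    then show "?h (2*m'+1) = m'" using l(3,5,6) by (cases "p + q = 2*m'+1") auto
  qed (use gi l in auto)
  moreover have "join (p + q) D D' = track i m' ?h"
    using l by (auto simp: join_def g(2) g'(2) track_def not_le)
  ultimately show ?thesis unfolding dyck_set_def by blast
qed

text \<open>The two joins only swap the tails beyond the common point, so both pairs of paths have
  the same points counted with multiplicity.\<close>

lemma sum_join: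
  fixes f :: "nat \<times> nat \<Rightarrow> real"
  assumes "dyck_set n i m D" "dyck_set n i' m' D'" "(p, q) \<in> D" "(p, q) \<in> D'"
  shows "sum f (join (p + q) D D') + sum f (join (p + q) D' D) = sum f D + sum f D'"
proof -
  define A where "A X = {(x, y) \<in> X. x + y \<le> p + q}" for X
  define B where "B X = {(x, y) \<in> X. p + q < x + y}" for X
  have fin: "finite D" "finite D'" using assms dyck_set_finite by blast+
  have finAB: "finite (A X)" "finite (B X)" if "finite X" for X
    by (rule finite_subset[OF _ that]; auto simp: A_def B_def)+
  have disj: "A X \<inter> B Y = {}" for X Y by (auto simp: A_def B_def)
  have AB: "X = A X \<union> B X" for X by (auto simp: A_def B_def)
  have split: "sum f X = sum f (A X) + sum f (B X)" if "finite X" for X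
    by (subst AB, rule sum.union_disjoint) (use finAB that disj in auto)
  have j: "join (p + q) X Y = A X \<union> B Y"
    if "(p, q) \<in> X" "(p, q) \<in> Y" and Y: "dyck_set n i m Y" for X Y i m
  proof -
    have "(x, y) \<in> A X" if xy: "(x, y) \<in> Y" "x + y = p + q" for x y
      using dyck_set_level_unique[OF Y \<open>(p, q) \<in> Y\<close> xy(1)] xy(2) \<open>(p, q) \<in> X\<close> by (simp add: A_def)
    then show ?thesis
      unfolding join_def set_eq_iff by (auto simp: A_def B_def le_less)
  qed
  have "sum f (A X \<union> B Y) = sum f (A X) + sum f (B Y)" if "finite X" "finite Y" for X Y
    by (rule sum.union_disjoint) (use finAB that disj in auto)
  then show ?thesis using split fin j[OF assms(3,4,2)] j[OF assms(4,3,1)] by simp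
qed

text \<open>Moving one point along its level is a local change: only the adjacency with its two
  neighbours has to be checked. The last alternative in \<open>nxt\<close> treats a final point on
  the antidiagonal, which has no successor and may lie anywhere on that level.\<close>

lemma dyck_set_update:
  assumes "dyck_set n i m D" "(p, q) \<in> D" "p' + q' = p + q" "2*i+1 < p + q" "p' < q'"
    and prev: "(p', q' - 1) \<in> D \<or> (p' - 1, q') \<in> D \<and> 1 \<le> p'"
    and nxt: "(p', Suc q') \<in> D \<or> (Suc p', q') \<in> D \<or> m = n \<and> p + q = 2*n+1"
  shows "dyck_set n i m (insert (p', q') (D - {(p, q)}))"
proof -
  obtain g where g: "level_path n i m g" "D = track i m g" using assms by (auto simp: dyck_set_def)
  define l where "l = p + q"
  let ?h = "g(l := p')"
  have gl: "g l = p" "2*i+1 < l" "l \<le> 2*m+1" using assms by (auto simp: g(2) track_def l_def)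
  obtain k where k: "l = Suc k" using gl(2) by (cases l) auto
  have gk: "g k = p' \<or> Suc (g k) = p'"
    using prev assms(3,5) k by (auto simp: g(2) track_def l_def)
  have gs: "l < 2*m+1 \<Longrightarrow> g (Suc l) = p' \<or> g (Suc l) = Suc p'"
    using nxt assms(3) by (auto simp: g(2) track_def l_def)
  have m: "l = 2*m+1 \<Longrightarrow> m = n"
    using nxt assms(3) by (auto simp: g(2) track_def l_def)
  have step: "g (Suc j) = g j \<or> g (Suc j) = Suc (g j)" if "2*i+1 \<le> j" "j < 2*m+1" for j
    using g(1) that by (auto simp: level_path_def)
  have "level_path n i m ?h"
    unfolding level_path_def
  proof (intro conjI allI impI)
    fix j assume j: "2*i+1 \<le> j \<and> j < 2*m+1"
    consider "j = l" | "Suc j = l" | "j \<noteq> l" "Suc j \<noteq> l" by blast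
    then show "?h (Suc j) = ?h j \<or> ?h (Suc j) = Suc (?h j)"
    proof cases
      case 1
      then show ?thesis using gs j by auto
    next
      case 2
      then show ?thesis using gk k by auto
    next
      case 3
      then show ?thesis using step j by simp
    qed
  next
    fix j assume "2*i+1 \<le> j \<and> j \<le> 2*m+1"
    then show "2 * ?h j < j" using g(1) assms(3,5) by (auto simp: level_path_def l_def)
  qed (use g(1) gl m in \<open>auto simp: level_path_def\<close>)
  moreover have "insert (p', q') (D - {(p, q)}) = track i m ?h"
    using gl assms(3) by (auto simp: g(2) track_def l_def)
  ultimately show ?thesis unfolding dyck_set_def by blast
qed

text \<open>The corner \<open>(p, Suc (Suc p))\<close> cannot be flipped, as
  \<open>(Suc p, Suc p)\<close> lies on the diagonal. Its neighbours are next to the diagonal,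
  however, so deleting it leaves two complete paths.\<close>

lemma dyck_set_split:
  assumes "dyck_set n i m D" "(p, Suc p) \<in> D" "(p, Suc (Suc p)) \<in> D" "(Suc p, Suc (Suc p)) \<in> D"
  shows "dyck_set n i p {(x, y) \<in> D. x + y < 2*p+2}" "dyck_set n (Suc p) m {(x, y) \<in> D. 2*p+2 < x + y}"
proof -
  obtain g where g: "level_path n i m g" "D = track i m g" using assms by (auto simp: dyck_set_def)
  have gp: "g (2*p+1) = p" "g (2 * Suc p + 1) = Suc p" "i \<le> p" "Suc p \<le> m"
    using assms by (auto simp: g(2) track_def mult_2)
  have all: "1 \<le> i" "m \<le> n" "g (2*i+1) = i" "m < n \<Longrightarrow> g (2*m+1) = m"
    "\<And>l. 2*i+1 \<le> l \<Longrightarrow> l < 2*m+1 \<Longrightarrow> g (Suc l) = g l \<or> g (Suc l) = Suc (g l)"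
    "\<And>l. 2*i+1 \<le> l \<Longrightarrow> l \<le> 2*m+1 \<Longrightarrow> 2 * g l < l"
    using g(1) unfolding level_path_def by blast+
  have "level_path n i p g"
    unfolding level_path_def using all gp(1,3,4) by (intro conjI allI impI all(5,6)) auto
  moreover have "level_path n (Suc p) m g"
    unfolding level_path_def using all(2,4) gp(2,3,4) by (intro conjI allI impI all(5,6)) auto
  moreover have "{(x, y) \<in> D. x + y < 2*p+2} = track i p g"
    using gp(4) by (auto simp: g(2) track_def)
  moreover have "{(x, y) \<in> D. 2*p+2 < x + y} = track (Suc p) m g"
    using gp(3) by (auto simp: g(2) track_def)
  ultimately show "dyck_set n i p {(x, y) \<in> D. x + y < 2*p+2}"
    "dyck_set n (Suc p) m {(x, y) \<in> D. 2*p+2 < x + y}"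
    unfolding dyck_set_def by blast+
qed

text \<open>The inverse of splitting: \<open>p < n\<close> forces the first path to end at
  \<open>(p, Suc p)\<close>, left of the inserted corner, and the second path starts just below that
  corner.\<close>

lemma dyck_set_concat:
  assumes "dyck_set n i p D" "dyck_set n (Suc p) m D'" "p < n"
  shows "dyck_set n i m (insert (p, Suc (Suc p)) (D \<union> D'))"
proof -
  obtain g where g: "level_path n i p g" "D = track i p g" using assms by (auto simp: dyck_set_def)
  obtain g' where g': "level_path n (Suc p) m g'" "D' = track (Suc p) m g'" using assms by (auto simp: dyck_set_def)
  let ?h = "\<lambda>k. if k \<le> 2*p+1 then g k else if k = 2*p+2 then p else g' k"
  have h: "1 \<le> i" "i \<le> p" "g (2*i+1) = i" "g (2*p+1) = p"
    "\<And>l. 2*i+1 \<le> l \<Longrightarrow> l < 2*p+1 \<Longrightarrow> g (Suc l) = g l \<or> g (Suc l) = Suc (g l)"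
    "\<And>l. 2*i+1 \<le> l \<Longrightarrow> l \<le> 2*p+1 \<Longrightarrow> 2 * g l < l"
    using g(1) assms(3) unfolding level_path_def by blast+
  have h': "Suc p \<le> m" "m \<le> n" "g' (2 * Suc p + 1) = Suc p" "m < n \<Longrightarrow> g' (2*m+1) = m"
    "\<And>l. 2 * Suc p + 1 \<le> l \<Longrightarrow> l < 2*m+1 \<Longrightarrow> g' (Suc l) = g' l \<or> g' (Suc l) = Suc (g' l)"
    "\<And>l. 2 * Suc p + 1 \<le> l \<Longrightarrow> l \<le> 2*m+1 \<Longrightarrow> 2 * g' l < l"
    using g'(1) unfolding level_path_def by blast+
  have "level_path n i m ?h"
    unfolding level_path_def
  proof (intro conjI allI impI)
    fix l assume l: "2*i+1 \<le> l \<and> l < 2*m+1"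
    consider "l < 2*p+1" | "l = 2*p+1" | "l = 2*p+2" | "2 * Suc p + 1 \<le> l" by force
    then show "?h (Suc l) = ?h l \<or> ?h (Suc l) = Suc (?h l)"
    proof cases
      case 1
      then show ?thesis using h(5)[of l] l by simp
    next
      case 2
      then show ?thesis using h(4) by simp
    next
      case 3
      then have "Suc l = 2 * Suc p + 1" by simp
      then have "g' (Suc l) = Suc p" using h'(3) by simp
      then show ?thesis using 3 by simp
    next
      case 4
      then show ?thesis using h'(5)[of l] l by simp
    qed
  next
    fix l assume l: "2*i+1 \<le> l \<and> l \<le> 2*m+1"
    consider "l \<le> 2*p+1" | "l = 2*p+2" | "2 * Suc p + 1 \<le> l" by force
    then show "2 * ?h l < l"
    proof cases
      case 1
      then show ?thesis using h(6)[of l] l by simp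
    next
      case 2
      then show ?thesis by simp
    next
      case 3
      then show ?thesis using h'(6)[of l] l by simp
    qed
  qed (use h(1-4) h'(1-4) in auto)
  moreover have "insert (p, Suc (Suc p)) (D \<union> D') = track i m ?h"
    using h(2) h'(1) by (auto simp: g(2) g'(2) track_def)
  ultimately show ?thesis unfolding dyck_set_def by blast
qed

section \<open>Hooks cut off at the antidiagonal\<close>

definition hook_C :: "nat \<Rightarrow> nat \<times> nat \<Rightarrow> (nat \<times> nat) set" where
  "hook_C n = (\<lambda>(i, j). {(p, q). p = i \<and> i < q \<and> q \<le> j \<or> q = j \<and> i \<le> p \<and> p < j \<and> p + j \<le> 2*n+1})"

text \<open>The row function \<open>max i (l - j)\<close> stays in row \<open>i\<close> up to level
  \<open>i + j\<close> and then follows column \<open>j\<close>. The column ends at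
  \<open>(j - 1, j)\<close> if \<open>j \<le> n\<close> and on the antidiagonal if
  \<open>n < j\<close>; \<open>min (j - 1) n\<close> is the end index in both cases.\<close>

lemma dyck_set_hook_C:
  assumes "(i, j) \<in> index_C n"
  shows "dyck_set n i (min (j - 1) n) (hook_C n (i, j))"
proof -
  define m where "m = min (j - 1) n"
  let ?g = "\<lambda>l. max i (l - j)"
  have ij: "1 \<le> i" "i < j" "i + j \<le> 2*n+1" using assms by (auto simp: index_C_def)
  have m: "m < j" "m \<le> n" "m = n \<or> Suc m = j" "i \<le> m" using ij by (auto simp: m_def)
  have "level_path n i m ?g"
    unfolding level_path_def
  proof (intro conjI allI impI)
    fix l assume "2*i+1 \<le> l \<and> l \<le> 2*m+1"
    then have "2 * i < l" "2 * (l - j) < l" using m(1) by auto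
    then show "2 * ?g l < l" by (simp add: max_def)
  next
    fix l
    have "Suc l - j = l - j \<or> Suc l - j = Suc (l - j)" by arith
    then show "?g (Suc l) = ?g l \<or> ?g (Suc l) = Suc (?g l)" by (auto simp: max_def)
  next
    assume "m < n"
    then show "?g (2*m+1) = m" using m by auto
  qed (use ij m in auto)
  moreover have "hook_C n (i, j) = track i m ?g"
  proof safe
    fix p q assume "(p, q) \<in> hook_C n (i, j)"
    then consider "p = i" "i < q" "q \<le> j" | "q = j" "i \<le> p" "p < j" "p + j \<le> 2*n+1"
      by (auto simp: hook_C_def)
    then show "(p, q) \<in> track i m ?g"
      by cases (use ij m in \<open>auto simp: track_def\<close>)
  next
    fix p q assume "(p, q) \<in> track i m ?g"
    then have "2*i+1 \<le> p + q" "p + q \<le> 2*m+1" "max i (p + q - j) = p" by (auto simp: track_def)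
    then show "(p, q) \<in> hook_C n (i, j)"
      using ij m by (cases "p = i") (auto simp: hook_C_def max_def split: if_splits)
  qed
  ultimately show ?thesis unfolding dyck_set_def m_def by blast
qed

section \<open>The tangent cone and its facets\<close>

definition tight :: "nat \<Rightarrow> (nat \<Rightarrow> nat) \<Rightarrow> point \<Rightarrow> (nat \<times> nat) set \<Rightarrow> bool" where
  "tight n a v D \<longleftrightarrow> (\<exists>i m. dyck_set n i m D \<and> (\<Sum>p\<in>D. coef v p) = (\<Sum>k=i..m. real (a k)))"

text \<open>With \<open>s\<close> a slack and \<open>t\<close> its rate of change, a direction
  respecting the tight constraints can be followed for a positive time without violating any other
  constraint.\<close>

lemma small_step:
  assumes "finite K" "\<And>s t. (s, t) \<in> K \<Longrightarrow> 0 \<le> s \<and> (s = 0 \<longrightarrow> 0 \<le> (t::real))"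
  obtains e where "0 < e" "\<And>s t. (s, t) \<in> K \<Longrightarrow> 0 \<le> s + e * t"
proof -
  \<comment> \<open>All smaller steps are included so that the minimum of two admissible steps is
    admissible.\<close>
  have "\<exists>e>0. \<forall>d. 0 < d \<and> d \<le> e \<longrightarrow> (\<forall>(s, t)\<in>K. 0 \<le> s + d * t)"
    using assms
  proof (induction K rule: finite_induct)
    case empty
    then show ?case by (intro exI[of _ 1]) auto
  next
    case (insert z K)
    obtain s t where z: "z = (s, t)" by (cases z)
    obtain e where e: "0 < e" "\<And>d. 0 < d \<and> d \<le> e \<Longrightarrow> \<forall>(s, t)\<in>K. 0 \<le> s + d * t"
      using insert by blast
    have st: "0 \<le> s" "s = 0 \<Longrightarrow> 0 \<le> t" using insert.prems[of s t] z by auto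
    have "\<exists>e'>0. \<forall>d. 0 < d \<and> d \<le> e' \<longrightarrow> 0 \<le> s + d * t"
    proof (cases "0 \<le> t")
      case True
      then show ?thesis using st by (intro exI[of _ 1]) auto
    next
      case False
      then have "0 < s" using st by force
      show ?thesis
      proof (intro exI[of _ "s / - t"] conjI allI impI)
        show "0 < s / - t" using False \<open>0 < s\<close> by (simp add: divide_pos_neg)
        fix d assume "0 < d \<and> d \<le> s / - t"
        then show "0 \<le> s + d * t" using False by (simp add: field_simps)
      qed
    qed
    then obtain e' where "0 < e'" "\<forall>d. 0 < d \<and> d \<le> e' \<longrightarrow> 0 \<le> s + d * t" by blast
    then show ?case using e by (intro exI[of _ "min e e'"]) (auto simp: z)
  qed
  then show ?thesis using that by fastforce
qed

lemma sum_coef_diff: "(\<Sum>p\<in>D. coef (x - y) p) = (\<Sum>p\<in>D. coef x p) - (\<Sum>p\<in>D. coef y p)"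
  by (simp add: lookup_minus sum_subtractf)

lemma sum_coef_scaleR: "(\<Sum>p\<in>D. coef (c *\<^sub>R x) p) = c * (\<Sum>p\<in>D. coef x p)"
  by (simp add: sum_distrib_left)

lemma sum_coef_add: "(\<Sum>p\<in>D. coef (x + y) p) = (\<Sum>p\<in>D. coef x p) + (\<Sum>p\<in>D. coef y p)"
  by (simp add: lookup_add sum.distrib)

lemma tangent_cone_FFLV_C:
  assumes v: "v \<in> FFLV_C n a"
  shows "tangent_cone (FFLV_C n a) v = {w \<in> coord_space (index_C n).
    (\<forall>p\<in>index_C n. coef v p = 0 \<longrightarrow> 0 \<le> coef w p) \<and>
    (\<forall>D. tight n a v D \<longrightarrow> (\<Sum>p\<in>D. coef w p) \<le> 0)}" (is "_ = ?R")
proof (intro equalityI subsetI)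
  fix w assume "w \<in> tangent_cone (FFLV_C n a) v"
  then obtain c x where w: "w = c *\<^sub>R (x - v)" "0 \<le> c" and x: "x \<in> FFLV_C n a"
    by (auto simp: tangent_cone_def conic_hull_explicit)
  show "w \<in> ?R"
  proof (intro CollectI conjI ballI allI impI)
    show "w \<in> coord_space (index_C n)"
      unfolding w(1) using v x
      by (intro subspace_scale subspace_diff subspace_coord_space) (auto simp: FFLV_C_def)
    fix p assume "p \<in> index_C n" "coef v p = 0"
    then show "0 \<le> coef w p" using x w by (simp add: FFLV_C_def lookup_minus)
  next
    fix D assume "tight n a v D"
    then have "(\<Sum>p\<in>D. coef x p) \<le> (\<Sum>p\<in>D. coef v p)"
      using x by (auto simp: tight_def FFLV_C_eq)
    then show "(\<Sum>p\<in>D. coef w p) \<le> 0"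
      using w(2) by (simp only: w(1) sum_coef_scaleR sum_coef_diff mult_nonneg_nonpos diff_le_0_iff_le)
  qed
next
  fix w assume w: "w \<in> ?R"
  \<comment> \<open>The slack of every coordinate and path inequality at \<open>v\<close>, paired
    with its rate of change along \<open>w\<close>.\<close>
  define K where "K = (\<lambda>p. (coef v p, coef w p)) ` index_C n \<union>
    (\<lambda>(i, m, D). ((\<Sum>k=i..m. real (a k)) - (\<Sum>p\<in>D. coef v p), - (\<Sum>p\<in>D. coef w p))) `
      {(i, m, D). dyck_set n i m D}"
  have "finite {(i, m, D). dyck_set n i m D}"
    by (rule finite_subset[of _ "{..n} \<times> {..n} \<times> Pow (index_C n)"])
      (auto simp: finite_index_C dest: dyck_set_range dyck_set_subset)
  then have finK: "finite K" by (simp add: K_def finite_index_C)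
  have K: "0 \<le> s \<and> (s = 0 \<longrightarrow> 0 \<le> t)" if "(s, t) \<in> K" for s t
    using that
      unfolding K_def
    proof (elim UnE imageE)
      fix p assume "(s, t) = (coef v p, coef w p)" "p \<in> index_C n"
      then show ?thesis using v w by (auto simp: FFLV_C_def)
    next
      fix z assume z: "z \<in> {(i, m, D). dyck_set n i m D}" "(s, t) = (case z of (i, m, D) \<Rightarrow>
        ((\<Sum>k=i..m. real (a k)) - (\<Sum>p\<in>D. coef v p), - (\<Sum>p\<in>D. coef w p)))"
      then obtain i m D where D: "dyck_set n i m D" "s = (\<Sum>k=i..m. real (a k)) - (\<Sum>p\<in>D. coef v p)"
        "t = - (\<Sum>p\<in>D. coef w p)" by auto
      have "0 \<le> s" using v D by (auto simp: FFLV_C_eq)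
      moreover have "0 \<le> t" if "s = 0"
      proof -
        have "tight n a v D" unfolding tight_def using D that by (intro exI[of _ i] exI[of _ m]) simp
        then show ?thesis using w D(3) by simp
      qed
      ultimately show ?thesis by blast
    qed
  obtain e where e: "0 < e" "\<And>s t. (s, t) \<in> K \<Longrightarrow> 0 \<le> s + e * t"
    using small_step[OF finK K] by blast
  define x where "x = v + e *\<^sub>R w"
  have "x \<in> FFLV_C n a"
    unfolding FFLV_C_eq
  proof (intro CollectI conjI ballI allI impI)
    show "x \<in> coord_space (index_C n)"
      unfolding x_def using v w
      by (intro subspace_add subspace_scale subspace_coord_space) (auto simp: FFLV_C_def)
    fix p assume "p \<in> index_C n"
    then show "0 \<le> coef x p"
      using e(2)[of "coef v p" "coef w p"] by (simp add: x_def K_def lookup_add)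
  next
    fix i m D assume "dyck_set n i m D"
    then have "((\<Sum>k=i..m. real (a k)) - (\<Sum>p\<in>D. coef v p), - (\<Sum>p\<in>D. coef w p)) \<in> K"
      unfolding K_def by (intro UnI2 image_eqI[of _ _ "(i, m, D)"]) auto
    then show "(\<Sum>p\<in>D. coef x p) \<le> (\<Sum>k=i..m. real (a k))"
      using e(2) by (fastforce simp: x_def sum_coef_add sum_coef_scaleR simp del: coef_scaleR)
  qed
  moreover have "w = (1 / e) *\<^sub>R (x - v)" using e(1) by (simp add: x_def)
  ultimately show "w \<in> tangent_cone (FFLV_C n a) v"
    using e(1) unfolding tangent_cone_def conic_hull_explicit
    by (intro CollectI exI[of _ "1 / e"] exI[of _ "x - v"]) auto
qed

text \<open>Both \<open>w\<close> and \<open>- w\<close> lie in the tangent cone, so for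
  \<open>w \<noteq> 0\<close> the vertex would be interior to a segment inside the polytope.\<close>

lemma extreme_point_annihilator:
  assumes v: "v extreme_point_of FFLV_C n a" and w: "w \<in> coord_space (index_C n)"
    and zero: "\<And>p. p \<in> index_C n \<Longrightarrow> coef v p = 0 \<Longrightarrow> coef w p = 0"
    and tight: "\<And>D. tight n a v D \<Longrightarrow> (\<Sum>p\<in>D. coef w p) = 0"
  shows "w = 0"
proof (rule ccontr)
  assume "w \<noteq> 0"
  have vP: "v \<in> FFLV_C n a" using v by (simp add: extreme_point_of_def)
  have "- w \<in> coord_space (index_C n)" using w subspace_coord_space by (rule subspace_neg[rotated])
  then have "- w \<in> tangent_cone (FFLV_C n a) v" "w \<in> tangent_cone (FFLV_C n a) v"
    using zero tight w by (auto simp: tangent_cone_FFLV_C[OF vP] sum_negf)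
  then obtain c x c' x' where x: "w = c *\<^sub>R (x - v)" "0 \<le> c" "x \<in> FFLV_C n a"
    and x': "- w = c' *\<^sub>R (x' - v)" "0 \<le> c'" "x' \<in> FFLV_C n a"
    unfolding tangent_cone_def conic_hull_explicit by blast
  have cc: "0 < c" "0 < c'" using x x' \<open>w \<noteq> 0\<close> by (auto simp: order.order_iff_strict)
  have "c *\<^sub>R (x - v) + c' *\<^sub>R (x' - v) = 0" using x(1) x'(1) by (metis add.right_inverse)
  then have "(c + c') *\<^sub>R v = c *\<^sub>R x + c' *\<^sub>R x'"
    by (simp add: algebra_simps)
  then have "(1 / (c + c')) *\<^sub>R (c + c') *\<^sub>R v = (1 / (c + c')) *\<^sub>R (c *\<^sub>R x + c' *\<^sub>R x')" by simp
  then have veq: "v = (c / (c + c')) *\<^sub>R x + (c' / (c + c')) *\<^sub>R x'"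
    using cc by (simp add: scaleR_add_right)
  have "x \<noteq> x'"
  proof
    assume "x = x'"
    then have "v = x" using veq cc by (metis add_divide_distrib add_pos_pos divide_self_if less_numeral_extra(3) scaleR_add_left scaleR_one)
    then show False using x(1) \<open>w \<noteq> 0\<close> by simp
  qed
  have "v \<in> open_segment x x'"
    unfolding in_segment
  proof (intro conjI exI[of _ "c' / (c + c')"])
    have "1 - c' / (c + c') = c / (c + c')" using cc by (simp add: field_simps)
    then show "v = (1 - c' / (c + c')) *\<^sub>R x + (c' / (c + c')) *\<^sub>R x'" using veq by simp
  qed (use cc \<open>x \<noteq> x'\<close> in auto)
  then show False using v x x' by (auto simp: extreme_point_of_def)
qed

section \<open>Test vectors and irredundancy of the tight inequalities\<close>

definition level_point :: "nat \<Rightarrow> nat \<Rightarrow> point" where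
  "level_point n l = point_of (index_C n) (\<lambda>(p, q). if p + q = l then 1 else 0)"

lemma coef_level_point: "p \<in> index_C n \<Longrightarrow> coef (level_point n l) p = (if fst p + snd p = l then 1 else 0)"
  by (simp add: level_point_def coef_point_of finite_index_C case_prod_beta)

lemma level_point_in_coord_space: "level_point n l \<in> coord_space (index_C n)"
  by (simp add: level_point_def point_of_in_coord_space finite_index_C)

text \<open>A path crosses each level of its range once, so level indicators see the range of a path
  but not its shape. They separate paths of different range before unit vectors separate paths of
  equal range.\<close>

lemma sum_level_point:
  assumes D: "dyck_set n i m D"
  shows "(\<Sum>p\<in>D. coef (level_point n l) p) = (if 2*i+1 \<le> l \<and> l \<le> 2*m+1 then 1 else 0)"
proof -
  have eq: "(\<Sum>p\<in>D. coef (level_point n l) p) = (\<Sum>p\<in>D. if fst p + snd p = l then 1 else 0)"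
    using dyck_set_subset[OF D] by (intro sum.cong) (auto simp: coef_level_point)
  show ?thesis
  proof (cases "2*i+1 \<le> l \<and> l \<le> 2*m+1")
    case True
    then obtain p q where pq: "(p, q) \<in> D" "p + q = l" using dyck_set_level_ex[OF D] by blast
    have "(\<Sum>p\<in>D. if fst p + snd p = l then 1 else 0 :: real) = (\<Sum>r\<in>D. if r = (p, q) then 1 else 0)"
      using dyck_set_level_unique[OF D pq(1)] pq(2) by (intro sum.cong) (auto split: if_splits)
    then show ?thesis using True eq pq dyck_set_finite[OF D] by simp
  next
    case False
    then have "fst p + snd p \<noteq> l" if "p \<in> D" for p
      using dyck_set_level[OF D, of "fst p" "snd p"] that by auto
    then show ?thesis using False eq by simp
  qed
qed

lemma bound_pos:
  assumes "\<And>i. i \<in> {1..n} \<Longrightarrow> 0 < a i" "dyck_set n i m D"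
  shows "0 < (\<Sum>k=i..m. real (a k))"
  using assms dyck_set_range[OF assms(2)] by (intro sum_pos) auto

text \<open>A sum of nonnegative terms that is at most 0 has only zero terms. The sign of
  \<open>s\<close> is required only at positive weights, so that what earlier tests reveal about the
  functionals occurring can be used in later ones.\<close>

lemma nonneg_combination_zero:
  fixes t :: "'b \<Rightarrow> real"
  assumes "finite B" "\<And>b. b \<in> B \<Longrightarrow> 0 \<le> t b" "(\<Sum>b\<in>B. t b * s b) \<le> 0"
    "\<And>b. b \<in> B \<Longrightarrow> 0 < t b \<Longrightarrow> 0 \<le> s b" "b \<in> B" "0 < t b"
  shows "s b = (0::real)"
proof -
  have nn: "0 \<le> t b * s b" if "b \<in> B" for b
    using assms(2)[OF that] assms(4)[OF that] by (cases "t b = 0") auto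
  have "t b * s b \<le> (\<Sum>b\<in>B. t b * s b)"
    using nn by (intro member_le_sum assms(1,5)) auto
  then have "t b * s b = 0" using assms(3) nn[OF assms(5)] by linarith
  then show ?thesis using assms(6) by simp
qed

lemma sum_unit_point:
  assumes "finite I" "D \<subseteq> I"
  shows "(\<Sum>p\<in>D. coef (point_of I (\<lambda>p. if p = q then 1 else 0)) p) = (if q \<in> D then 1 else 0)"
proof -
  have "(\<Sum>p\<in>D. coef (point_of I (\<lambda>p. if p = q then 1 else 0)) p) = (\<Sum>p\<in>D. if p = q then 1 else 0)"
    using assms(2) by (intro sum.cong refl) (auto simp only: coef_point_of[OF assms(1)] subsetD if_True)
  then show ?thesis using finite_subset[OF assms(2,1)] by simp
qed

text \<open>Path sums carry a minus sign so that the tangent cone is where all these functionals are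
  nonnegative.\<close>

definition tight_functionals :: "nat \<Rightarrow> (nat \<Rightarrow> nat) \<Rightarrow> point \<Rightarrow> (point \<Rightarrow> real) set" where
  "tight_functionals n a v = (\<lambda>p w. coef w p) ` {p \<in> index_C n. coef v p = 0} \<union>
     (\<lambda>D w. - (\<Sum>p\<in>D. coef w p)) ` {D. tight n a v D}"

text \<open>A vector \<open>y\<close> with \<open>f y \<le> 0\<close> on which all functionals of
  positive weight are nonnegative is annihilated by all of them. Successive test vectors, each
  admissible thanks to the previous ones, leave \<open>f\<close> as the only candidate.\<close>

lemma tight_functionals_extremal:
  assumes pos: "\<And>i. i \<in> {1..n} \<Longrightarrow> 0 < a i" and v: "v \<in> FFLV_C n a" and fin: "finite B"
    and f: "f \<in> tight_functionals n a v" and t: "\<And>b. b \<in> B \<Longrightarrow> 0 \<le> t b"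
    and g: "\<And>b. b \<in> B \<Longrightarrow> g b \<in> tight_functionals n a v"
    and eq: "\<And>w. w \<in> coord_space (index_C n) \<Longrightarrow> f w = (\<Sum>b\<in>B. t b * g b w)"
    and b: "b \<in> B" "0 < t b"
  shows "g b = f"
proof -
  let ?U = "coord_space (index_C n)"
  let ?single = "\<lambda>q. point_of (index_C n) (\<lambda>p. if p = q then 1 else 0)"
  note [simp] = sum_coef_scaleR sum_coef_diff
  have vU: "v \<in> ?U" using v by (simp add: FFLV_C_def)
  have test_zero: "g b y = 0"
    if "y \<in> ?U" "f y \<le> 0" "\<And>b. b \<in> B \<Longrightarrow> 0 < t b \<Longrightarrow> 0 \<le> g b y" "b \<in> B" "0 < t b" for y b
    by (rule nonneg_combination_zero[OF fin t, where s="\<lambda>b. g b y"]) (use that eq[OF that(1)] in auto)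
  have neg: "- y \<in> ?U" if "y \<in> ?U" for y
    using that by (rule subspace_neg[OF subspace_coord_space])
  have gcases: "(\<exists>q\<in>index_C n. coef v q = 0 \<and> g b = (\<lambda>w. coef w q)) \<or>
     (\<exists>D i m. dyck_set n i m D \<and> (\<Sum>p\<in>D. coef v p) = (\<Sum>k=i..m. real (a k)) \<and> g b = (\<lambda>w. - (\<Sum>p\<in>D. coef w p)))"
    if "b \<in> B" for b
    using g[OF that] by (auto simp: tight_functionals_def tight_def)
  have single: "coef (?single q) p = (if p = q then 1 else 0)" if "p \<in> index_C n" for p q
    using that by (simp add: coef_point_of finite_index_C)
  have singleU: "?single q \<in> ?U" for q by (simp add: point_of_in_coord_space finite_index_C)
  consider (zero) p where "p \<in> index_C n" "coef v p = 0" "f = (\<lambda>w. coef w p)"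
    | (path) D i m where "dyck_set n i m D" "(\<Sum>p\<in>D. coef v p) = (\<Sum>k=i..m. real (a k))"
        "f = (\<lambda>w. - (\<Sum>p\<in>D. coef w p))"
    using f by (auto simp: tight_functionals_def tight_def)
  then show ?thesis
  proof cases
    case zero
    \<comment> \<open>At \<open>- v\<close> the vanishing coordinates are 0, while a tight path
      functional equals its positive bound; so no path contributes to a coordinate.\<close>
    have coordinate: "\<exists>q\<in>index_C n. coef v q = 0 \<and> g b = (\<lambda>w. coef w q)" if b: "b \<in> B" "0 < t b" for b
    proof (rule ccontr)
      assume *: "\<not> ?thesis"
      have "0 \<le> g b (- v)" if "b \<in> B" for b
        using gcases[OF that] by (auto simp: sum_negf intro!: sum_nonneg)
      then have "g b (- v) = 0"
        using test_zero[of "- v" b] b neg[OF vU] zero by auto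
      moreover obtain D i m where D: "dyck_set n i m D" "(\<Sum>p\<in>D. coef v p) = (\<Sum>k=i..m. real (a k))"
        "g b = (\<lambda>w. - (\<Sum>p\<in>D. coef w p))"
        using gcases[OF b(1)] * by blast
      ultimately show False using bound_pos[where a=a, OF pos D(1)] by (simp add: sum_negf)
    qed
    obtain q where q: "q \<in> index_C n" "coef v q = 0" "g b = (\<lambda>w. coef w q)" using coordinate[OF b] by blast
    have "q = p"
    proof (rule ccontr)
      assume "q \<noteq> p"
      then have "f (?single q) \<le> 0" using zero q by (simp add: single)
      moreover have "0 \<le> g b (?single q)" if "b \<in> B" "0 < t b" for b
        using coordinate[OF that] by (auto simp: single)
      ultimately have "g b (?single q) = 0" using b singleU test_zero by blast
      then show False using q by (simp add: single)
    qed
    then show ?thesis using q zero by simp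
  next
    case path
    have im: "1 \<le> i" "i \<le> m" "m \<le> n" using dyck_set_range[OF path(1)] by auto
    let ?L = "level_point n"
    have LU: "?L l \<in> ?U" for l by (rule level_point_in_coord_space)
    note sum_L = sum_level_point
    \<comment> \<open>\<open>u\<close> puts weight \<open>a k\<close> on all of level
      \<open>2*k+1\<close>, so every path sum of \<open>u\<close> equals its bound. Hence
      \<open>u - v\<close> is annihilated by all tight paths but positive at vanishing coordinates
      on odd levels, which excludes those coordinates.\<close>
    define u where "u = (\<Sum>k=1..n. real (a k) *\<^sub>R ?L (2*k+1))"
    have uU: "u \<in> ?U"
      unfolding u_def by (intro subspace_sum subspace_scale subspace_coord_space LU)
    have coef_u: "coef u q = (\<Sum>k=1..n. real (a k) * coef (?L (2*k+1)) q)" for q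
      by (simp add: u_def lookup_sum)
    have sum_u: "(\<Sum>p\<in>D'. coef u p) = (\<Sum>k=i'..m'. real (a k))" if D': "dyck_set n i' m' D'" for D' i' m'
    proof -
      have "(\<Sum>p\<in>D'. coef u p) = (\<Sum>k=1..n. real (a k) * (\<Sum>p\<in>D'. coef (?L (2*k+1)) p))"
        unfolding coef_u by (subst sum.swap) (simp add: sum_distrib_left)
      also have "\<dots> = (\<Sum>k=1..n. if k \<in> {i'..m'} then real (a k) else 0)"
        by (intro sum.cong) (auto simp: sum_L[OF D'])
      also have "\<dots> = (\<Sum>k\<in>{1..n} \<inter> {i'..m'}. real (a k))"
        by (rule sum.inter_restrict[symmetric]) simp
      also have "{1..n} \<inter> {i'..m'} = {i'..m'}" using dyck_set_range[OF D'] by auto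
      finally show ?thesis .
    qed
    have u_nonneg: "0 \<le> coef u q" if "q \<in> index_C n" for q
      unfolding coef_u using that by (intro sum_nonneg) (simp add: coef_level_point)
    have u_odd: "0 < coef u q" if q: "q \<in> index_C n" "odd (fst q + snd q)" for q
    proof -
      obtain k where k: "fst q + snd q = 2*k+1" using q(2) by (rule oddE)
      then have "k \<in> {1..n}" using q(1) by (auto simp: index_C_def)
      then have "0 < real (a k) * coef (?L (2*k+1)) q"
        using pos k q(1) by (simp add: coef_level_point)
      then show ?thesis
        unfolding coef_u using \<open>k \<in> {1..n}\<close> q(1)
        by (intro sum_pos2[of _ k]) (auto simp: coef_level_point)
    qed
    have even: "even (fst q + snd q)"
      if b: "b \<in> B" "0 < t b" and q: "q \<in> index_C n" "coef v q = 0" "g b = (\<lambda>w. coef w q)" for b q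
    proof (rule ccontr)
      assume "odd (fst q + snd q)"
      have "g b (u - v) = 0"
      proof (rule test_zero)
        show "u - v \<in> ?U" by (intro subspace_diff subspace_coord_space uU vU)
        show "f (u - v) \<le> 0" using path sum_u[OF path(1)] by simp
        fix b assume "b \<in> B"
        from gcases[OF this] show "0 \<le> g b (u - v)"
        proof (elim disjE bexE exE conjE)
          fix q assume "q \<in> index_C n" "coef v q = 0" "g b = (\<lambda>w. coef w q)"
          then show ?thesis using u_nonneg by (simp add: lookup_minus)
        next
          fix D i m assume "dyck_set n i m D" "(\<Sum>p\<in>D. coef v p) = (\<Sum>k=i..m. real (a k))"
            "g b = (\<lambda>w. - (\<Sum>p\<in>D. coef w p))"
          then show ?thesis by (simp add: sum_u)
        qed
      qed (use b in auto)
      then show False using q u_odd[OF q(1) \<open>odd _\<close>] by (simp add: lookup_minus)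
    qed
    \<comment> \<open>With no coordinates left on odd levels, minus the indicator of an odd level
      outside the range of \<open>f\<close> is admissible and excludes every path crossing
      it.\<close>
    have range1: "i \<le> i' \<and> m' \<le> m"
      if b: "b \<in> B" "0 < t b" and D': "dyck_set n i' m' D'" "g b = (\<lambda>w. - (\<Sum>p\<in>D'. coef w p))" for b D' i' m'
    proof -
      have "k \<in> {i..m}" if k: "k \<in> {i'..m'}" for k
      proof (rule ccontr)
        assume "k \<notin> {i..m}"
        have "g b (- ?L (2*k+1)) = 0"
        proof (rule test_zero)
          show "- ?L (2*k+1) \<in> ?U" by (rule neg[OF LU])
          show "f (- ?L (2*k+1)) \<le> 0" using \<open>k \<notin> {i..m}\<close> path by (auto simp: sum_negf sum_L)
          fix b assume b: "b \<in> B" "0 < t b"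
          from gcases[OF b(1)] show "0 \<le> g b (- ?L (2*k+1))"
          proof (elim disjE bexE exE conjE)
            fix q assume q: "q \<in> index_C n" "coef v q = 0" "g b = (\<lambda>w. coef w q)"
            then have "fst q + snd q \<noteq> 2*k+1"
              using even[OF b q] by (metis dvd_triv_left even_plus_one_iff)
            then show ?thesis using q by (simp add: coef_level_point)
          next
            fix D i m assume "dyck_set n i m D" "g b = (\<lambda>w. - (\<Sum>p\<in>D. coef w p))"
            then show ?thesis by (simp add: sum_L sum_negf)
          qed
        qed (use b in auto)
        then show False using D' k by (simp add: sum_negf sum_L)
      qed
      then show ?thesis using dyck_set_range[OF D'(1)] by auto
    qed
    \<comment> \<open>Ranges begin and end at odd levels, so a path crossing the even level
      \<open>2*k\<close> crosses both neighbouring levels too; each difference is therefore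
      nonnegative on all remaining functionals.\<close>
    have between: "g b (?L (2*k) - ?L (2*k-1)) = 0" "g b (?L (2*k) - ?L (2*k+1)) = 0"
      if b: "b \<in> B" "0 < t b" and k: "i < k" "k \<le> m" for b k
    proof -
      have *: "0 \<le> g b (?L (2*k) - ?L (2*k-1)) \<and> 0 \<le> g b (?L (2*k) - ?L (2*k+1))"
        if b: "b \<in> B" "0 < t b" for b
        using gcases[OF b(1)]
      proof (elim disjE bexE exE conjE)
        fix q assume q: "q \<in> index_C n" "coef v q = 0" "g b = (\<lambda>w. coef w q)"
        obtain c where "fst q + snd q = 2*c" using even[OF b q] by blast
        then have "fst q + snd q \<noteq> 2*k-1" "fst q + snd q \<noteq> 2*k+1" using k by presburger+
        then show ?thesis using q by (simp add: lookup_minus coef_level_point)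
      next
        fix D i m assume D: "dyck_set n i m D" "g b = (\<lambda>w. - (\<Sum>p\<in>D. coef w p))"
        have "2*i+1 \<le> 2*k \<Longrightarrow> 2*i+1 \<le> 2*k-1" "2*k \<le> 2*m+1 \<Longrightarrow> 2*k+1 \<le> 2*m+1" by presburger+
        then show ?thesis unfolding D(2) by (auto simp: sum_L[OF D(1)])
      qed
      show "g b (?L (2*k) - ?L (2*k-1)) = 0"
        by (rule test_zero) (use * b k path LU in \<open>auto simp: sum_L[OF path(1)] intro!: subspace_diff subspace_coord_space\<close>)
      show "g b (?L (2*k) - ?L (2*k+1)) = 0"
        by (rule test_zero) (use * b k path LU in \<open>auto simp: sum_L[OF path(1)] intro!: subspace_diff subspace_coord_space\<close>)
    qed
    \<comment> \<open>A smaller range would end at level \<open>2*m'+1\<close> or begin at level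
      \<open>2*i'+1\<close> inside the range of \<open>f\<close>, where one of the differences takes
      the value 1.\<close>
    have range2: "i' = i \<and> m' = m"
      if b: "b \<in> B" "0 < t b" and D': "dyck_set n i' m' D'" "g b = (\<lambda>w. - (\<Sum>p\<in>D'. coef w p))" for b D' i' m'
    proof (rule ccontr)
      assume *: "\<not> ?thesis"
      have r: "i \<le> i'" "m' \<le> m" "i' \<le> m'" using range1[OF b D'] dyck_set_range[OF D'(1)] by auto
      consider "m' < m" | "i < i'" using * r by linarith
      then show False
      proof cases
        case 1
        then have "g b (?L (2 * Suc m') - ?L (2 * Suc m' - 1)) = 0" using r by (intro between b) auto
        then show False using r by (simp add: D'(2) sum_L[OF D'(1)])
      next
        case 2
        then have "g b (?L (2 * i') - ?L (2 * i' + 1)) = 0" using r by (intro between b) auto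
        then show False using r by (simp add: D'(2) sum_L[OF D'(1)])
      qed
    qed
    \<comment> \<open>Inside the range of \<open>f\<close> the same differences detect an even
      coordinate. Outside, the indicator of its level is admissible, because all remaining paths
      have the range of \<open>f\<close>.\<close>
    have no_coordinate: False
      if b: "b \<in> B" "0 < t b" and q: "q \<in> index_C n" "coef v q = 0" "g b = (\<lambda>w. coef w q)" for b q
    proof -
      obtain k where k: "fst q + snd q = 2*k" using even[OF b q] by blast
      show False
      proof (cases "i < k \<and> k \<le> m")
        case True
        then have "2*k \<noteq> 2*k - 1" by linarith
        then show False using between(1)[OF b, of k] True q k by (simp add: lookup_minus coef_level_point)
      next
        case False
        have "g b (?L (2*k)) = 0"
        proof (rule test_zero)
          show "f (?L (2*k)) \<le> 0" using False path by (simp add: sum_L)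
          fix b assume b: "b \<in> B" "0 < t b"
          from gcases[OF b(1)] show "0 \<le> g b (?L (2*k))"
          proof (elim disjE bexE exE conjE)
            fix q assume q: "q \<in> index_C n" "g b = (\<lambda>w. coef w q)"
            then show ?thesis by (simp add: coef_level_point)
          next
            fix D' i' m' assume D': "dyck_set n i' m' D'" "g b = (\<lambda>w. - (\<Sum>p\<in>D'. coef w p))"
            then show ?thesis using range2[OF b D'] False by (auto simp: sum_L)
          qed
        qed (use b LU in auto)
        then show False using q k by (simp add: coef_level_point)
      qed
    qed
    obtain D' where D': "dyck_set n i m D'" "g b = (\<lambda>w. - (\<Sum>p\<in>D'. coef w p))"
      using gcases[OF b(1)] no_coordinate[OF b] range2[OF b] by metis
    have sum_single: "(\<Sum>p\<in>D. coef (?single q) p) = (if q \<in> D then 1 else 0)"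
      if "dyck_set n i m D" for D i m q
      by (rule sum_unit_point[OF finite_index_C dyck_set_subset[OF that]])
    \<comment> \<open>Only paths remain, so minus the unit vector at a point of \<open>D'\<close>
      outside \<open>D\<close> would be admissible but nonzero on \<open>D'\<close>.\<close>
    have "D' \<subseteq> D"
    proof
      fix q assume "q \<in> D'"
      show "q \<in> D"
      proof (rule ccontr)
        assume "q \<notin> D"
        have "g b (- ?single q) = 0"
        proof (rule test_zero)
          show "f (- ?single q) \<le> 0" using \<open>q \<notin> D\<close> path by (simp add: sum_negf sum_single)
          show "- ?single q \<in> ?U" by (rule neg[OF singleU])
          fix b assume b: "b \<in> B" "0 < t b"
          from gcases[OF b(1)] show "0 \<le> g b (- ?single q)"
          proof (elim disjE bexE exE conjE)
            fix r assume "r \<in> index_C n" "coef v r = 0" "g b = (\<lambda>w. coef w r)"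
            then show ?thesis using no_coordinate[OF b] by blast
          next
            fix D i m assume "dyck_set n i m D" "g b = (\<lambda>w. - (\<Sum>p\<in>D. coef w p))"
            then show ?thesis by (simp add: sum_negf sum_single)
          qed
        qed (use b in auto)
        then show False using D' \<open>q \<in> D'\<close> by (simp add: sum_negf sum_single)
      qed
    qed
    then have "D' = D" using dyck_set_subset_eq path(1) D'(1) by blast
    then show ?thesis using D' path by simp
  qed
qed

text \<open>The generators of the cone form a lattice basis: they are independent, and they span the
  coordinate space because unit vectors are lattice points. Extremality then gives each tight path a
  dual vector, the form in which the structure of the cone is used from here on.\<close>

lemma simple_vertex_separates:
  assumes pos: "\<And>i. i \<in> {1..n} \<Longrightarrow> 0 < a i"
    and simple: "simple_vertex (int_lattice (index_C n)) (FFLV_C n a) v" and D: "tight n a v D"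
  obtains w where "w \<in> coord_space (index_C n)" "(\<Sum>p\<in>D. coef w p) \<noteq> 0"
    "\<And>p. p \<in> index_C n \<Longrightarrow> coef v p = 0 \<Longrightarrow> coef w p = 0"
    "\<And>D'. tight n a v D' \<Longrightarrow> D' \<noteq> D \<Longrightarrow> (\<Sum>p\<in>D'. coef w p) = 0"
proof -
  let ?U = "coord_space (index_C n)" and ?F = "tight_functionals n a v"
  let ?single = "\<lambda>q. point_of (index_C n) (\<lambda>p. if p = q then 1 else 0)"
  have vP: "v \<in> FFLV_C n a" using simple by (simp add: simple_vertex_def extreme_point_of_def)
  obtain B where B: "lattice_basis B (int_lattice (index_C n))"
    "tangent_cone (FFLV_C n a) v = convex_cone hull B"
    using simple by (auto simp: simple_vertex_def unimodular_cone_def)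
  have finB: "finite B" and indB: "independent B"
    and L: "int_lattice (index_C n) = {\<Sum>b\<in>B. of_int (c b) *\<^sub>R b | c :: _ \<Rightarrow> int. True}"
    using B(1) by (auto simp: lattice_basis_def)
  have single: "coef (?single q) p = (if p = q \<and> p \<in> index_C n then 1 else 0)" for p q
    by (simp add: coef_point_of finite_index_C)
  have singleU: "?single q \<in> ?U" for q by (simp add: point_of_in_coord_space finite_index_C)
  have BL: "B \<subseteq> int_lattice (index_C n)"
  proof
    fix b assume b: "b \<in> B"
    then have "b = (\<Sum>b'\<in>B. of_int (if b' = b then 1 else 0) *\<^sub>R b')"
      using finB by (simp add: if_distrib[of "\<lambda>t. of_int t *\<^sub>R _"] cong: if_cong)
    then show "b \<in> int_lattice (index_C n)"
      unfolding L by - (intro CollectI exI conjI TrueI)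
  qed
  have spanB: "span B = ?U"
  proof
    show "span B \<subseteq> ?U"
      using BL by (intro span_minimal subspace_coord_space) (auto simp: int_lattice_def)
    show "?U \<subseteq> span B"
    proof
      fix w assume w: "w \<in> ?U"
      have "?single q \<in> span B" for q
      proof -
        have "?single q \<in> int_lattice (index_C n)"
          using singleU by (auto simp: int_lattice_def single)
        then obtain c :: "_ \<Rightarrow> int" where "?single q = (\<Sum>b\<in>B. of_int (c b) *\<^sub>R b)"
          unfolding L by blast
        then show ?thesis by (simp add: span_sum span_scale span_base)
      qed
      then have "(\<Sum>q\<in>index_C n. coef w q *\<^sub>R ?single q) \<in> span B"
        by (intro span_sum span_scale)
      moreover have "w = (\<Sum>q\<in>index_C n. coef w q *\<^sub>R ?single q)"
      proof (rule coord_space_eqI[OF w])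
        show "(\<Sum>q\<in>index_C n. coef w q *\<^sub>R ?single q) \<in> ?U"
          by (intro subspace_sum subspace_scale subspace_coord_space singleU)
      qed (simp add: lookup_sum single finite_index_C if_distrib[of "\<lambda>t. _ * t"] cong: if_cong)
      ultimately show "w \<in> span B" by simp
    qed
  qed
  have linF: "linear f" if "f \<in> ?F" for f
  proof -
    have "linear (\<lambda>w. coef w p)" for p using linear_sum_coef[of "{p}"] by simp
    moreover have "linear (\<lambda>w. - (\<Sum>p\<in>D. coef w p))" for D
      by (rule linear_compose_neg[OF linear_sum_coef])
    ultimately show ?thesis using that by (auto simp: tight_functionals_def)
  qed
  have finF: "finite ?F"
  proof -
    have "finite {D. tight n a v D}"
      by (rule finite_subset[OF _ finite_dyck_sets[of n]]) (auto simp: tight_def)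
    then show ?thesis by (simp add: tight_functionals_def finite_index_C)
  qed
  have cone: "convex_cone hull B = {w \<in> ?U. \<forall>f\<in>?F. 0 \<le> f w}"
    unfolding B(2)[symmetric] ball_Un tangent_cone_FFLV_C[OF vP] tight_functionals_def
    by auto
  have nonzero: "\<exists>w\<in>?U. f w \<noteq> 0" if "f \<in> ?F" for f
    using that unfolding tight_functionals_def
  proof (elim UnE imageE)
    fix p assume p: "f = (\<lambda>w. coef w p)" "p \<in> {p \<in> index_C n. coef v p = 0}"
    then have "f (?single p) \<noteq> 0" by (simp add: single)
    then show ?thesis using singleU by blast
  next
    fix D assume D: "f = (\<lambda>w. - (\<Sum>p\<in>D. coef w p))" "D \<in> {D. tight n a v D}"
    then have "f v \<noteq> 0" using bound_pos[where a=a, OF pos] by (fastforce simp: tight_def)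
    then show ?thesis using vP by (auto simp: FFLV_C_def)
  qed
  let ?f = "\<lambda>w. - (\<Sum>p\<in>D. coef w p)"
  have f: "?f \<in> ?F" using D by (auto simp: tight_functionals_def)
  have extremal: "g b = f" if "f \<in> ?F" "\<And>b. b \<in> B \<Longrightarrow> 0 \<le> t b" "\<And>b. b \<in> B \<Longrightarrow> g b \<in> ?F"
    "\<And>w. w \<in> ?U \<Longrightarrow> f w = (\<Sum>b\<in>B. t b * g b w)" "b \<in> B" "0 < t b" for f t g b
    by (rule tight_functionals_extremal[where a=a and B=B and t=t and g=g and b=b]) fact+
  have "\<exists>w. w \<in> ?U \<and> 0 < ?f w \<and> (\<forall>f'. f' \<in> ?F \<longrightarrow> f' \<noteq> ?f \<longrightarrow> f' w = 0)"
  proof (rule simplicial_cone_separates_inequalities[where F="?F" and B=B and U="?U" and f="?f"])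
    fix w assume "w \<in> ?U" "0 < ?f w" "\<And>f'. f' \<in> ?F \<Longrightarrow> f' \<noteq> ?f \<Longrightarrow> f' w = 0"
    then show ?thesis by blast
  qed (fact finF linF finB indB spanB cone extremal nonzero f)+
  then obtain w where w: "w \<in> ?U" "0 < ?f w" "\<And>f'. f' \<in> ?F \<Longrightarrow> f' \<noteq> ?f \<Longrightarrow> f' w = 0"
    by blast
  have sum_single: "(\<Sum>p\<in>D. coef (?single q) p) = (if q \<in> D then 1 else 0)" if "tight n a v D" for D q
    using that sum_unit_point[OF finite_index_C dyck_set_subset] unfolding tight_def by metis
  show ?thesis
  proof
    show "w \<in> ?U" by (rule w)
    show "(\<Sum>p\<in>D. coef w p) \<noteq> 0" using w(2) by simp
    fix p assume p: "p \<in> index_C n" "coef v p = 0"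
    \<comment> \<open>Functionals are compared as functions, so different constraints must be shown
      to differ as such; the unit vector at \<open>p\<close> gives 1 for the coordinate and 0 or -1
      for a path.\<close>
    have "(\<lambda>w. coef w p) \<noteq> ?f"
    proof
      assume "(\<lambda>w. coef w p) = ?f"
      then have "coef (?single p) p = ?f (?single p)" by metis
      then have "coef (?single p) p = - (if p \<in> D then 1 else 0)" by (simp only: sum_single[OF D])
      then show False using p by (simp add: single split: if_splits)
    qed
    then show "coef w p = 0" using w(3) p by (auto simp: tight_functionals_def)
  next
    fix D' assume D': "tight n a v D'" "D' \<noteq> D"
    have "(\<lambda>w. - (\<Sum>p\<in>D'. coef w p)) \<noteq> ?f"
    proof
      assume *: "(\<lambda>w. - (\<Sum>p\<in>D'. coef w p)) = ?f"
      have "q \<in> D' \<longleftrightarrow> q \<in> D" for q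
        using fun_cong[OF *, of "?single q"] by (simp add: sum_single[OF D] sum_single[OF D'(1)] split: if_splits)
      then show False using D'(2) by blast
    qed
    moreover have "(\<lambda>w. - (\<Sum>p\<in>D'. coef w p)) \<in> ?F" using D' by (auto simp: tight_functionals_def)
    ultimately show "(\<Sum>p\<in>D'. coef w p) = 0" using w(3) by fastforce
  qed
qed

section \<open>Simple vertices\<close>

lemma sum_bound_split:
  fixes a :: "nat \<Rightarrow> nat"
  assumes "i \<le> Suc p" "p \<le> m"
  shows "(\<Sum>k=i..m. real (a k)) = (\<Sum>k=i..p. real (a k)) + (\<Sum>k=Suc p..m. real (a k))"
  using sum.atLeastLessThan_concat[of i "Suc p" "Suc m" "\<lambda>k. real (a k)"] assms
  by (simp add: atLeastLessThanSuc_atLeastAtMost)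

lemma sum_bound_swap:
  fixes a :: "nat \<Rightarrow> nat"
  assumes "i \<le> m" "i' \<le> m'" "i \<le> m'" "i' \<le> m"
  shows "(\<Sum>k=i..m'. real (a k)) + (\<Sum>k=i'..m. real (a k)) =
    (\<Sum>k=i..m. real (a k)) + (\<Sum>k=i'..m'. real (a k))"
proof -
  have diff: "(\<Sum>k=x..y. real (a k)) = (\<Sum>k=0..y. real (a k)) - (\<Sum>k=0..<x. real (a k))" if "x \<le> y" for x y
    using sum.atLeastLessThan_concat[of 0 x "Suc y" "\<lambda>k. real (a k)"] that
    by (simp add: atLeastLessThanSuc_atLeastAtMost)
  show ?thesis using diff[of i m] diff[of i' m'] diff[of i m'] diff[of i' m] assms by linarith
qed

lemma sum_insert_union:
  fixes f :: "'a \<Rightarrow> real"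
  assumes "finite A" "finite B" "A \<inter> B = {}" "r \<notin> A" "r \<notin> B"
  shows "sum f (insert r (A \<union> B)) = f r + (sum f A + sum f B)"
  using assms by (simp add: sum.union_disjoint)

locale simple_FFLV_C =
  fixes n :: nat and a :: "nat \<Rightarrow> nat" and v :: point
  assumes pos: "\<And>i. i \<in> {1..n} \<Longrightarrow> 0 < a i"
    and simple: "simple_vertex (int_lattice (index_C n)) (FFLV_C n a) v"
begin

definition tight_path :: "nat \<Rightarrow> nat \<Rightarrow> (nat \<times> nat) set \<Rightarrow> bool" where
  "tight_path i m D \<longleftrightarrow> dyck_set n i m D \<and> (\<Sum>p\<in>D. coef v p) = (\<Sum>k=i..m. real (a k))"

definition supp :: "(nat \<times> nat) set" where
  "supp = {p \<in> index_C n. 0 < coef v p}"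

lemma tight_iff: "tight n a v D \<longleftrightarrow> (\<exists>i m. tight_path i m D)"
  by (simp add: tight_def tight_path_def)

lemma tight_path_dyck: "tight_path i m D \<Longrightarrow> dyck_set n i m D"
  by (simp add: tight_path_def)

lemma extreme: "v extreme_point_of FFLV_C n a"
  using simple by (simp add: simple_vertex_def)

lemma v_mem: "v \<in> FFLV_C n a"
  using extreme by (simp add: extreme_point_of_def)

lemma v_nonneg: "p \<in> index_C n \<Longrightarrow> 0 \<le> coef v p"
  using v_mem by (auto simp: FFLV_C_def)

lemma v_zero: "p \<in> index_C n \<Longrightarrow> p \<notin> supp \<Longrightarrow> coef v p = 0"
  using v_nonneg[of p] by (auto simp: supp_def)

lemma path_le: "dyck_set n i m D \<Longrightarrow> (\<Sum>p\<in>D. coef v p) \<le> (\<Sum>k=i..m. real (a k))"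
  using v_mem by (auto simp: FFLV_C_eq)

lemma separates:
  assumes "tight_path i m D"
  obtains w where "w \<in> coord_space (index_C n)" "(\<Sum>p\<in>D. coef w p) \<noteq> 0"
    "\<And>p. p \<in> index_C n \<Longrightarrow> p \<notin> supp \<Longrightarrow> coef w p = 0"
    "\<And>i m D'. tight_path i m D' \<Longrightarrow> D' \<noteq> D \<Longrightarrow> (\<Sum>p\<in>D'. coef w p) = 0"
proof -
  have D: "tight n a v D" using assms tight_iff by blast
  obtain w where w: "w \<in> coord_space (index_C n)" "(\<Sum>p\<in>D. coef w p) \<noteq> 0"
    "\<And>p. p \<in> index_C n \<Longrightarrow> coef v p = 0 \<Longrightarrow> coef w p = 0"
    "\<And>D'. tight n a v D' \<Longrightarrow> D' \<noteq> D \<Longrightarrow> (\<Sum>p\<in>D'. coef w p) = 0"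
    using simple_vertex_separates[where a=a, OF pos simple D] by metis
  show ?thesis
  proof
    show "coef w p = 0" if "p \<in> index_C n" "p \<notin> supp" for p
      using w(3)[OF that(1)] v_zero[OF that] by blast
    show "(\<Sum>p\<in>D'. coef w p) = 0" if "tight_path i m D'" "D' \<noteq> D" for i m D'
      using w(4) that tight_iff by blast
  qed (use w in auto)
qed

section \<open>Corners and end points of tight paths\<close>

text \<open>If \<open>v\<close> vanished at \<open>r\<close>, the bound for the exchanged path would
  force \<open>v\<close> to vanish at \<open>r'\<close> as well, making that path tight. The two
  tight paths would then differ only off the support, where the separating vector is zero.\<close>

lemma exchange_supp:
  assumes D: "tight_path i m D" and r: "r \<in> D" "r' \<notin> D"
    and D': "dyck_set n i m (insert r' (D - {r}))"
  shows "r \<in> supp"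
proof (rule ccontr)
  assume "r \<notin> supp"
  let ?D' = "insert r' (D - {r})"
  have fin: "finite D" using D dyck_set_finite tight_path_dyck by blast
  have sub: "D \<subseteq> index_C n" "?D' \<subseteq> index_C n"
    using D D' dyck_set_subset tight_path_dyck by blast+
  have sum: "(\<Sum>p\<in>?D'. f p) = (\<Sum>p\<in>D. f p) - f r + f r'" for f :: "_ \<Rightarrow> real"
    using r fin sum.remove[OF fin r(1), of f] by simp
  have r0: "coef v r = 0" using v_zero r sub \<open>r \<notin> supp\<close> by blast
  have "(\<Sum>p\<in>?D'. coef v p) \<le> (\<Sum>p\<in>D. coef v p)"
    using path_le[OF D'] D by (simp add: tight_path_def)
  then have "coef v r' \<le> 0" using sum[of "coef v"] r0 by simp
  then have r'0: "coef v r' = 0" "r' \<notin> supp" using v_nonneg[of r'] sub by (auto simp: supp_def)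
  have "tight_path i m ?D'"
    using D D' sum[of "coef v"] r0 r'0 by (simp add: tight_path_def)
  moreover have "?D' \<noteq> D" using r by blast
  moreover obtain w where w: "(\<Sum>p\<in>D. coef w p) \<noteq> 0"
    "\<And>p. p \<in> index_C n \<Longrightarrow> p \<notin> supp \<Longrightarrow> coef w p = 0"
    "\<And>i m D'. tight_path i m D' \<Longrightarrow> D' \<noteq> D \<Longrightarrow> (\<Sum>p\<in>D'. coef w p) = 0"
    using separates[OF D] by metis
  ultimately have "(\<Sum>p\<in>?D'. coef w p) = 0" by blast
  moreover have "coef w r = 0" "coef w r' = 0"
    using w(2)[of r] w(2)[of r'] sub r(1) \<open>r \<notin> supp\<close> r'0(2) by auto
  ultimately show False using w(1) sum[of "coef w"] by simp
qed

text \<open>Away from the diagonal the corner can be flipped to \<open>(Suc p, q)\<close>. For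
  \<open>q = Suc p\<close> that point leaves the index set; then removing a corner of value 0 leaves
  two paths whose bounds add up to the old one, so both are tight and together equal
  \<open>D\<close> off the corner.\<close>

lemma upper_corner_supp:
  assumes D: "tight_path i m D" and c: "(p, q) \<in> D" "(p, Suc q) \<in> D" "(Suc p, Suc q) \<in> D"
  shows "(p, Suc q) \<in> supp"
proof -
  have d: "dyck_set n i m D" using D by (rule tight_path_dyck)
  have "Suc p < Suc q" using dyck_set_subset[OF d] c(3) by (auto simp: index_C_def)
  then consider "Suc p < q" | "q = Suc p" by linarith
  then show ?thesis
  proof cases
    case 1
    have "(Suc p, q) \<notin> D" using dyck_set_level_unique[OF d c(2), of "Suc p" q] by auto
    moreover have "dyck_set n i m (insert (Suc p, q) (D - {(p, Suc q)}))"
      using dyck_set_level[OF d c(1)] 1 c by (intro dyck_set_update[OF d c(2)]) auto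
    ultimately show ?thesis using exchange_supp[OF D c(2)] by blast
  next
    case 2
    let ?r = "(p, Suc (Suc p))"
    let ?D1 = "{(x, y) \<in> D. x + y < 2*p+2}" and ?D2 = "{(x, y) \<in> D. 2*p+2 < x + y}"
    have D12: "dyck_set n i p ?D1" "dyck_set n (Suc p) m ?D2"
      using dyck_set_split[OF d] c 2 by auto
    have fin: "finite D" using d by (rule dyck_set_finite)
    have Deq: "D = insert ?r (?D1 \<union> ?D2)"
    proof (intro equalityI subsetI)
      fix z assume z: "z \<in> D"
      obtain x y where xy: "z = (x, y)" by (cases z)
      consider "x + y < 2*p+2" | "2*p+2 < x + y" | "x + y = 2*p+2" by linarith
      then show "z \<in> insert ?r (?D1 \<union> ?D2)"
      proof cases
        case 3
        then have "z = ?r" using dyck_set_level_unique[OF d c(2), of x y] z xy 2 by simp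
        then show ?thesis by simp
      qed (use z xy in auto)
    next
      fix z assume "z \<in> insert ?r (?D1 \<union> ?D2)"
      then show "z \<in> D" using c(2) 2 by auto
    qed
    have sum: "(\<Sum>x\<in>D. f x) = f ?r + ((\<Sum>x\<in>?D1. f x) + (\<Sum>x\<in>?D2. f x))" for f :: "_ \<Rightarrow> real"
    proof -
      have "finite ?D1" "finite ?D2" using D12 dyck_set_finite by blast+
      moreover have "?D1 \<inter> ?D2 = {}" by auto
      moreover have "?r \<notin> ?D1" "?r \<notin> ?D2" by auto
      ultimately have "sum f (insert ?r (?D1 \<union> ?D2)) = f ?r + (sum f ?D1 + sum f ?D2)"
        by (rule sum_insert_union)
      then show ?thesis using Deq by simp
    qed
    show ?thesis
    proof (rule ccontr)
      assume ns: "(p, Suc q) \<notin> supp"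
      have rD: "?r \<in> D" "?r \<notin> ?D1" "?r \<notin> ?D2" using c(2) 2 by auto
      have rI: "?r \<in> index_C n" using dyck_set_subset[OF d] c(2) 2 by auto
      have r0: "coef v ?r = 0" using v_zero[OF rI] ns 2 by simp
      have "i \<le> p" "Suc p \<le> m" using dyck_set_range[OF D12(1)] dyck_set_range[OF D12(2)] by auto
      then have b: "(\<Sum>k=i..m. real (a k)) = (\<Sum>k=i..p. real (a k)) + (\<Sum>k=Suc p..m. real (a k))"
        by (intro sum_bound_split) auto
      have "tight_path i p ?D1" "tight_path (Suc p) m ?D2"
        using path_le[OF D12(1)] path_le[OF D12(2)] D b sum[of "coef v"] r0 D12
        by (auto simp: tight_path_def)
      moreover have "?D1 \<noteq> D" "?D2 \<noteq> D" using rD by metis+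
      moreover obtain w where w: "(\<Sum>p\<in>D. coef w p) \<noteq> 0"
        "\<And>p. p \<in> index_C n \<Longrightarrow> p \<notin> supp \<Longrightarrow> coef w p = 0"
        "\<And>i m D'. tight_path i m D' \<Longrightarrow> D' \<noteq> D \<Longrightarrow> (\<Sum>p\<in>D'. coef w p) = 0"
        using separates[OF D] by metis
      ultimately have "(\<Sum>p\<in>?D1. coef w p) = 0" "(\<Sum>p\<in>?D2. coef w p) = 0" by blast+
      moreover have "coef w ?r = 0" using w(2)[OF rI] ns 2 by simp
      ultimately show False using w(1) sum[of "coef w"] by simp
    qed
  qed
qed

text \<open>The flipped point lies on the same level and further from the diagonal, so it never
  leaves the index set.\<close>

lemma lower_corner_supp:
  assumes D: "tight_path i m D" and c: "(p, q) \<in> D" "(Suc p, q) \<in> D" "(Suc p, Suc q) \<in> D"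
  shows "(Suc p, q) \<in> supp"
proof -
  have d: "dyck_set n i m D" using D by (rule tight_path_dyck)
  have "p < q" using dyck_set_subset[OF d] c(1) by (auto simp: index_C_def)
  then have "dyck_set n i m (insert (p, Suc q) (D - {(Suc p, q)}))"
    using dyck_set_level[OF d c(1)] c by (intro dyck_set_update[OF d c(2)]) auto
  moreover have "(p, Suc q) \<notin> D" using dyck_set_level_unique[OF d c(2), of p "Suc q"] by auto
  ultimately show ?thesis using exchange_supp[OF D c(2)] by blast
qed

text \<open>A path may end anywhere on the antidiagonal, so its last point can be moved to the other
  successor of its predecessor. A path without predecessor is a single point, whose value is the
  positive bound.\<close>

lemma end_supp:
  assumes D: "tight_path i m D" and r: "(p, q) \<in> D" "p + q = 2*n+1"
  shows "(p, q) \<in> supp"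
proof -
  have d: "dyck_set n i m D" using D by (rule tight_path_dyck)
  have m: "m = n" using dyck_set_level[OF d r(1)] dyck_set_range[OF d] r(2) by auto
  have pq: "1 \<le> p" "p < q" "(p, q) \<in> index_C n"
    using dyck_set_subset[OF d] r(1) by (auto simp: index_C_def)
  show ?thesis
  proof (cases "i = n")
    case True
    have "D = {(p, q)}"
    proof -
      have "(x, y) = (p, q)" if "(x, y) \<in> D" for x y
        using dyck_set_level[OF d that] True m r(2) dyck_set_level_unique[OF d r(1) that] by simp
      then have "D \<subseteq> {(p, q)}" by (intro subrelI) (simp only: insert_iff simp_thms)
      then show ?thesis using r(1) by blast
    qed
    then have "coef v (p, q) = (\<Sum>k=i..m. real (a k))" using D by (simp add: tight_path_def)
    then have "0 < coef v (p, q)" using bound_pos[where a=a, OF pos d] by simp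
    then show ?thesis using pq by (simp add: supp_def)
  next
    case False
    then have l: "2*i+1 < p + q" using dyck_set_range[OF d] m r(2) by auto
    then consider "(p, q - 1) \<in> D" | "(p - 1, q) \<in> D" using dyck_set_prev[OF d r(1)] by blast
    then show ?thesis
    proof cases
      case 1
      then have "p < q - 1" using dyck_set_subset[OF d] by (auto simp: index_C_def)
      \<comment> \<open>The level \<open>2*n+1\<close> is odd, so \<open>p\<close> and
        \<open>q\<close> differ by an odd number.\<close>
      then have "Suc p < q - 1" using r(2) by presburger
      then have "dyck_set n i m (insert (Suc p, q - 1) (D - {(p, q)}))"
        using 1 l r m pq by (intro dyck_set_update[OF d r(1)]) auto
      moreover have "(Suc p, q - 1) \<notin> D"
        using dyck_set_level_unique[OF d r(1), of "Suc p" "q - 1"] pq by auto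
      ultimately show ?thesis using exchange_supp[OF D r(1)] by blast
    next
      case 2
      then have "dyck_set n i m (insert (p - 1, Suc q) (D - {(p, q)}))"
        using l r m pq by (intro dyck_set_update[OF d r(1)]) auto
      moreover have "(p - 1, Suc q) \<notin> D"
        using dyck_set_level_unique[OF d r(1), of "p - 1" "Suc q"] pq by auto
      ultimately show ?thesis using exchange_supp[OF D r(1)] by blast
    qed
  qed
qed

text \<open>Exchanging tails preserves the total sum and the total bound; as each new path obeys its
  own inequality, both inequalities are equalities.\<close>

lemma tight_path_join:
  assumes D: "tight_path i m D" and D': "tight_path i' m' D'" and r: "(p, q) \<in> D" "(p, q) \<in> D'"
  shows "tight_path i m' (join (p + q) D D')"
proof -
  have d: "dyck_set n i m D" "dyck_set n i' m' D'" using D D' by (auto simp: tight_path_def)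
  have j: "dyck_set n i m' (join (p + q) D D')" "dyck_set n i' m (join (p + q) D' D)"
    using dyck_set_join d r by blast+
  have "(\<Sum>k=i..m'. real (a k)) + (\<Sum>k=i'..m. real (a k)) =
      (\<Sum>k=i..m. real (a k)) + (\<Sum>k=i'..m'. real (a k))"
    using dyck_set_range[OF d(1)] dyck_set_range[OF d(2)] dyck_set_range[OF j(1)] dyck_set_range[OF j(2)]
    by (intro sum_bound_swap) auto
  then show ?thesis
    using path_le[OF j(1)] path_le[OF j(2)] sum_join[OF d r, of "coef v"] D D' j(1)
    by (simp add: tight_path_def)
qed

text \<open>The point \<open>w\<close> stores the coefficients of a combination of support
  coordinates, evaluated on a path by summing over it. The combination represents the indicator of
  \<open>P\<close> on tight paths only, and \<open>X\<close> limits the coordinates that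
  occur.\<close>

definition supported_functional :: "((nat \<times> nat) set \<Rightarrow> bool) \<Rightarrow> (nat \<times> nat \<Rightarrow> bool) \<Rightarrow> bool" where
  "supported_functional P X \<longleftrightarrow> (\<exists>w \<in> coord_space (index_C n).
     (\<forall>p. coef w p \<noteq> 0 \<longrightarrow> p \<in> supp \<and> X p) \<and>
     (\<forall>i m D. tight_path i m D \<longrightarrow> (\<Sum>p\<in>D. coef w p) = of_bool (P D)))"

lemma supported_functional_zero:
  assumes "\<And>i m D. tight_path i m D \<Longrightarrow> \<not> P D"
  shows "supported_functional P X"
  unfolding supported_functional_def using assms
  by (intro bexI[of _ 0]) (auto simp: coord_space_def)

lemma supported_functional_cong:
  assumes "supported_functional P X" "\<And>i m D. tight_path i m D \<Longrightarrow> P D = Q D" "\<And>p. X p \<Longrightarrow> Y p"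
  shows "supported_functional Q Y"
proof -
  obtain w where w: "w \<in> coord_space (index_C n)" "\<And>p. coef w p \<noteq> 0 \<Longrightarrow> p \<in> supp \<and> X p"
    "\<And>i m D. tight_path i m D \<Longrightarrow> (\<Sum>p\<in>D. coef w p) = of_bool (P D)"
    using assms(1) unfolding supported_functional_def by blast
  then show ?thesis
    unfolding supported_functional_def using assms(2,3) by (intro bexI[of _ w]) auto
qed

lemma supported_functional_diff:
  assumes P: "supported_functional P X" and s: "s \<in> supp" "X s"
    and Q: "\<And>i m D. tight_path i m D \<Longrightarrow> Q D \<longleftrightarrow> s \<in> D \<and> \<not> P D"
    and P_mem: "\<And>i m D. tight_path i m D \<Longrightarrow> P D \<Longrightarrow> s \<in> D"
  shows "supported_functional Q X"
proof -
  obtain w where w: "w \<in> coord_space (index_C n)" "\<And>p. coef w p \<noteq> 0 \<Longrightarrow> p \<in> supp \<and> X p"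
    "\<And>i m D. tight_path i m D \<Longrightarrow> (\<Sum>p\<in>D. coef w p) = of_bool (P D)"
    using P unfolding supported_functional_def by blast
  define y where "y = Poly_Mapping.single s 1 - w"
  have sI: "s \<in> index_C n" using s by (simp add: supp_def)
  have y: "coef y p = of_bool (p = s) - coef w p" for p
    by (simp add: y_def lookup_minus lookup_single when_def)
  show ?thesis
    unfolding supported_functional_def
  proof (intro bexI[of _ y] conjI allI impI)
    show "y \<in> coord_space (index_C n)" using w(1) sI by (auto simp: coord_space_def y)
    fix p assume "coef y p \<noteq> 0"
    then have "p = s \<or> coef w p \<noteq> 0" by (auto simp: y)
    then show "p \<in> supp" "X p" using s w(2)[of p] by auto
  next
    fix i m D assume D: "tight_path i m D"
    then have "finite D" using dyck_set_finite tight_path_dyck by blast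
    then have "(\<Sum>p\<in>D. coef y p) = of_bool (s \<in> D) - of_bool (P D)"
      by (simp add: y sum_subtractf w(3)[OF D] of_bool_def)
    then show "(\<Sum>p\<in>D. coef y p) = of_bool (Q D)" using Q[OF D] P_mem[OF D] by auto
  qed
qed

text \<open>If \<open>P\<close> agreed with passing through \<open>s\<close> on all tight paths, the
  unit vector at \<open>s\<close> minus the combination would vanish on them and off the support,
  hence be zero at an extreme point; but \<open>X\<close> excludes \<open>s\<close>, so its
  coefficient there is 1.\<close>

lemma supported_functional_not_coordinate:
  assumes P: "supported_functional P X" and s: "s \<in> supp" "\<not> X s"
  obtains i m D where "tight_path i m D" "P D \<noteq> (s \<in> D)"
proof -
  obtain w where w: "w \<in> coord_space (index_C n)" "\<And>p. coef w p \<noteq> 0 \<Longrightarrow> p \<in> supp \<and> X p"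
    "\<And>i m D. tight_path i m D \<Longrightarrow> (\<Sum>p\<in>D. coef w p) = of_bool (P D)"
    using P unfolding supported_functional_def by blast
  define y where "y = Poly_Mapping.single s 1 - w"
  have sI: "s \<in> index_C n" using s by (simp add: supp_def)
  have y: "coef y p = of_bool (p = s) - coef w p" for p
    by (simp add: y_def lookup_minus lookup_single when_def)
  have "\<exists>i m D. tight_path i m D \<and> P D \<noteq> (s \<in> D)"
  proof (rule ccontr)
    assume *: "\<not> ?thesis"
    have "y = 0"
    proof (rule extreme_point_annihilator[OF extreme])
      show "y \<in> coord_space (index_C n)" using w(1) sI by (auto simp: coord_space_def y)
      show "coef y p = 0" if "coef v p = 0" for p
        using that w(2)[of p] s by (auto simp: y supp_def)
      fix D assume "tight n a v D"
      then obtain i m where D: "tight_path i m D" using tight_iff by blast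
      then have "finite D" using dyck_set_finite tight_path_dyck by blast
      then have "(\<Sum>p\<in>D. coef y p) = of_bool (s \<in> D) - of_bool (P D)"
        by (simp add: y sum_subtractf w(3)[OF D] of_bool_def)
      then show "(\<Sum>p\<in>D. coef y p) = 0" using * D by auto
    qed
    then have "coef y s = 0" by simp
    then show False using w(2)[of s] s by (auto simp: y)
  qed
  then show ?thesis using that by blast
qed

text \<open>The indicator of an edge, as a function of the tight path, is a combination of coordinates in
  the support lying weakly above and to the right of the edge: at a point outside the support no
  tight path turns, and at a point of the support the two incoming (outgoing) edges add up to the
  coordinate.\<close>

lemma supported_functional_edges:
  "(\<forall>j. supported_functional (\<lambda>D. (i, j) \<in> D \<and> (i, Suc j) \<in> D) (\<lambda>(p, q). p \<le> i \<and> j < q)) \<and>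
   (\<forall>j. supported_functional (\<lambda>D. (i, j) \<in> D \<and> (Suc i, j) \<in> D) (\<lambda>(p, q). p \<le> i \<and> j \<le> q))"
proof (induction i)
  case 0
  have "(0, j) \<notin> D" if "tight_path i m D" for i m D j
    using dyck_set_subset[OF tight_path_dyck[OF that]] by (auto simp: index_C_def)
  then show ?case by (auto intro!: supported_functional_zero)
next
  case (Suc i)
  \<comment> \<open>Rows are treated from the top and, within a row, right edges from the far column
    backwards: the edge into \<open>?s\<close> reduces to the edge entering \<open>?s\<close> from
    the previous row or to the next right edge.\<close>
  have right: "supported_functional (\<lambda>D. (Suc i, j) \<in> D \<and> (Suc i, Suc j) \<in> D) (\<lambda>(p, q). p \<le> Suc i \<and> j < q)" for j
  proof (induction "2*n+1 - j" arbitrary: j rule: less_induct)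
    case less
    let ?r = "(Suc i, j)" and ?s = "(Suc i, Suc j)"
    show ?case
    proof (cases "?r \<in> index_C n \<and> ?s \<in> index_C n")
      case False
      have "\<not> (?r \<in> D \<and> ?s \<in> D)" if "tight_path i m D" for i m D
        using dyck_set_subset[OF tight_path_dyck[OF that]] False by blast
      then show ?thesis by (rule supported_functional_zero)
    next
      case True
      then have ij: "Suc i < j" "Suc i + Suc j \<le> 2*n+1" by (auto simp: index_C_def)
      have not_start: "2*i0+1 < Suc i + Suc j" if D: "dyck_set n i0 m D" and s: "?s \<in> D" for i0 m D
      proof -
        have "2*i0+1 \<noteq> Suc i + Suc j"
          using dyck_set_level_unique[OF D dyck_set_start[OF D] s] ij by auto
        then show ?thesis using dyck_set_level[OF D s] by linarith
      qed
      show ?thesis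
      proof (cases "?s \<in> supp")
        case True
        have "supported_functional (\<lambda>D. (i, Suc j) \<in> D \<and> ?s \<in> D) (\<lambda>(p, q). p \<le> Suc i \<and> j < q)"
          using Suc.IH by (auto intro: supported_functional_cong)
        then show ?thesis
        proof (rule supported_functional_diff[OF _ True])
          fix i0 m D assume "tight_path i0 m D"
          then have D: "dyck_set n i0 m D" by (rule tight_path_dyck)
          show "?r \<in> D \<and> ?s \<in> D \<longleftrightarrow> ?s \<in> D \<and> \<not> ((i, Suc j) \<in> D \<and> ?s \<in> D)"
            using dyck_set_prev[OF D _ not_start[OF D]] by auto
        qed auto
      next
        case False
        have "2*n+1 - Suc j < 2*n+1 - j" using ij by simp
        from less[OF this] show ?thesis
        proof (rule supported_functional_cong)
          fix i0 m D assume TD: "tight_path i0 m D"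
          then have D: "dyck_set n i0 m D" by (rule tight_path_dyck)
          show "?s \<in> D \<and> (Suc i, Suc (Suc j)) \<in> D \<longleftrightarrow> ?r \<in> D \<and> ?s \<in> D"
          proof safe
            assume s: "?s \<in> D" "(Suc i, Suc (Suc j)) \<in> D"
            then have "(i, Suc j) \<notin> D" using lower_corner_supp[OF TD] False by blast
            then show "?r \<in> D" using dyck_set_prev[OF D s(1) not_start[OF D s(1)]] by auto
          next
            assume r: "?r \<in> D" "?s \<in> D"
            \<comment> \<open>A path ending at \<open>?s\<close> would end on the antidiagonal,
              since \<open>?s\<close> is not next to the diagonal, and then \<open>?s\<close> would
              be in the support.\<close>
            have "Suc i + Suc j < 2*m+1"
            proof (rule ccontr)
              assume "\<not> ?thesis"
              then have l: "Suc i + Suc j = 2*m+1" using dyck_set_level[OF D r(2)] by simp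
              show False
              proof (cases "m < n")
                case True
                then show False using dyck_set_level_unique[OF D dyck_set_end[OF D True] r(2)] l ij by auto
              next
                case False
                then have "m = n" using dyck_set_range[OF D] by simp
                then show False using end_supp[OF TD r(2)] l \<open>?s \<notin> supp\<close> by simp
              qed
            qed
            moreover have "(Suc (Suc i), Suc j) \<notin> D" using upper_corner_supp[OF TD r] False by blast
            ultimately show "(Suc i, Suc (Suc j)) \<in> D" using dyck_set_next[OF D r(2)] by blast
          qed
        qed auto
      qed
    qed
  qed
  have down: "supported_functional (\<lambda>D. (Suc i, j) \<in> D \<and> (Suc (Suc i), j) \<in> D) (\<lambda>(p, q). p \<le> Suc i \<and> j \<le> q)" for j
  proof -
    let ?r = "(Suc i, j)" and ?d = "(Suc (Suc i), j)"
    show ?thesis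
    proof (cases "?r \<in> index_C n \<and> ?d \<in> index_C n")
      case False
      have "\<not> (?r \<in> D \<and> ?d \<in> D)" if "tight_path i m D" for i m D
        using dyck_set_subset[OF tight_path_dyck[OF that]] False by blast
      then show ?thesis by (rule supported_functional_zero)
    next
      case True
      then have ij: "Suc (Suc i) < j" "Suc (Suc i) + j \<le> 2*n+1" by (auto simp: index_C_def)
      have not_end: "Suc i + j < 2*m+1" if D: "dyck_set n i0 m D" and r: "?r \<in> D" for i0 m D
      proof -
        have "Suc i + j \<noteq> 2*m+1"
        proof
          assume l: "Suc i + j = 2*m+1"
          then have "m < n" using ij by simp
          then show False using dyck_set_level_unique[OF D dyck_set_end[OF D] r] l ij by auto
        qed
        then show ?thesis using dyck_set_level[OF D r] by linarith
      qed
      show ?thesis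
      proof (cases "?r \<in> supp")
        case True
        have "supported_functional (\<lambda>D. ?r \<in> D \<and> (Suc i, Suc j) \<in> D) (\<lambda>(p, q). p \<le> Suc i \<and> j \<le> q)"
          using right[of j] by (rule supported_functional_cong) auto
        then show ?thesis
        proof (rule supported_functional_diff[OF _ True])
          fix i0 m D assume "tight_path i0 m D"
          then have D: "dyck_set n i0 m D" by (rule tight_path_dyck)
          show "?r \<in> D \<and> ?d \<in> D \<longleftrightarrow> ?r \<in> D \<and> \<not> (?r \<in> D \<and> (Suc i, Suc j) \<in> D)"
            using dyck_set_next[OF D _ not_end[OF D]] by auto
        qed auto
      next
        case False
        have "supported_functional (\<lambda>D. (i, j) \<in> D \<and> ?r \<in> D) (\<lambda>(p, q). p \<le> i \<and> j \<le> q)"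
          using Suc.IH by blast
        then show ?thesis
        proof (rule supported_functional_cong)
          fix i0 m D assume TD: "tight_path i0 m D"
          then have D: "dyck_set n i0 m D" by (rule tight_path_dyck)
          show "(i, j) \<in> D \<and> ?r \<in> D \<longleftrightarrow> ?r \<in> D \<and> ?d \<in> D"
          proof safe
            assume r: "(i, j) \<in> D" "?r \<in> D"
            then have "(Suc i, Suc j) \<notin> D" using lower_corner_supp[OF TD] False by blast
            then show "?d \<in> D" using dyck_set_next[OF D r(2) not_end[OF D r(2)]] by blast
          next
            assume r: "?r \<in> D" "?d \<in> D"
            have "2*i0+1 \<noteq> Suc i + j"
              using dyck_set_level_unique[OF D dyck_set_start[OF D] r(1)] ij by auto
            then have l: "2*i0+1 < Suc i + j" using dyck_set_level[OF D r(1)] by linarith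
            obtain k where k: "j = Suc k" using ij by (cases j) auto
            have "(Suc i, k) \<notin> D" using upper_corner_supp[OF TD, of "Suc i" k] r k False by blast
            then show "(i, j) \<in> D" using dyck_set_prev[OF D r(1) l] k by auto
          qed
        qed auto
      qed
    qed
  qed
  show ?case using right down by blast
qed

section \<open>Tight paths are hooks\<close>

text \<open>The edge entering from above is expressed by coordinates in rows above \<open>i\<close>,
  so it cannot agree with the coordinate \<open>(i, j)\<close> on all tight paths.\<close>

lemma supp_not_from_above:
  assumes "(i, j) \<in> supp"
  obtains i0 m D where "tight_path i0 m D" "(i, j) \<in> D" "(i - 1, j) \<notin> D"
proof -
  obtain k where k: "i = Suc k" using assms by (cases i) (auto simp: supp_def index_C_def)
  have "supported_functional (\<lambda>D. (k, j) \<in> D \<and> (Suc k, j) \<in> D) (\<lambda>(p, q). p \<le> k \<and> j \<le> q)"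
    using supported_functional_edges by blast
  then obtain i0 m D where "tight_path i0 m D" "((k, j) \<in> D \<and> (Suc k, j) \<in> D) \<noteq> ((i, j) \<in> D)"
    by (rule supported_functional_not_coordinate[OF _ assms]) (use k in auto)
  then show ?thesis using that[of i0 m D] k by auto
qed

text \<open>The same argument for the edge leaving to the right, whose coordinates lie beyond column
  \<open>j\<close>.\<close>

lemma supp_not_to_right:
  assumes "(i, j) \<in> supp"
  obtains i0 m D where "tight_path i0 m D" "(i, j) \<in> D" "(i, Suc j) \<notin> D"
proof -
  have "supported_functional (\<lambda>D. (i, j) \<in> D \<and> (i, Suc j) \<in> D) (\<lambda>(p, q). p \<le> i \<and> j < q)"
    using supported_functional_edges by blast
  then obtain i0 m D where "tight_path i0 m D" "((i, j) \<in> D \<and> (i, Suc j) \<in> D) \<noteq> ((i, j) \<in> D)"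
    by (rule supported_functional_not_coordinate[OF _ assms]) auto
  then show ?thesis using that[of i0 m D] by auto
qed

lemma supp_turning_path:
  assumes "(i, j) \<in> supp"
  obtains i0 m D where "tight_path i0 m D" "(i, j) \<in> D" "(i - 1, j) \<notin> D" "(i, Suc j) \<notin> D"
proof -
  obtain i1 m1 D1 where D1: "tight_path i1 m1 D1" "(i, j) \<in> D1" "(i - 1, j) \<notin> D1"
    using supp_not_from_above[OF assms] by blast
  obtain i2 m2 D2 where D2: "tight_path i2 m2 D2" "(i, j) \<in> D2" "(i, Suc j) \<notin> D2"
    using supp_not_to_right[OF assms] by blast
  have "1 \<le> i" using assms by (auto simp: supp_def index_C_def)
  then show ?thesis
    using tight_path_join[OF D1(1) D2(1) D1(2) D2(2)] D1 D2
    by (intro that[of i1 m2 "join (i + j) D1 D2"]) (auto simp: join_def)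
qed

text \<open>At a lower corner \<open>D\<close> enters from above and leaves to the right, while a
  turning path \<open>h\<close> does neither. Exchanging tails gives two tight paths different from
  \<open>D\<close>, and the relation between the four sums contradicts the vector separating
  \<open>D\<close> from the other three.\<close>

lemma no_lower_corner:
  assumes D: "tight_path i m D" and c: "(p, q) \<in> D" "(Suc p, q) \<in> D" "(Suc p, Suc q) \<in> D"
  shows False
proof -
  have "(Suc p, q) \<in> supp" using lower_corner_supp[OF assms] .
  then obtain i1 m1 h where h: "tight_path i1 m1 h" "(Suc p, q) \<in> h" "(p, q) \<notin> h" "(Suc p, Suc q) \<notin> h"
    using supp_turning_path[of "Suc p" q] by auto
  let ?A = "join (Suc p + q) D h" and ?B = "join (Suc p + q) h D"
  have A: "tight_path i m1 ?A" and B: "tight_path i1 m ?B"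
    using tight_path_join D h c by blast+
  have "(Suc p, Suc q) \<notin> ?A" "(p, q) \<notin> ?B" using h by (auto simp: join_def)
  then have ne: "?A \<noteq> D" "?B \<noteq> D" "h \<noteq> D" using c h by auto
  obtain w where w: "(\<Sum>p\<in>D. coef w p) \<noteq> 0"
    "\<And>i m D'. tight_path i m D' \<Longrightarrow> D' \<noteq> D \<Longrightarrow> (\<Sum>p\<in>D'. coef w p) = 0"
    using separates[OF D] by metis
  have "(\<Sum>p\<in>?A. coef w p) + (\<Sum>p\<in>?B. coef w p) = (\<Sum>p\<in>D. coef w p) + (\<Sum>p\<in>h. coef w p)"
    using sum_join[OF tight_path_dyck[OF D] tight_path_dyck[OF h(1)] c(2) h(2)] by blast
  then show False using w(1) w(2)[OF A ne(1)] w(2)[OF B ne(2)] w(2)[OF h(1) ne(3)] by simp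
qed

text \<open>Take a turning path through \<open>(i, j)\<close>. Entering row \<open>i\<close> from
  above before \<open>(i, j)\<close>, or leaving column \<open>j\<close> to the right after it,
  would create a lower corner; so the path is straight back to its start and straight down to its
  end.\<close>

lemma hook_tight:
  assumes s: "(i, j) \<in> supp"
  shows "tight_path i (min (j - 1) n) (hook_C n (i, j))"
proof -
  have sI: "(i, j) \<in> index_C n" and ij: "1 \<le> i" "i < j" "i + j \<le> 2*n+1"
    using s by (auto simp: supp_def index_C_def)
  obtain i0 m h where h: "tight_path i0 m h" "(i, j) \<in> h" "(i - 1, j) \<notin> h" "(i, Suc j) \<notin> h"
    using supp_turning_path[OF s] by blast
  have d: "dyck_set n i0 m h" using h(1) by (rule tight_path_dyck)
  have row: "(i, k) \<in> h" if "k \<le> j" "2*i0+1 \<le> i + k" for k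
    using that
  proof (induction k rule: inc_induct)
    case base
    then show ?case using h by simp
  next
    case (step k)
    then have k: "(i, Suc k) \<in> h" by simp
    have "(i - 1, Suc k) \<notin> h"
    proof
      assume up: "(i - 1, Suc k) \<in> h"
      then have "Suc k \<noteq> j" using h(3) by auto
      then have "Suc (Suc k) \<le> j" using step by simp
      then have "(i, Suc (Suc k)) \<in> h"
        using dyck_set_next[OF d k] dyck_set_mono[OF d _ h(2), of "Suc i" "Suc k"]
          dyck_set_level[OF d h(2)] by auto
      then show False using no_lower_corner[OF h(1), of "i - 1" "Suc k"] up k ij by simp
    qed
    then show ?case using dyck_set_prev[OF d k] step by auto
  qed
  have column: "(i + k, j) \<in> h" if "i + j + k \<le> 2*m+1" for k
    using that
  proof (induction k)
    case 0
    then show ?case using h by simp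
  next
    case (Suc k)
    then have k: "(i + k, j) \<in> h" by simp
    have "(i + k, Suc j) \<notin> h"
    proof
      assume right: "(i + k, Suc j) \<in> h"
      then have "k \<noteq> 0" using h(4) by (cases k) auto
      then obtain k' where k': "k = Suc k'" by (cases k) auto
      have "(i + k', j) \<in> h"
        using dyck_set_prev[OF d k] dyck_set_mono[OF d h(2), of "i + k" "j - 1"] dyck_set_level[OF d h(2)] ij k' by auto
      then show False using no_lower_corner[OF h(1), of "i + k'" j] right k k' by simp
    qed
    then show ?case using dyck_set_next[OF d k] Suc.prems by auto
  qed
  have lev: "2*i0+1 \<le> i + j" "i + j \<le> 2*m+1" using dyck_set_level[OF d h(2)] by auto
  have i0: "i0 = i"
  proof -
    show ?thesis
    \<comment> \<open>The start level gives the column \<open>2*i0+1 - i\<close>; if this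
      subtraction were truncated, the row would extend to column 0, outside the index set.\<close>
    proof (cases "i \<le> 2*i0+1")
      case True
      then have "(i, 2*i0+1 - i) \<in> h" using row[of "2*i0+1 - i"] lev by simp
      then show ?thesis using dyck_set_level_unique[OF d dyck_set_start[OF d], of i "2*i0+1 - i"] True by auto
    next
      case False
      then have "(i, 0) \<in> h" using row[of 0] by simp
      then show ?thesis using dyck_set_subset[OF d] by (auto simp: index_C_def)
    qed
  qed
  have last: "(2*m+1 - j, j) \<in> h" using column[of "2*m+1 - (i + j)"] lev by simp
  then have lastI: "2*m+1 - j < j" using dyck_set_subset[OF d] by (auto simp: index_C_def)
  have m: "m = min (j - 1) n"
  proof (cases "m < n")
    case True
    then have "j = Suc m"
      using dyck_set_level_unique[OF d dyck_set_end[OF d True] last] lev by auto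
    then show ?thesis using True by simp
  next
    case False
    then have "m = n" using dyck_set_range[OF d] by simp
    then show ?thesis using lastI by auto
  qed
  have "hook_C n (i, j) \<subseteq> h"
  proof safe
    fix p q assume "(p, q) \<in> hook_C n (i, j)"
    then consider "p = i" "i < q" "q \<le> j" | "q = j" "i \<le> p" "p < j" "p + j \<le> 2*n+1"
      by (auto simp: hook_C_def)
    then show "(p, q) \<in> h"
    proof cases
      case 1
      then show ?thesis using row i0 by simp
    next
      case 2
      then have "p + j \<le> 2*m+1" using m by auto
      then show ?thesis using column[of "p - i"] 2 by simp
    qed
  qed
  then have "hook_C n (i, j) = h"
    using dyck_set_subset_eq[of n i m h "hook_C n (i, j)"] d dyck_set_hook_C[OF sI] i0 m by simp
  then show ?thesis using h(1) i0 m by simp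
qed

lemma supp_antidiagonal:
  assumes s: "(i, j) \<in> supp" and j: "n < j"
  shows "(2*n+1 - j, j) \<in> supp"
proof -
  have "i < j" "i + j \<le> 2*n+1" using s by (auto simp: supp_def index_C_def)
  then have "(2*n+1 - j, j) \<in> hook_C n (i, j)" "2*n+1 - j + j = 2*n+1"
    using j by (auto simp: hook_C_def)
  then show ?thesis using end_supp[OF hook_tight[OF s]] by blast
qed

text \<open>Properly overlapping segments have hooks crossing at \<open>(k, j)\<close>, and
  exchanging tails there makes a lower corner. For \<open>k = j\<close> the hooks are disjoint and
  are glued along the diagonal instead.\<close>

lemma supp_laminar:
  assumes s: "(i, j) \<in> supp" "(k, l) \<in> supp" and c: "i < k" "k \<le> j" "j < l"
  shows False
proof -
  have I: "1 \<le> i" "i < j" "k < l" "k + l \<le> 2*n+1"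
    using s by (auto simp: supp_def index_C_def)
  note H = hook_tight[OF s(1)] hook_tight[OF s(2)]
  show False
  proof (cases "k < j")
    case True
    have mem: "(k, j) \<in> hook_C n (i, j)" "(k - 1, j) \<in> hook_C n (i, j)"
      "(k, j) \<in> hook_C n (k, l)" "(k, Suc j) \<in> hook_C n (k, l)"
      using True c I by (auto simp: hook_C_def)
    have "tight_path i (min (l - 1) n) (join (k + j) (hook_C n (i, j)) (hook_C n (k, l)))"
      by (rule tight_path_join[OF H mem(1,3)])
    then show False
      by (rule no_lower_corner[of _ _ _ "k - 1" j]) (use mem c in \<open>auto simp: join_def\<close>)
  next
    case False
    then have kj: "k = j" using c by simp
    \<comment> \<open>The first hook ends at \<open>(p, Suc p)\<close> and the second starts at
      \<open>(Suc p, Suc (Suc p))\<close>. Gluing with the corner \<open>?r\<close> adds the bounds,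
      so \<open>v\<close> vanishes at \<open>?r\<close> and the glued path is tight; yet its upper
      corner \<open>?r\<close> must lie in the support.\<close>
    define p where "p = j - 1"
    have p: "j = Suc p" "p < n" "min (j - 1) n = p" using I kj by (auto simp: p_def)
    let ?H1 = "hook_C n (i, j)" and ?H2 = "hook_C n (j, l)" and ?r = "(p, Suc (Suc p))" and ?m = "min (l - 1) n"
    have d: "dyck_set n i p ?H1" "dyck_set n (Suc p) ?m ?H2"
      using tight_path_dyck[OF H(1)] tight_path_dyck[OF H(2)] p kj by simp_all
    have E: "dyck_set n i ?m (insert ?r (?H1 \<union> ?H2))" by (rule dyck_set_concat[OF d p(2)])
    have disj: "?H1 \<inter> ?H2 = {}" "?r \<notin> ?H1" "?r \<notin> ?H2"
      using dyck_set_level[OF d(1)] dyck_set_level[OF d(2)] by fastforce+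
    have sum: "(\<Sum>x\<in>insert ?r (?H1 \<union> ?H2). coef v x) =
        coef v ?r + ((\<Sum>x\<in>?H1. coef v x) + (\<Sum>x\<in>?H2. coef v x))"
      using disj dyck_set_finite[OF d(1)] dyck_set_finite[OF d(2)]
      by (intro sum_insert_union)
    have b: "(\<Sum>k=i..?m. real (a k)) = (\<Sum>k=i..p. real (a k)) + (\<Sum>k=Suc p..?m. real (a k))"
      using dyck_set_range[OF d(1)] dyck_set_range[OF d(2)] by (intro sum_bound_split) auto
    have rI: "?r \<in> index_C n" using dyck_set_subset[OF E] by blast
    have "coef v ?r = 0" "tight_path i ?m (insert ?r (?H1 \<union> ?H2))"
      using path_le[OF E] sum b H v_nonneg[OF rI] E p(3) kj p(1) by (auto simp: tight_path_def)
    moreover have "?r \<in> supp" if "tight_path i ?m (insert ?r (?H1 \<union> ?H2))"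
    proof (rule upper_corner_supp[OF that])
      show "(p, Suc p) \<in> insert ?r (?H1 \<union> ?H2)" using dyck_set_end[OF d(1) p(2)] by blast
      show "(Suc p, Suc (Suc p)) \<in> insert ?r (?H1 \<union> ?H2)" using dyck_set_start[OF d(2)] by blast
    qed simp
    ultimately show False by (simp add: supp_def)
  qed
qed

end

section \<open>Laminar supports\<close>

text \<open>The strict \<open>j < k\<close> also forbids a common end point, since segments touching
  there intersect. Positivity of \<open>v\<close> on \<open>E\<close> is derived in
  \<open>v_pos\<close> rather than assumed.\<close>

locale laminar_FFLV_C =
  fixes n :: nat and a :: "nat \<Rightarrow> nat" and v :: point and E :: "(nat \<times> nat) set"
  assumes pos: "\<And>i. i \<in> {1..n} \<Longrightarrow> 0 < a i"
    and v_mem: "v \<in> FFLV_C n a"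
    and E_sub: "E \<subseteq> index_C n"
    and off: "\<And>p. p \<in> index_C n \<Longrightarrow> p \<notin> E \<Longrightarrow> coef v p = 0"
    and hook_eq: "\<And>i j. (i, j) \<in> E \<Longrightarrow> (\<Sum>p\<in>hook_C n (i, j). coef v p) = (\<Sum>k=i..min (j - 1) n. real (a k))"
    and antidiagonal: "\<And>i j. (i, j) \<in> E \<Longrightarrow> n < j \<Longrightarrow> (2*n+1 - j, j) \<in> E"
    and laminar: "\<And>i j k l. (i, j) \<in> E \<Longrightarrow> (k, l) \<in> E \<Longrightarrow> i < k \<Longrightarrow> j < l \<Longrightarrow> j < k"
begin

lemma index_E: "(i, j) \<in> E \<Longrightarrow> 1 \<le> i \<and> i < j \<and> i + j \<le> 2*n+1"
  using E_sub by (auto simp: index_C_def)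

lemma v_nonneg: "p \<in> index_C n \<Longrightarrow> 0 \<le> coef v p"
  using v_mem by (auto simp: FFLV_C_def)

lemma hook_dyck: "(i, j) \<in> E \<Longrightarrow> dyck_set n i (min (j - 1) n) (hook_C n (i, j))"
  using dyck_set_hook_C E_sub by blast

lemma sum_mono_index:
  assumes "A \<subseteq> B" "B \<subseteq> index_C n"
  shows "(\<Sum>p\<in>A. coef v p) \<le> (\<Sum>p\<in>B. coef v p)"
  using assms v_nonneg by (intro sum_mono2 finite_subset[OF assms(2) finite_index_C]) auto

lemma sum_strict_mono_index:
  assumes "A \<subseteq> B" "B \<subseteq> index_C n" "z \<in> B" "z \<notin> A" "0 < coef v z"
  shows "(\<Sum>p\<in>A. coef v p) < (\<Sum>p\<in>B. coef v p)"
proof -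
  have "finite A" using finite_subset assms(1,2) finite_index_C by metis
  then have "(\<Sum>p\<in>insert z A. coef v p) = coef v z + (\<Sum>p\<in>A. coef v p)" using assms(4) by simp
  moreover have "(\<Sum>p\<in>insert z A. coef v p) \<le> (\<Sum>p\<in>B. coef v p)"
    using assms by (intro sum_mono_index) auto
  ultimately show ?thesis using assms(5) by linarith
qed

lemma sum_restrict_E:
  assumes "D \<subseteq> index_C n"
  shows "(\<Sum>p\<in>D \<inter> E. coef v p) = (\<Sum>p\<in>D. coef v p)"
  by (rule sum.mono_neutral_left) (use assms off finite_subset[OF assms finite_index_C] in auto)

lemma bound_mono:
  assumes "s \<le> s'" "s' \<le> t'" "t' \<le> t" "1 \<le> s" "t \<le> n"
  shows "(\<Sum>k=s'..t'. real (a k)) \<le> (\<Sum>k=s..t. real (a k))"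
    and "(\<Sum>k=s'..t'. real (a k)) = (\<Sum>k=s..t. real (a k)) \<Longrightarrow> s' = s \<and> t' = t"
proof -
  show le: "(\<Sum>k=s'..t'. real (a k)) \<le> (\<Sum>k=s..t. real (a k))"
    using assms by (intro sum_mono2) auto
  assume eq: "(\<Sum>k=s'..t'. real (a k)) = (\<Sum>k=s..t. real (a k))"
  show "s' = s \<and> t' = t"
  proof (rule ccontr)
    assume "\<not> ?thesis"
    then obtain k where k: "k \<in> {s..t}" "k \<notin> {s'..t'}"
      using assms by (cases "s' = s") (auto intro: that[of s] that[of t])
    have "(\<Sum>k=s'..t'. real (a k)) + real (a k) = (\<Sum>k\<in>insert k {s'..t'}. real (a k))" using k by simp
    also have "\<dots> \<le> (\<Sum>k=s..t. real (a k))" using k assms by (intro sum_mono2) auto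
    finally show False using eq pos[of k] k assms by auto
  qed
qed

text \<open>The members of a chain in a laminar family that meet its first longest segment all lie on the
  hook of that segment; the remaining ones start strictly further to the right.\<close>

lemma chain_bound:
  assumes "finite D" "D \<noteq> {}" "D \<subseteq> E"
    and "\<And>p q p' q'. (p, q) \<in> D \<Longrightarrow> (p', q') \<in> D \<Longrightarrow> p \<le> p' \<and> q \<le> q' \<or> p' \<le> p \<and> q' \<le> q"
    and "\<And>p q. (p, q) \<in> D \<Longrightarrow> s \<le> p \<and> min (q - 1) n \<le> t" and "1 \<le> s" and t: "t \<le> n"
  shows "(\<Sum>p\<in>D. coef v p) \<le> (\<Sum>k=s..t. real (a k)) \<and>
    ((\<Sum>p\<in>D. coef v p) = (\<Sum>k=s..t. real (a k)) \<longrightarrow>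
      (\<exists>j. (s, j) \<in> D \<and> min (j - 1) n = t \<and> D \<subseteq> hook_C n (s, j)))"
  using assms(1-6)
proof (induction "card D" arbitrary: D s rule: less_induct)
  case less
  note fin = less.prems(1) and ne = less.prems(2) and DE = less.prems(3)
    and chain = less.prems(4) and range = less.prems(5)
  define i where "i = Min (fst ` D)"
  have i_min: "i \<le> p" if "(p, q) \<in> D" for p q
    unfolding i_def using fin that by (intro Min_le) force+
  have "i \<in> fst ` D" unfolding i_def using fin ne by (intro Min_in) auto
  then have neQ: "{q. (i, q) \<in> D} \<noteq> {}" by force
  have finQ: "finite {q. (i, q) \<in> D}"
    by (rule finite_subset[of _ "snd ` D"]) (use fin in force)+
  define j where "j = Max {q. (i, q) \<in> D}"
  have ijD: "(i, j) \<in> D" using Max_in[OF finQ neQ] by (simp add: j_def)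
  have j_max: "q \<le> j" if "(i, q) \<in> D" for q
    unfolding j_def using finQ that by (intro Max_ge) auto
  have ijE: "(i, j) \<in> E" using ijD DE by blast
  have ij: "1 \<le> i" "i < j" "i + j \<le> 2*n+1" using index_E[OF ijE] by auto
  let ?H = "hook_C n (i, j)" and ?m = "min (j - 1) n"
  have H: "dyck_set n i ?m ?H" by (rule hook_dyck[OF ijE])
  have beyond: "j < x" if xy: "(x, y) \<in> D" "(x, y) \<notin> ?H" for x y
  proof -
    have xyE: "(x, y) \<in> E" using xy DE by blast
    note xyI = index_E[OF xyE]
    have "x \<noteq> i" using j_max[of y] xy xyI by (auto simp: hook_C_def)
    then have "i < x" using i_min[OF xy(1)] by simp
    then have "j \<le> y" using chain[OF ijD xy(1)] by auto
    moreover have "y \<noteq> j" using xy xyI \<open>i < x\<close> by (auto simp: hook_C_def)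
    ultimately show ?thesis using laminar[OF ijE xyE \<open>i < x\<close>] by simp
  qed
  have HI: "?H \<subseteq> index_C n" by (rule dyck_set_subset[OF H])
  have D1: "(\<Sum>p\<in>D \<inter> ?H. coef v p) \<le> (\<Sum>k=i..?m. real (a k))"
    using sum_mono_index[of "D \<inter> ?H" ?H] HI hook_eq[OF ijE] by simp
  have split: "(\<Sum>p\<in>D. coef v p) = (\<Sum>p\<in>D \<inter> ?H. coef v p) + (\<Sum>p\<in>D - ?H. coef v p)"
    using fin by (subst sum.Int_Diff[of D _ ?H]) auto
  have si: "s \<le> i" "?m \<le> t" using range[OF ijD] by auto
  have im: "i \<le> ?m" using dyck_set_range[OF H] by simp
  show ?case
  proof (cases "D - ?H = {}")
    case True
    have le: "(\<Sum>p\<in>D. coef v p) \<le> (\<Sum>k=i..?m. real (a k))" using split True D1 by simp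
    note mono = bound_mono[OF si(1) im si(2) less.prems(6) t]
    show ?thesis
    proof (intro conjI impI)
      show "(\<Sum>p\<in>D. coef v p) \<le> (\<Sum>k=s..t. real (a k))" using le mono(1) by linarith
      assume "(\<Sum>p\<in>D. coef v p) = (\<Sum>k=s..t. real (a k))"
      then have "i = s \<and> ?m = t" using le mono(1) by (intro mono(2)) linarith
      then show "\<exists>j. (s, j) \<in> D \<and> min (j - 1) n = t \<and> D \<subseteq> hook_C n (s, j)" using True ijD by blast
    qed
  next
    case False
    have "card (D - ?H) < card D"
    proof (rule psubset_card_mono[OF fin])
      have "(i, j) \<in> ?H" using ij by (simp add: hook_C_def)
      then show "D - ?H \<subset> D" using ijD by blast
    qed
    then have IH: "(\<Sum>p\<in>D - ?H. coef v p) \<le> (\<Sum>k=Suc j..t. real (a k))"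
    proof (rule less.hyps[THEN conjunct1])
      show "Suc j \<le> p \<and> min (q - 1) n \<le> t" if "(p, q) \<in> D - ?H" for p q
        using beyond[of p q] range[of p q] that by auto
      show "p \<le> p' \<and> q \<le> q' \<or> p' \<le> p \<and> q' \<le> q" if "(p, q) \<in> D - ?H" "(p', q') \<in> D - ?H" for p q p' q'
        using chain that by blast
    qed (use False fin DE in auto)
    obtain x y where xy: "(x, y) \<in> D" "(x, y) \<notin> ?H" using False by force
    have xyI: "1 \<le> x \<and> x < y \<and> x + y \<le> 2*n+1" using index_E xy DE by blast
    \<comment> \<open>A segment starting after \<open>j\<close> and summing to at most
      \<open>2*n+1\<close> forces \<open>j < n\<close>, so the first hook is not cut off.\<close>
    have jt: "j < t" using beyond[OF xy] range[OF xy(1)] xyI by auto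
    then have m: "?m = j - 1" using t by simp
    have j: "j \<in> {1..n}" using jt t ij by simp
    \<comment> \<open>The first group is charged to indices below \<open>j\<close>, the rest to
      indices above \<open>j\<close>. The positive \<open>a j\<close> is left over, so equality is
      confined to a single hook.\<close>
    have "(\<Sum>p\<in>D. coef v p) \<le> (\<Sum>k=i..j - 1. real (a k)) + (\<Sum>k=Suc j..t. real (a k))"
      using split D1 IH m by simp
    also have "\<dots> < (\<Sum>k=i..t. real (a k))"
    proof -
      have "(\<Sum>k=i..t. real (a k)) = (\<Sum>k=i..j - 1. real (a k)) + (\<Sum>k=Suc (j - 1)..t. real (a k))"
        using ij jt by (intro sum_bound_split) auto
      moreover have "(\<Sum>k=j..t. real (a k)) = (\<Sum>k=j..j. real (a k)) + (\<Sum>k=Suc j..t. real (a k))"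
        using jt by (intro sum_bound_split) auto
      ultimately show ?thesis using pos[OF j] ij by simp
    qed
    also have "\<dots> \<le> (\<Sum>k=s..t. real (a k))"
      using si ij jt less.prems(6) t by (intro bound_mono) auto
    finally show ?thesis by simp
  qed
qed

text \<open>A path is a chain whose segments stay within its range. Arbitrary subsets
  \<open>A\<close> are allowed so that \<open>v_pos\<close> can first discard a point of value
  0.\<close>

lemma chain_bound_dyck:
  assumes D: "dyck_set n i m D" and A: "A \<subseteq> D \<inter> E" and eq: "(\<Sum>p\<in>A. coef v p) = (\<Sum>k=i..m. real (a k))"
  obtains j where "(i, j) \<in> A" "min (j - 1) n = m" "A \<subseteq> hook_C n (i, j)"
proof -
  have im: "1 \<le> i" "i \<le> m" "m \<le> n" using dyck_set_range[OF D] by auto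
  have "0 < (\<Sum>k=i..m. real (a k))" by (rule bound_pos[where a=a, OF pos D])
  then have ne: "A \<noteq> {}" using eq by auto
  have finA: "finite A" by (rule finite_subset[OF _ dyck_set_finite[OF D]]) (use A in blast)
  have AE: "A \<subseteq> E" using A by blast
  have chainA: "p \<le> p' \<and> q \<le> q' \<or> p' \<le> p \<and> q' \<le> q" if "(p, q) \<in> A" "(p', q') \<in> A" for p q p' q'
    using dyck_set_mono[OF D, of p q p' q'] dyck_set_mono[OF D, of p' q' p q] that A
    by (meson IntD1 nat_le_linear subsetD)
  have rangeA: "i \<le> p \<and> min (q - 1) n \<le> m" if "(p, q) \<in> A" for p q
  proof -
    have pq: "(p, q) \<in> D" using that A by blast
    note lev = dyck_set_level[OF D pq]
    have "i \<le> p" using dyck_set_mono[OF D dyck_set_start[OF D] pq] lev by simp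
    moreover have "min (q - 1) n \<le> m"
    proof (cases "m < n")
      case True
      then have "q \<le> Suc m" using dyck_set_mono[OF D pq dyck_set_end[OF D True]] lev by simp
      then show ?thesis by simp
    qed simp
    ultimately show ?thesis ..
  qed
  have "\<exists>j. (i, j) \<in> A \<and> min (j - 1) n = m \<and> A \<subseteq> hook_C n (i, j)"
    using chain_bound[OF finA ne AE chainA rangeA im(1,3)] eq by blast
  then show ?thesis using that by blast
qed

lemma antidiagonal_hook:
  assumes "(i, j) \<in> E" "n < j"
  shows "(2*n+1 - j, j) \<in> hook_C n (i, j)"
  using index_E[OF assms(1)] assms(2) by (auto simp: hook_C_def)

text \<open>If \<open>v\<close> vanished at \<open>(i, j)\<close>, the other members of its hook
  would still reach the bound, hence lie on the hook of a shorter \<open>(i, j')\<close> with the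
  same bound, which requires \<open>n < j'\<close>. The antidiagonal end of the shorter hook,
  positive by induction on the length, is not on the longer one, so their sum is too small.\<close>

lemma v_pos: "(i, j) \<in> E \<Longrightarrow> 0 < coef v (i, j)"
proof (induction "j - i" arbitrary: i j rule: less_induct)
  case less
  note ijE = less.prems
  note ij = index_E[OF ijE]
  let ?H = "hook_C n (i, j)"
  have H: "dyck_set n i (min (j - 1) n) ?H" by (rule hook_dyck[OF ijE])
  have HI: "?H \<subseteq> index_C n" by (rule dyck_set_subset[OF H])
  show ?case
  proof (rule ccontr)
    assume "\<not> ?thesis"
    then have v0: "coef v (i, j) = 0" using v_nonneg[of "(i, j)"] ijE E_sub by force
    define A where "A = ?H \<inter> E - {(i, j)}"
    have "(\<Sum>p\<in>A. coef v p) = (\<Sum>p\<in>?H \<inter> E. coef v p)"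
      unfolding A_def using v0 dyck_set_finite[OF H] by (intro sum.mono_neutral_left) auto
    then have eq: "(\<Sum>p\<in>A. coef v p) = (\<Sum>k=i..min (j - 1) n. real (a k))"
      using sum_restrict_E[OF HI] hook_eq[OF ijE] by simp
    obtain j' where j': "(i, j') \<in> A" "min (j' - 1) n = min (j - 1) n" "A \<subseteq> hook_C n (i, j')"
      by (rule chain_bound_dyck[OF H _ eq]) (auto simp: A_def)
    have ij'E: "(i, j') \<in> E" using j' by (simp add: A_def)
    have "j' < j" using j'(1) by (auto simp: A_def hook_C_def)
    then have "n < j'" using j'(2) ij by auto
    let ?z = "(2*n+1 - j', j')"
    have zE: "?z \<in> E" and zH: "?z \<in> hook_C n (i, j')"
      using antidiagonal[OF ij'E \<open>n < j'\<close>] antidiagonal_hook[OF ij'E \<open>n < j'\<close>] by auto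
    have "0 < coef v ?z"
      using zE \<open>j' < j\<close> index_E[OF ij'E] ij by (intro less.hyps) auto
    moreover have "?z \<notin> A" using \<open>j' < j\<close> ij by (auto simp: A_def hook_C_def)
    ultimately have "(\<Sum>p\<in>A. coef v p) < (\<Sum>p\<in>hook_C n (i, j'). coef v p)"
      using j'(3) zH dyck_set_subset[OF hook_dyck[OF ij'E]] by (intro sum_strict_mono_index) auto
    then show False using eq hook_eq[OF ij'E] j'(2) by simp
  qed
qed

text \<open>Equality in the chain bound puts \<open>D \<inter> E\<close> on one hook starting where
  \<open>D\<close> starts. Once \<open>D\<close> is known to end in column \<open>j\<close>,
  monotonicity squeezes it onto the hook.\<close>

lemma tight_is_hook:
  assumes "tight n a v D"
  obtains p where "p \<in> E" "D = hook_C n p"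
proof -
  obtain i m where D: "dyck_set n i m D" and eq: "(\<Sum>p\<in>D. coef v p) = (\<Sum>k=i..m. real (a k))"
    using assms by (auto simp: tight_def)
  have DI: "D \<subseteq> index_C n" by (rule dyck_set_subset[OF D])
  have eqE: "(\<Sum>p\<in>D \<inter> E. coef v p) = (\<Sum>k=i..m. real (a k))" using eq sum_restrict_E[OF DI] by simp
  obtain j where j: "(i, j) \<in> D \<inter> E" "min (j - 1) n = m" "D \<inter> E \<subseteq> hook_C n (i, j)"
    by (rule chain_bound_dyck[OF D _ eqE]) auto
  let ?H = "hook_C n (i, j)"
  have ijE: "(i, j) \<in> E" and ijD: "(i, j) \<in> D" using j by auto
  note ij = index_E[OF ijE]
  have H: "dyck_set n i m ?H" using hook_dyck[OF ijE] j(2) by simp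
  \<comment> \<open>For \<open>m < n\<close> the end is prescribed. For \<open>m = n\<close> the
    antidiagonal end of the hook has positive value, so a path avoiding it would have too small a
    sum.\<close>
  have last: "(2*m+1 - j, j) \<in> D"
  proof (cases "m < n")
    case True
    then have "j = Suc m" using j(2) ij by auto
    then show ?thesis using dyck_set_end[OF D True] by simp
  next
    case False
    then have m: "m = n" and "n < j" using dyck_set_range[OF D] j(2) ij by auto
    let ?z = "(2*n+1 - j, j)"
    have z: "?z \<in> E" "?z \<in> ?H" using antidiagonal[OF ijE \<open>n < j\<close>] antidiagonal_hook[OF ijE \<open>n < j\<close>] by auto
    have "?z \<in> D \<inter> E"
    proof (rule ccontr)
      assume "?z \<notin> D \<inter> E"
      then have "(\<Sum>p\<in>D \<inter> E. coef v p) < (\<Sum>p\<in>?H. coef v p)"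
        using j(3) z v_pos[OF z(1)] dyck_set_subset[OF H] by (intro sum_strict_mono_index) auto
      then show False using eqE hook_eq[OF ijE] j(2) by simp
    qed
    then show ?thesis using m by simp
  qed
  have lev: "2*i+1 \<le> i + j" "i + j \<le> 2*m+1" using dyck_set_level[OF D ijD] by auto
  have "?H \<subseteq> D"
  proof safe
    fix p q assume pqH: "(p, q) \<in> ?H"
    obtain x y where xy: "(x, y) \<in> D" "x + y = p + q"
      using dyck_set_level_ex[OF D, of "p + q"] dyck_set_level[OF H pqH] by blast
    from pqH consider "p = i" "i < q" "q \<le> j" | "q = j" "i \<le> p" "p < j" "p + j \<le> 2*n+1"
      by (auto simp: hook_C_def)
    then have "x = p"
    proof cases
      case 1
      then have "i \<le> x" "x \<le> i"
        using dyck_set_mono[OF D dyck_set_start[OF D] xy(1)] dyck_set_mono[OF D xy(1) ijD] xy(2) by auto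
      then show ?thesis using 1 by simp
    next
      case 2
      then have "j \<le> y" using dyck_set_mono[OF D ijD xy(1)] xy(2) by auto
      moreover have "y \<le> j"
        using dyck_set_mono[OF D xy(1) last] xy(2) dyck_set_level[OF H pqH] lev by auto
      ultimately show ?thesis using 2 xy(2) by simp
    qed
    then show "(p, q) \<in> D" using xy by simp
  qed
  then have "?H = D" by (rule dyck_set_subset_eq[OF D H])
  then show ?thesis using ijE that by blast
qed

lemma hook_is_tight: "p \<in> E \<Longrightarrow> tight n a v (hook_C n p)"
  unfolding tight_def using hook_dyck hook_eq by (cases p) blast

lemma unimodular:
  obtains B where "lattice_basis B (int_lattice (index_C n))" "tangent_cone (FFLV_C n a) v = convex_cone hull B"
proof -
  let ?I = "index_C n" and ?U = "coord_space (index_C n)"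
  \<comment> \<open>One functional per index: the hook for members of \<open>E\<close>, the
    coordinate itself otherwise. The other points of a hook belong to shorter segments, so length
    makes the system unitriangular.\<close>
  define H where "H p = (if p \<in> E then hook_C n p else {p})" for p
  define f where "f p w = (if p \<in> E then -1 else 1) * (\<Sum>q\<in>H p. coef w q)" for p w
  have sub: "H p \<subseteq> ?I" if "p \<in> ?I" for p
    using that hook_dyck dyck_set_subset unfolding H_def by (cases p) (metis empty_subsetI insert_subset)
  have self: "p \<in> H p" if "p \<in> ?I" for p
    using that by (cases p) (auto simp: H_def hook_C_def index_C_def)
  have rank: "snd q - fst q < snd p - fst p" if "p \<in> ?I" "q \<in> H p" "q \<noteq> p" for p q
    using that by (cases p; cases q) (auto simp: H_def hook_C_def index_C_def split: if_splits)
  note unique = triangular_system_unique[where I="?I" and H=H and rank="\<lambda>p. snd p - fst p", OF finite_index_C sub self rank]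
  note exist = triangular_system_exists[where I="?I" and H=H and rank="\<lambda>p. snd p - fst p", OF finite_index_C sub self rank]
  define sg where "sg p = (if p \<in> E then -1 else 1 :: real)" for p
  have f: "f p w = sg p * (\<Sum>q\<in>H p. coef w q)" for p w by (simp add: f_def sg_def)
  have sg2: "sg p * sg p = 1" and sgZ: "sg p \<in> \<int>" and sg0: "sg p \<noteq> 0" for p
    by (auto simp: sg_def)
  have "\<exists>b \<in> ?U. \<forall>q\<in>?I. f q b = (if p = q then 1 else 0)" if "p \<in> ?I" for p
  proof -
    obtain b where "b \<in> ?U" "\<forall>q\<in>?I. (\<Sum>r\<in>H q. coef b r) = (if p = q then sg q else 0)"
      using exist[of "\<lambda>q. if p = q then sg q else 0"] by blast
    then show ?thesis by (intro bexI[of _ b]) (auto simp: f sg2)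
  qed
  then obtain b where b: "\<And>p. p \<in> ?I \<Longrightarrow> b p \<in> ?U"
    "\<And>p q. p \<in> ?I \<Longrightarrow> q \<in> ?I \<Longrightarrow> f q (b p) = (if p = q then 1 else 0)"
    by metis
  have lin: "linear (f p)" for p
    by (rule linearI) (simp_all add: f lookup_add sum.distrib sum_distrib_left algebra_simps)
  have zero: "w = 0" if "w \<in> ?U" "\<And>p. p \<in> ?I \<Longrightarrow> f p w = 0" for w
  proof (rule unique)
    show "0 \<in> ?U" by (simp add: coord_space_def)
    fix p assume "p \<in> ?I"
    then show "(\<Sum>q\<in>H p. coef w q) = (\<Sum>q\<in>H p. coef 0 q)" using that(2)[of p] sg0 by (simp add: f)
  qed (use that in auto)
  have L: "int_lattice ?I = {w \<in> ?U. \<forall>p\<in>?I. f p w \<in> \<int>}"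
  proof (intro equalityI subsetI)
    fix w assume "w \<in> int_lattice ?I"
    then show "w \<in> {w \<in> ?U. \<forall>p\<in>?I. f p w \<in> \<int>}"
      by (auto simp: int_lattice_def f intro!: Ints_mult sgZ Ints_sum)
  next
    fix w assume "w \<in> {w \<in> ?U. \<forall>p\<in>?I. f p w \<in> \<int>}"
    then have w: "w \<in> ?U" "\<And>p. p \<in> ?I \<Longrightarrow> f p w \<in> \<int>" by auto
    \<comment> \<open>The sign is its own inverse, so the right-hand sides are integral, and the
      unique solution \<open>w\<close> must be the integral one.\<close>
    have "(\<Sum>q\<in>H p. coef w q) \<in> \<int>" if "p \<in> ?I" for p
    proof -
      have "sg p * f p w = (\<Sum>q\<in>H p. coef w q)" by (simp add: f sg2 flip: mult.assoc)
      then show ?thesis using Ints_mult[OF sgZ[of p] w(2)[OF that]] by simp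
    qed
    then obtain x where x: "x \<in> ?U" "\<forall>p\<in>?I. (\<Sum>q\<in>H p. coef x q) = (\<Sum>q\<in>H p. coef w q)"
      "\<forall>p. coef x p \<in> \<int>"
      using exist[of "\<lambda>p. \<Sum>q\<in>H p. coef w q"] by blast
    have "x = w" by (rule unique) (use x w in auto)
    then show "w \<in> int_lattice ?I" using x by (simp add: int_lattice_def)
  qed
  have "coef v p = 0 \<longleftrightarrow> p \<notin> E" if "p \<in> ?I" for p
    using off[OF that] v_pos[of "fst p" "snd p"] by auto
  then have C: "tangent_cone (FFLV_C n a) v = {w \<in> ?U. \<forall>p\<in>?I. 0 \<le> f p w}"
    unfolding tangent_cone_FFLV_C[OF v_mem]
  proof (intro Collect_cong conj_cong refl)
    fix w assume v0: "\<And>p. p \<in> ?I \<Longrightarrow> (coef v p = 0) = (p \<notin> E)"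
    show "(\<forall>p\<in>?I. coef v p = 0 \<longrightarrow> 0 \<le> coef w p) \<and> (\<forall>D. tight n a v D \<longrightarrow> (\<Sum>p\<in>D. coef w p) \<le> 0) \<longleftrightarrow>
      (\<forall>p\<in>?I. 0 \<le> f p w)" (is "?l \<longleftrightarrow> ?r")
    proof
      assume l: ?l
      show ?r
      proof
        fix p assume p: "p \<in> ?I"
        show "0 \<le> f p w"
        proof (cases "p \<in> E")
          case True
          then show ?thesis using l hook_is_tight[of p] by (simp add: f_def H_def)
        next
          case False
          then show ?thesis using l v0[OF p] p by (simp add: f_def H_def)
        qed
      qed
    next
      assume r: ?r
      show ?l
      proof (intro conjI ballI allI impI)
        fix p assume p: "p \<in> ?I" "coef v p = 0"
        then have "p \<notin> E" using v0[OF p(1)] by blast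
        moreover have "0 \<le> f p w" using r p(1) by (rule bspec)
        ultimately show "0 \<le> coef w p" by (simp add: f_def H_def)
      next
        fix D assume "tight n a v D"
        then obtain p where p: "p \<in> E" "D = hook_C n p" using tight_is_hook by blast
        have "0 \<le> f p w" by (rule bspec[OF r subsetD[OF E_sub p(1)]])
        then show "(\<Sum>p\<in>D. coef w p) \<le> 0" using p by (simp add: f_def H_def)
      qed
    qed
  qed
  show ?thesis
    using dual_family_unimodular[where I="?I" and f=f and b=b and U="?U",
        OF finite_index_C lin b(2) b(1) subspace_coord_space zero L C] that by blast
qed

end

section \<open>Folding type A onto type C\<close>

lemma finite_index_A: "finite (index_A n)"
  by (rule finite_subset[of _ "{..2*n} \<times> {..2*n}"]) (auto simp: index_A_def)

lemma index_C_subset_A: "index_C n \<subseteq> index_A n"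
  by (auto simp: index_C_def index_A_def)

lemma phi_eq_point_of: "phi n x = point_of (index_A n) (\<lambda>(i, j).
     if i + j < 2 * n + 1 then coef x (i, j)
      else if i + j = 2 * n + 1 then 2 * coef x (i, j)
      else coef x (2 * n + 1 - j, 2 * n + 1 - i))"
  unfolding phi_def point_of_def by (rule sum.cong) auto

lemma coef_phi: "(i, j) \<in> index_A n \<Longrightarrow> coef (phi n x) (i, j) =
    (if i + j < 2 * n + 1 then coef x (i, j)
     else if i + j = 2 * n + 1 then 2 * coef x (i, j)
     else coef x (2 * n + 1 - j, 2 * n + 1 - i))"
  by (simp add: phi_eq_point_of coef_point_of finite_index_A)

lemma phi_in_coord_space: "phi n x \<in> coord_space (index_A n)"
  by (simp add: phi_eq_point_of point_of_in_coord_space finite_index_A)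

definition hook_A :: "nat \<times> nat \<Rightarrow> (nat \<times> nat) set" where
  "hook_A = (\<lambda>(i, j). {(p, q). p = i \<and> i < q \<and> q \<le> j \<or> q = j \<and> i < p \<and> p < j})"

lemma path_sum_hook: "path_sum y (hook i j) = (\<Sum>p\<in>hook_A (i, j). coef y p)"
proof -
  have "distinct (hook i j)" by (auto simp: hook_def distinct_map inj_on_def)
  moreover have "set (hook i j) = hook_A (i, j)"
    by (auto simp: hook_def hook_A_def)
  ultimately show ?thesis by (simp add: path_sum_def sum_list_distinct_conv_sum_set)
qed

lemma sum_hook_A:
  "(\<Sum>p\<in>hook_A (i, j). f p) = (\<Sum>k\<in>{i<..j}. f (i, k)) + (\<Sum>k\<in>{i<..<j}. f (k, j) :: real)"
proof -
  have "hook_A (i, j) = Pair i ` {i<..j} \<union> (\<lambda>k. (k, j)) ` {i<..<j}" by (auto simp: hook_A_def)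
  then have "(\<Sum>p\<in>hook_A (i, j). f p) = (\<Sum>p\<in>Pair i ` {i<..j}. f p) + (\<Sum>p\<in>(\<lambda>k. (k, j)) ` {i<..<j}. f p)"
    by (simp only:) (rule sum.union_disjoint, auto)
  then show ?thesis by (simp add: sum.reindex inj_on_def)
qed

lemma sum_hook_C:
  assumes "i < j" "i + j \<le> 2*n+1"
  shows "(\<Sum>p\<in>hook_C n (i, j). f p) =
    (\<Sum>k\<in>{i<..j}. f (i, k)) + (\<Sum>k\<in>{k \<in> {i<..<j}. k + j \<le> 2*n+1}. f (k, j) :: real)"
proof -
  have "hook_C n (i, j) = Pair i ` {i<..j} \<union> (\<lambda>k. (k, j)) ` {k \<in> {i<..<j}. k + j \<le> 2*n+1}"
    using assms by (auto simp: hook_C_def image_iff)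
  then have "(\<Sum>p\<in>hook_C n (i, j). f p) = (\<Sum>p\<in>Pair i ` {i<..j}. f p) +
      (\<Sum>p\<in>(\<lambda>k. (k, j)) ` {k \<in> {i<..<j}. k + j \<le> 2*n+1}. f p)"
    by (simp only:) (rule sum.union_disjoint, auto)
  then show ?thesis by (simp add: sum.reindex inj_on_def)
qed

text \<open>Folding a hook along the antidiagonal: the part below the antidiagonal is the mirror image of
  the row through \<open>2 n + 1 - j\<close>.\<close>

lemma sum_hook_phi:
  assumes ij: "(i, j) \<in> index_C n"
  shows "(\<Sum>p\<in>hook_A (i, j). coef (phi n x) p) = (\<Sum>p\<in>hook_C n (i, j). coef x p) +
    (if n < j then \<Sum>p\<in>hook_C n (2*n+1 - j, j). coef x p else 0)"
proof -
  have I: "1 \<le> i" "i < j" "i + j \<le> 2*n+1" "j \<le> 2*n" using ij by (auto simp: index_C_def)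
  have A: "(i, k) \<in> index_A n" if "k \<in> {i<..j}" for k using that I by (auto simp: index_A_def)
  have A': "(k, j) \<in> index_A n" if "k \<in> {i<..<j}" for k using that I by (auto simp: index_A_def)
  show ?thesis
  proof (cases "n < j")
    case False
    have "coef (phi n x) (i, k) = coef x (i, k)" if "k \<in> {i<..j}" for k
      using that False I by (subst coef_phi[OF A[OF that]]) auto
    moreover have "coef (phi n x) (k, j) = coef x (k, j)" if "k \<in> {i<..<j}" for k
      using that False I by (subst coef_phi[OF A'[OF that]]) auto
    moreover have "{k \<in> {i<..<j}. k + j \<le> 2*n+1} = {i<..<j}" using False by auto
    ultimately show ?thesis using False I by (simp add: sum_hook_A sum_hook_C)
  next
    case True
    \<comment> \<open>The doubled coordinate \<open>(j', j)\<close> contributes one copy to each of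
      the two type C hooks.\<close>
    define j' where "j' = 2*n+1 - j"
    have j': "j' + j = 2*n+1" "j' < j" "i \<le> j'" "2*n+1 - j' = j" using True I by (auto simp: j'_def)
    have row: "(\<Sum>k\<in>{i<..j}. coef (phi n x) (i, k)) =
        (\<Sum>k\<in>{i<..j}. coef x (i, k)) + (if i = j' then coef x (i, j) else 0)"
    proof -
      have "coef (phi n x) (i, k) = coef x (i, k) + (if k = j then if i = j' then coef x (i, j) else 0 else 0)"
        if "k \<in> {i<..j}" for k
        using that I j' by (subst coef_phi[OF A[OF that]]) auto
      then show ?thesis using I by (simp add: sum.distrib)
    qed
    have col: "(\<Sum>k\<in>{i<..<j}. coef (phi n x) (k, j)) =
        (\<Sum>k\<in>{k \<in> {i<..<j}. k + j \<le> 2*n+1}. coef x (k, j)) +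
        (\<Sum>k\<in>{k \<in> {i<..<j}. j' \<le> k}. coef x (j', 2*n+1 - k))"
    proof -
      have "coef (phi n x) (k, j) = (if k + j \<le> 2*n+1 then coef x (k, j) else 0) +
          (if j' \<le> k then coef x (j', 2*n+1 - k) else 0)" if "k \<in> {i<..<j}" for k
      proof -
        consider "k < j'" | "k = j'" | "j' < k" by linarith
        moreover have "Suc (2*n) - j = j'" by (simp add: j'_def)
        ultimately show ?thesis
          unfolding coef_phi[OF A'[OF that]] using that j' by cases auto
      qed
      then have "(\<Sum>k\<in>{i<..<j}. coef (phi n x) (k, j)) =
          (\<Sum>k\<in>{i<..<j}. (if k + j \<le> 2*n+1 then coef x (k, j) else 0) +
          (if j' \<le> k then coef x (j', 2*n+1 - k) else 0))" by (rule sum.cong[OF refl])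
      then show ?thesis by (simp only: sum.distrib sum.inter_filter finite_greaterThanLessThan)
    qed
    \<comment> \<open>For \<open>i = j'\<close> the column omits its corner, so the reflected range
      misses \<open>j\<close>; the missing term is the second copy recorded in
      \<open>row\<close>.\<close>
    have refl_sum: "(\<Sum>k\<in>{k \<in> {i<..<j}. j' \<le> k}. coef x (j', 2*n+1 - k)) =
        (\<Sum>k\<in>(if i = j' then {j'<..<j} else {j'<..j}). coef x (j', k))"
      by (rule sum.reindex_bij_witness[of _ "\<lambda>k. 2*n+1 - k" "\<lambda>k. 2*n+1 - k"])
        (use j' in \<open>auto split: if_splits\<close>)
    have hj': "(\<Sum>p\<in>hook_C n (j', j). coef x p) = (\<Sum>k\<in>{j'<..j}. coef x (j', k))"
    proof -
      have "{k \<in> {j'<..<j}. k + j \<le> 2*n+1} = {}" using j' by auto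
      then show ?thesis using j' by (subst sum_hook_C) (simp_all only: sum.empty)
    qed
    have last: "(\<Sum>k\<in>{j'<..j}. coef x (j', k)) = (\<Sum>k\<in>{j'<..<j}. coef x (j', k)) + coef x (j', j)"
    proof -
      have "{j'<..j} = insert j {j'<..<j}" using j' by auto
      then show ?thesis by simp
    qed
    have A_sum: "(\<Sum>p\<in>hook_A (i, j). coef (phi n x) p) =
        ((\<Sum>k\<in>{i<..j}. coef x (i, k)) + (if i = j' then coef x (i, j) else 0)) +
        ((\<Sum>k\<in>{k \<in> {i<..<j}. k + j \<le> 2*n+1}. coef x (k, j)) +
         (\<Sum>k\<in>(if i = j' then {j'<..<j} else {j'<..j}). coef x (j', k)))"
      by (simp only: sum_hook_A row col refl_sum)
    show ?thesis
      unfolding A_sum sum_hook_C[OF I(2,3)] j'_def[symmetric] hj' using True last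
      by (cases "i = j'") simp_all
  qed
qed

text \<open>The factor 2 of the middle coefficient is shared between the two halves, and
  \<open>2*n - k\<close> reflects the upper half; the summands match those of
  \<open>sum_hook_phi\<close> one by one.\<close>

lemma sum_abar:
  assumes ij: "(i, j) \<in> index_C n"
  shows "real (\<Sum>k=i..<j. abar n a k) = (\<Sum>k=i..min (j - 1) n. real (a k)) +
    (if n < j then \<Sum>k=2*n+1 - j..n. real (a k) else 0)"
proof -
  have I: "1 \<le> i" "i < j" "i + j \<le> 2*n+1" "j \<le> 2*n" using ij by (auto simp: index_C_def)
  have "real (abar n a k) = (if k \<le> n then real (a k) else 0) + (if n \<le> k then real (a (2*n - k)) else 0)" for k
  proof -
    consider "k < n" | "k = n" | "n < k" by linarith
    then show ?thesis by cases (auto simp: abar_def)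
  qed
  then have "real (\<Sum>k=i..<j. abar n a k) =
      (\<Sum>k\<in>{k \<in> {i..<j}. k \<le> n}. real (a k)) + (\<Sum>k\<in>{k \<in> {i..<j}. n \<le> k}. real (a (2*n - k)))"
    by (simp only: of_nat_sum sum.distrib sum.inter_filter finite_atLeastLessThan)
  moreover have "{k \<in> {i..<j}. k \<le> n} = {i..min (j - 1) n}" using I by auto
  moreover have "(\<Sum>k\<in>{k \<in> {i..<j}. n \<le> k}. real (a (2*n - k))) =
      (if n < j then \<Sum>k=2*n+1 - j..n. real (a k) else 0)"
  proof (cases "n < j")
    case True
    have "(\<Sum>k\<in>{k \<in> {i..<j}. n \<le> k}. real (a (2*n - k))) = (\<Sum>k=2*n+1 - j..n. real (a k))"
      by (rule sum.reindex_bij_witness[of _ "\<lambda>k. 2*n - k" "\<lambda>k. 2*n - k"]) (use True I in auto)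
    then show ?thesis using True by simp
  next
    case False
    then have "{k \<in> {i..<j}. n \<le> k} = {}" by auto
    then show ?thesis using False by (simp only: sum.empty if_False)
  qed
  ultimately show ?thesis by simp
qed

section \<open>Reflection in the antidiagonal\<close>

definition mirror :: "nat \<Rightarrow> nat \<times> nat \<Rightarrow> nat \<times> nat" where
  "mirror n = (\<lambda>(i, j). (2*n+1 - j, 2*n+1 - i))"

lemma mirror_index_A: "p \<in> index_A n \<Longrightarrow> mirror n p \<in> index_A n"
  by (auto simp: mirror_def index_A_def)

lemma mirror_mirror: "p \<in> index_A n \<Longrightarrow> mirror n (mirror n p) = p"
  by (auto simp: mirror_def index_A_def)

lemma mirror_index_C: "p \<in> index_A n \<Longrightarrow> p \<notin> index_C n \<Longrightarrow> mirror n p \<in> index_C n"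
  by (auto simp: mirror_def index_A_def index_C_def)

lemma coef_phi_mirror:
  assumes "p \<in> index_A n"
  shows "coef (phi n x) (mirror n p) = coef (phi n x) p"
proof -
  obtain i j where p: "p = (i, j)" by (cases p)
  have ij: "(i, j) \<in> index_A n" "(2*n+1 - j, 2*n+1 - i) \<in> index_A n"
    using assms mirror_index_A[OF assms] by (auto simp: p mirror_def)
  have le: "i \<le> 2*n" "j \<le> 2*n" using ij(1) by (auto simp: index_A_def)
  consider "i + j < 2*n+1" | "i + j = 2*n+1" | "2*n+1 < i + j" by linarith
  then show ?thesis
  proof cases
    case 2
    then have "2*n+1 - j = i" "2*n+1 - i = j" by auto
    then show ?thesis by (simp add: p mirror_def)
  next
    case 1
    then show ?thesis unfolding p mirror_def prod.case coef_phi[OF ij(1)] coef_phi[OF ij(2)] using le by auto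
  next
    case 3
    then show ?thesis unfolding p mirror_def prod.case coef_phi[OF ij(1)] coef_phi[OF ij(2)] using le by auto
  qed
qed

lemma sum_hook_phi_mirror:
  assumes "(i, j) \<in> index_A n"
  shows "(\<Sum>p\<in>hook_A (mirror n (i, j)). coef (phi n x) p) = (\<Sum>p\<in>hook_A (i, j). coef (phi n x) p)"
proof (rule sum.reindex_bij_witness[of _ "mirror n" "mirror n"])
  have I: "1 \<le> i" "i < j" "j \<le> 2*n" using assms by (auto simp: index_A_def)
  have sub: "hook_A q \<subseteq> index_A n" if "q \<in> index_A n" for q
    using that by (cases q) (auto simp: hook_A_def index_A_def)
  have mI: "mirror n (i, j) \<in> index_A n" by (rule mirror_index_A[OF assms])
  fix p
  show "mirror n (mirror n p) = p" if "p \<in> hook_A (mirror n (i, j))"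
    using sub[OF mI] that mirror_mirror by blast
  show "mirror n p \<in> hook_A (i, j)" if "p \<in> hook_A (mirror n (i, j))"
    using that I by (cases p) (auto simp: hook_A_def mirror_def)
  show "coef (phi n x) (mirror n p) = coef (phi n x) p" if "p \<in> hook_A (mirror n (i, j))"
    using sub[OF mI] that coef_phi_mirror by blast
  show "mirror n (mirror n p) = p" if "p \<in> hook_A (i, j)"
    using sub[OF assms] that mirror_mirror by blast
  show "mirror n p \<in> hook_A (mirror n (i, j))" if "p \<in> hook_A (i, j)"
    using that I by (cases p) (auto simp: hook_A_def mirror_def)
qed

lemma sum_abar_mirror:
  assumes "(i, j) \<in> index_A n"
  shows "(\<Sum>k=2*n+1 - j..<2*n+1 - i. abar n a k) = (\<Sum>k=i..<j. abar n a k)"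
\<comment> \<open>The index \<open>k\<close> stands for the unit step from \<open>k\<close> to
  \<open>k + 1\<close>, so reflecting end points by \<open>2*n+1\<close> reflects indices by
  \<open>2*n\<close>.\<close>
proof (rule sum.reindex_bij_witness[of _ "\<lambda>k. 2*n - k" "\<lambda>k. 2*n - k"])
  have I: "1 \<le> i" "i < j" "j \<le> 2*n" using assms by (auto simp: index_A_def)
  fix k assume k: "k \<in> {2*n+1 - j..<2*n+1 - i}"
  then show "2*n - (2*n - k) = k" "2*n - k \<in> {i..<j}" using I by auto
  have "k \<le> 2*n" using k I by auto
  then show "abar n a (2*n - k) = abar n a k" by (auto simp: abar_def)
next
  have I: "1 \<le> i" "i < j" "j \<le> 2*n" using assms by (auto simp: index_A_def)
  fix k assume k: "k \<in> {i..<j}"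
  then show "2*n - (2*n - k) = k" "2*n - k \<in> {2*n+1 - j..<2*n+1 - i}" using I by auto
qed

definition x_system :: "nat \<Rightarrow> (nat \<Rightarrow> nat) \<Rightarrow> nat set set \<Rightarrow> point \<Rightarrow> bool" where
  "x_system n a E y \<longleftrightarrow> y \<in> coord_space (index_A n) \<and>
     (\<forall>(i, j) \<in> index_A n.
        ({i..j} \<notin> E \<longrightarrow> coef y (i, j) = 0) \<and>
        ({i..j} \<in> E \<longrightarrow> (\<Sum>p\<in>hook_A (i, j). coef y p) = real (\<Sum>k = i..<j. abar n a k)))"

text \<open>An equation outside \<open>E\<close> fixes one coordinate, and inside \<open>E\<close>
  the other points of the hook are shorter segments. Length thus makes the system triangular and the
  definite description in \<open>x_of\<close> meaningful.\<close>

lemma x_system_ex1: "\<exists>!y. x_system n a E y"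
proof -
  define H where "H p = (if {fst p..snd p} \<in> E then hook_A p else {p})" for p
  define c where "c p = (if {fst p..snd p} \<in> E then real (\<Sum>k = fst p..<snd p. abar n a k) else 0)" for p
  have sub: "H p \<subseteq> index_A n" if "p \<in> index_A n" for p
    using that by (cases p) (auto simp: H_def hook_A_def index_A_def split: if_splits)
  have self: "p \<in> H p" if "p \<in> index_A n" for p
    using that by (cases p) (auto simp: H_def hook_A_def index_A_def)
  have rank: "snd q - fst q < snd p - fst p" if "p \<in> index_A n" "q \<in> H p" "q \<noteq> p" for p q
    using that by (cases p; cases q) (auto simp: H_def hook_A_def index_A_def split: if_splits)
  have eq: "x_system n a E y \<longleftrightarrow> y \<in> coord_space (index_A n) \<and> (\<forall>p\<in>index_A n. (\<Sum>q\<in>H p. coef y q) = c p)" for y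
  proof -
    have "(case p of (i, j) \<Rightarrow> ({i..j} \<notin> E \<longrightarrow> coef y (i, j) = 0) \<and>
        ({i..j} \<in> E \<longrightarrow> (\<Sum>p\<in>hook_A (i, j). coef y p) = real (\<Sum>k = i..<j. abar n a k))) \<longleftrightarrow>
      (\<Sum>q\<in>H p. coef y q) = c p" for p
      by (cases p; cases "{fst p..snd p} \<in> E") (simp_all add: H_def c_def)
    then show ?thesis unfolding x_system_def by (intro conj_cong ball_cong refl) blast
  qed
  show ?thesis
    unfolding eq
  proof (rule ex_ex1I)
    show "\<exists>y. y \<in> coord_space (index_A n) \<and> (\<forall>p\<in>index_A n. (\<Sum>q\<in>H p. coef y q) = c p)"
      using triangular_system_exists[where I="index_A n" and H=H and rank="\<lambda>p. snd p - fst p" and c=c,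
          OF finite_index_A sub self rank] by blast
    fix x y
    assume "x \<in> coord_space (index_A n) \<and> (\<forall>p\<in>index_A n. (\<Sum>q\<in>H p. coef x q) = c p)"
      "y \<in> coord_space (index_A n) \<and> (\<forall>p\<in>index_A n. (\<Sum>q\<in>H p. coef y q) = c p)"
    then show "x = y"
      by (intro triangular_system_unique[where I="index_A n" and H=H and rank="\<lambda>p. snd p - fst p",
            OF finite_index_A sub self rank]) auto
  qed
qed

lemma x_of_eq_iff: "y = x_of n a E \<longleftrightarrow> x_system n a E y"
proof -
  have "x_of n a E = (THE y. x_system n a E y)"
    by (simp add: x_of_def x_system_def path_sum_hook)
  then show ?thesis using x_system_ex1[of n a E] the1_equality theI' by metis
qed

section \<open>From laminar supports to symmetric segment families and back\<close>

definition symmetric_segments_of :: "nat \<Rightarrow> (nat \<times> nat) set \<Rightarrow> nat set set" where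
  "symmetric_segments_of n S = {{i..j} | i j. (i, j) \<in> index_A n \<and> ((i, j) \<in> S \<or> mirror n (i, j) \<in> S)}"

lemma mem_symmetric_segments_of:
  assumes "(i, j) \<in> index_A n"
  shows "{i..j} \<in> symmetric_segments_of n S \<longleftrightarrow> (i, j) \<in> S \<or> mirror n (i, j) \<in> S"
proof -
  have "i \<le> j" using assms by (auto simp: index_A_def)
  then show ?thesis using assms by (auto simp: symmetric_segments_of_def Icc_eq_Icc)
qed

text \<open>Laminarity settles intersections within \<open>S\<close> and, after reflection, within
  its mirror image. The mixed case, a member meeting a reflected member, relies on the antidiagonal
  condition.\<close>

lemma symmetric_segments_of_in_R_s_C:
  assumes S: "S \<subseteq> index_C n"
    and antidiagonal: "\<And>i j. (i, j) \<in> S \<Longrightarrow> n < j \<Longrightarrow> (2*n+1 - j, j) \<in> S"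
    and laminar: "\<And>i j k l. (i, j) \<in> S \<Longrightarrow> (k, l) \<in> S \<Longrightarrow> i < k \<Longrightarrow> j < l \<Longrightarrow> j < k"
  shows "symmetric_segments_of n S \<in> R_s_C n"
proof -
  let ?E = "symmetric_segments_of n S"
  define G where "G p \<longleftrightarrow> p \<in> index_A n \<and> (p \<in> S \<or> mirror n p \<in> S)" for p
  have E: "s \<in> ?E \<longleftrightarrow> (\<exists>i j. s = {i..j} \<and> G (i, j))" for s
    by (auto simp: symmetric_segments_of_def G_def)
  have SA: "S \<subseteq> index_A n" using S index_C_subset_A by blast
  have G_S: "G p" if "p \<in> S" for p using that SA by (auto simp: G_def)
  have G_mirror: "G (mirror n p)" if "G p" for p
    using that mirror_index_A mirror_mirror by (auto simp: G_def)
  have G_mirrorD: "G p" if "p \<in> index_A n" "G (mirror n p)" for p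
    using G_mirror[OF that(2)] mirror_mirror[OF that(1)] by simp
  have idx: "1 \<le> i \<and> i < j \<and> i + j \<le> 2*n+1 \<and> j \<le> 2*n" if "(i, j) \<in> S" for i j
    using that S by (auto simp: index_C_def)
  have inter: "(max i k, min j l) \<in> S"
    if "(i, j) \<in> S" "(k, l) \<in> S" "max i k \<le> min j l" for i j k l
  proof -
    consider "i < k" | "k < i" | "i = k" by linarith
    then show ?thesis
    proof cases
      case 1
      then have "l \<le> j" using laminar[OF that(1,2)] that(3) by (meson leD le_less_linear max.bounded_iff min.bounded_iff)
      then show ?thesis using 1 that by (simp add: max_def min_def)
    next
      case 2
      then have "j \<le> l" using laminar[OF that(2,1)] that(3) by (meson leD le_less_linear max.bounded_iff min.bounded_iff)
      then show ?thesis using 2 that by (simp add: max_def min_def)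
    next
      case 3
      then show ?thesis using that by (simp add: min_def)
    qed
  qed
  \<comment> \<open>Here \<open>(p, q)\<close> is contained in \<open>(x, y)\<close> and meets its
    mirror image. If \<open>2*n+1 - y\<close> exceeds \<open>p\<close>, laminarity of
    \<open>(p, q)\<close> with the antidiagonal member ending at \<open>y\<close> forces
    \<open>q = y\<close>, and the intersection is that member.\<close>
  have nested: "(max p (2*n+1 - y), min q (2*n+1 - x)) \<in> S"
    if pq: "(p, q) \<in> S" and xy: "(x, y) \<in> S" and qy: "2*n+1 \<le> q + y" and le: "x \<le> p" "q \<le> y" for p q x y
  proof -
    have "min q (2*n+1 - x) = q" using idx[OF pq] le by auto
    moreover have "(max p (2*n+1 - y), q) \<in> S"
    proof (cases "2*n+1 - y \<le> p")
      case True
      then show ?thesis using pq by (simp add: max_def)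
    next
      case False
      have c: "(2*n+1 - y, y) \<in> S" using antidiagonal[OF xy] qy le by simp
      have "q = y"
      proof (rule ccontr)
        assume "q \<noteq> y"
        then have "q < 2*n+1 - y" using laminar[OF pq c] False le by simp
        then show False using qy by simp
      qed
      then show ?thesis using c False by (simp add: max_def)
    qed
    ultimately show ?thesis by simp
  qed
  have inter': "G (max p k, min q l)"
    if pq: "(p, q) \<in> S" and kl: "(k, l) \<in> index_A n" "mirror n (k, l) \<in> S" and ne: "max p k \<le> min q l" for p q k l
  proof -
    define x y where "x = 2*n+1 - l" and "y = 2*n+1 - k"
    have kl': "k = 2*n+1 - y" "l = 2*n+1 - x" "k < l" using kl(1) by (auto simp: index_A_def x_def y_def)
    have xy: "(x, y) \<in> S" using kl(2) by (simp add: mirror_def x_def y_def)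
    note I = idx[OF pq] idx[OF xy]
    have "2*n+1 - y \<le> q" using ne kl'(1) by simp
    then have qy: "2*n+1 \<le> q + y" by linarith
    \<comment> \<open>The end points of each segment sum to at most \<open>2*n+1\<close> while
      \<open>q + y\<close> is at least \<open>2*n+1\<close>, so the segments meet and laminarity
      nests them.\<close>
    consider "x \<le> p" "q \<le> y" | "p \<le> x" "y \<le> q"
    proof -
      consider "p < x" | "x < p" | "p = x" by linarith
      then show ?thesis
      proof cases
        case 1
        have "\<not> q < y" using laminar[OF pq xy 1] qy I by linarith
        then show ?thesis using that(2) 1 by simp
      next
        case 2
        have "\<not> y < q" using laminar[OF xy pq 2] qy I by linarith
        then show ?thesis using that(1) 2 by simp
      next
        case 3
        then show ?thesis using that by linarith
      qed
    qed
    then show ?thesis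
    proof cases
      case 1
      then show ?thesis using G_S[OF nested[OF pq xy qy]] kl' by simp
    next
      case 2
      have "2*n+1 \<le> y + q" using qy by simp
      from nested[OF xy pq this 2] have "(max x (2*n+1 - q), min y (2*n+1 - p)) \<in> S" .
      then have "G (mirror n (max x (2*n+1 - q), min y (2*n+1 - p)))" using G_mirror G_S by blast
      moreover have "mirror n (max x (2*n+1 - q), min y (2*n+1 - p)) = (max p k, min q l)"
        using kl' I by (auto simp: mirror_def)
      ultimately show ?thesis by simp
    qed
  qed
  have G_inter: "G (max i k, min j l)" if G: "G (i, j)" "G (k, l)" and ne: "max i k \<le> min j l" for i j k l
  proof -
    have A: "(i, j) \<in> index_A n" "(k, l) \<in> index_A n" using G by (auto simp: G_def)
    have A': "1 \<le> i" "i < j" "j \<le> 2*n" "1 \<le> k" "k < l" "l \<le> 2*n" using A by (auto simp: index_A_def)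
    consider "(i, j) \<in> S" "(k, l) \<in> S" | "(i, j) \<in> S" "mirror n (k, l) \<in> S"
      | "mirror n (i, j) \<in> S" "(k, l) \<in> S" | "mirror n (i, j) \<in> S" "mirror n (k, l) \<in> S"
      using G unfolding G_def by blast
    then show ?thesis
    proof cases
      case 1
      then show ?thesis using inter ne G_S by blast
    next
      case 2
      then show ?thesis using inter' A ne by blast
    next
      case 3
      then show ?thesis using inter'[of k l i j] A ne by (simp add: max.commute min.commute)
    next
      case 4
      let ?x = "max (2*n+1 - j) (2*n+1 - l)" and ?y = "min (2*n+1 - i) (2*n+1 - k)"
      have m: "(max i k, min j l) = mirror n (?x, ?y)" using A' by (auto simp: mirror_def)
      have "?x \<le> ?y" using ne A' by auto
      then have "(?x, ?y) \<in> S" using 4 by (intro inter) (auto simp: mirror_def)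
      then show ?thesis unfolding m using G_S G_mirror by blast
    qed
  qed
  have "?E \<in> R_p n"
    unfolding R_p_def
  proof (intro CollectI conjI ballI impI)
    show "?E \<subseteq> segments n"
      by (auto simp: symmetric_segments_of_def segments_def index_A_def)
    fix s t assume "s \<in> ?E" "t \<in> ?E" and ne: "s \<inter> t \<noteq> {}"
    then obtain i j k l where st: "s = {i..j}" "G (i, j)" "t = {k..l}" "G (k, l)" unfolding E by blast
    then have "s \<inter> t = {max i k..min j l}" by simp
    moreover have "max i k \<le> min j l" using ne calculation by (metis atLeastatMost_empty_iff2 le_less_linear)
    ultimately show "s \<inter> t \<in> ?E" using G_inter st unfolding E by blast
  qed
  moreover have "symmetric_segs n ?E"
    unfolding symmetric_segs_def
  proof safe
    fix i j assume ij: "(i, j) \<in> index_A n" and m: "{2*n+1 - j..2*n+1 - i} \<in> ?E"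
    then have "mirror n (i, j) \<in> S \<or> mirror n (mirror n (i, j)) \<in> S"
      using mem_symmetric_segments_of[of "2*n+1 - j" "2*n+1 - i" n S] mirror_index_A[OF ij]
      by (simp add: mirror_def)
    then show "{i..j} \<in> ?E"
      using mem_symmetric_segments_of[OF ij] mirror_mirror[OF ij] by auto
  qed
  moreover have "{i..j} \<inter> {k..l} = {} \<or> {i..j} \<subseteq> {k..l} \<or> {k..l} \<subseteq> {i..j}"
    if A: "(i, j) \<in> index_A n" "(k, l) \<in> index_A n" and e: "{i..j} \<in> ?E" "{k..l} \<in> ?E"
      and half: "i + j \<le> 2*n+1" "k + l \<le> 2*n+1" for i j k l
  proof -
    have half_S: "(i, j) \<in> S" if "(i, j) \<in> index_A n" "{i..j} \<in> ?E" "i + j \<le> 2*n+1" for i j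
    proof -
      have "(i, j) \<in> S \<or> mirror n (i, j) \<in> S" using mem_symmetric_segments_of that by blast
      moreover have "mirror n (i, j) = (i, j)" if "mirror n (i, j) \<in> S"
        using idx[of "2*n+1 - j" "2*n+1 - i"] that \<open>i + j \<le> 2*n+1\<close> \<open>(i, j) \<in> index_A n\<close>
        by (auto simp: mirror_def index_A_def)
      ultimately show ?thesis by metis
    qed
    note s = half_S[OF A(1) e(1) half(1)] half_S[OF A(2) e(2) half(2)]
    consider "i < k" "j < l" | "k < i" "l < j" | "k \<le> i" "j \<le> l" | "i \<le> k" "l \<le> j" by linarith
    then show ?thesis
    proof cases
      case 1
      then have "j < k" using laminar[OF s] by blast
      then show ?thesis by auto
    next
      case 2
      then have "l < i" using laminar[OF s(2,1)] by blast
      then show ?thesis by auto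
    qed auto
  qed
  ultimately show ?thesis
    unfolding R_s_C_def by blast
qed

text \<open>The family is the symmetrised support of \<open>v\<close>. Folding adds the tight hook
  equation of \<open>(i, j)\<close> to that of its antidiagonal end, which gives the type A
  equation; reflection covers the other half.\<close>

lemma simple_vertex_imp_x_of:
  assumes pos: "\<And>i. i \<in> {1..n} \<Longrightarrow> 0 < a i"
    and simple: "simple_vertex (int_lattice (index_C n)) (FFLV_C n a) v"
  shows "\<exists>E \<in> R_s_C n. phi n v = x_of n a E"
proof -
  interpret simple_FFLV_C n a v by unfold_locales fact+
  let ?E = "symmetric_segments_of n supp"
  have S: "supp \<subseteq> index_C n" by (auto simp: supp_def)
  have "?E \<in> R_s_C n"
  proof (rule symmetric_segments_of_in_R_s_C[OF S])
    show "(2*n+1 - j, j) \<in> supp" if "(i, j) \<in> supp" "n < j" for i j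
      using supp_antidiagonal that by blast
    show "j < k" if "(i, j) \<in> supp" "(k, l) \<in> supp" "i < k" "j < l" for i j k l
      using supp_laminar[OF that(1-3) _ that(4)] by force
  qed
  moreover have "x_system n a ?E (phi n v)"
    unfolding x_system_def
  proof (intro conjI phi_in_coord_space, safe)
    fix i j assume ij: "(i, j) \<in> index_A n"
    have hook: "(\<Sum>p\<in>hook_A (i, j). coef (phi n v) p) = real (\<Sum>k=i..<j. abar n a k)"
      if "(i, j) \<in> supp" for i j
    proof -
      have ijC: "(i, j) \<in> index_C n" using that S by blast
      have "(\<Sum>p\<in>hook_C n (i, j). coef v p) = (\<Sum>k=i..min (j - 1) n. real (a k))" if "(i, j) \<in> supp" for i j
        using hook_tight[OF that] by (simp add: tight_path_def)
      note eq = this[OF that] this[OF supp_antidiagonal[OF that]]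
      show ?thesis
        unfolding sum_hook_phi[OF ijC] sum_abar[OF ijC] using eq by (auto simp: min.absorb2)
    qed
    {
      assume "{i..j} \<in> ?E"
      then consider "(i, j) \<in> supp" | "mirror n (i, j) \<in> supp" using mem_symmetric_segments_of[OF ij] by blast
      then show "(\<Sum>p\<in>hook_A (i, j). coef (phi n v) p) = real (\<Sum>k=i..<j. abar n a k)"
      proof cases
        case 2
        then have "(\<Sum>p\<in>hook_A (mirror n (i, j)). coef (phi n v) p) = real (\<Sum>k=2*n+1 - j..<2*n+1 - i. abar n a k)"
          using hook[of "2*n+1 - j" "2*n+1 - i"] by (simp add: mirror_def)
        then show ?thesis by (simp only: sum_hook_phi_mirror[OF ij] sum_abar_mirror[OF ij])
      qed (use hook in blast)
    next
      assume "{i..j} \<notin> ?E"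
      then have ns: "(i, j) \<notin> supp" "mirror n (i, j) \<notin> supp" using mem_symmetric_segments_of[OF ij] by auto
      show "coef (phi n v) (i, j) = 0"
      proof (cases "(i, j) \<in> index_C n")
        case True
        then have "i + j \<le> 2*n+1" by (auto simp: index_C_def)
        then show ?thesis using v_zero[OF True ns(1)] by (simp add: coef_phi[OF ij])
      next
        case False
        then have "2*n+1 < i + j" using ij by (auto simp: index_C_def index_A_def)
        then show ?thesis
          using v_zero[OF mirror_index_C[OF ij False] ns(2)] by (simp add: coef_phi[OF ij] mirror_def)
      qed
    }
  qed
  ultimately show ?thesis using x_of_eq_iff by blast
qed

lemma x_of_imp_simple_vertex:
  assumes pos: "\<And>i. i \<in> {1..n} \<Longrightarrow> 0 < a i"
    and v: "v extreme_point_of FFLV_C n a"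
    and E: "E \<in> R_s_C n" and eq: "phi n v = x_of n a E"
  shows "simple_vertex (int_lattice (index_C n)) (FFLV_C n a) v"
proof -
  define S where "S = {(i, j) \<in> index_C n. {i..j} \<in> E}"
  have sys: "x_system n a E (phi n v)" using eq x_of_eq_iff by blast
  have inter: "s \<inter> t \<in> E" if "s \<in> E" "t \<in> E" "s \<inter> t \<noteq> {}" for s t
    using E that by (auto simp: R_s_C_def R_p_def)
  have sym: "{i..j} \<in> E" if "(i, j) \<in> index_A n" "{2*n+1 - j..2*n+1 - i} \<in> E" for i j
    using E that by (auto simp: R_s_C_def symmetric_segs_def)
  have nest: "{i..j} \<inter> {k..l} = {} \<or> {i..j} \<subseteq> {k..l} \<or> {k..l} \<subseteq> {i..j}"
    if "(i, j) \<in> S" "(k, l) \<in> S" for i j k l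
  proof -
    have "(i, j) \<in> index_A n" "(k, l) \<in> index_A n" "i + j \<le> 2*n+1" "k + l \<le> 2*n+1"
      using that index_C_subset_A by (auto simp: S_def index_C_def)
    then show ?thesis using E that by (auto simp: R_s_C_def S_def)
  qed
  \<comment> \<open>A segment reaching past the middle meets its mirror image in the symmetric
    segment \<open>{2*n+1 - j..j}\<close>, so closure under intersection puts that segment into
    \<open>E\<close>.\<close>
  have anti: "(2*n+1 - j, j) \<in> S" if ij: "(i, j) \<in> S" "n < j" for i j
  proof -
    have I: "1 \<le> i" "i < j" "i + j \<le> 2*n+1" "(i, j) \<in> index_A n" "{i..j} \<in> E"
      using ij index_C_subset_A by (auto simp: S_def index_C_def)
    have "{2*n+1 - j..2*n+1 - i} \<in> E"
      using sym[of "2*n+1 - j" "2*n+1 - i"] mirror_index_A[OF I(4)] I(5) mirror_mirror[OF I(4)]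
      by (simp add: mirror_def)
    moreover have eq: "{i..j} \<inter> {2*n+1 - j..2*n+1 - i} = {2*n+1 - j..j}" using I by auto
    moreover have "{2*n+1 - j..j} \<noteq> {}" using ij(2) by auto
    ultimately have "{2*n+1 - j..j} \<in> E" using inter[OF I(5)] by metis
    then show ?thesis using ij I by (auto simp: S_def index_C_def)
  qed
  have hookA: "(\<Sum>p\<in>hook_C n (i, j). coef v p) + (if n < j then \<Sum>p\<in>hook_C n (2*n+1 - j, j). coef v p else 0) =
      (\<Sum>k=i..min (j - 1) n. real (a k)) + (if n < j then \<Sum>k=2*n+1 - j..n. real (a k) else 0)"
    if "(i, j) \<in> S" for i j
  proof -
    have ij: "(i, j) \<in> index_C n" "(i, j) \<in> index_A n" "{i..j} \<in> E"
      using that index_C_subset_A by (auto simp: S_def)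
    have "(\<Sum>p\<in>hook_A (i, j). coef (phi n v) p) = real (\<Sum>k=i..<j. abar n a k)"
      using sys ij unfolding x_system_def by blast
    then show ?thesis unfolding sum_hook_phi[OF ij(1)] sum_abar[OF ij(1)] .
  qed
  interpret laminar_FFLV_C n a v S
  proof
    show "v \<in> FFLV_C n a" using v by (simp add: extreme_point_of_def)
    show "S \<subseteq> index_C n" by (auto simp: S_def)
    show "coef v p = 0" if "p \<in> index_C n" "p \<notin> S" for p
    proof -
      obtain i j where p: "p = (i, j)" by (cases p)
      have ij: "(i, j) \<in> index_A n" "i + j \<le> 2*n+1" using that p index_C_subset_A by (auto simp: index_C_def)
      moreover have "coef (phi n v) (i, j) = 0"
        using sys that p ij(1) unfolding x_system_def by (auto simp: S_def)
      ultimately show ?thesis by (simp add: p coef_phi split: if_splits)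
    qed
    show "(\<Sum>p\<in>hook_C n (i, j). coef v p) = (\<Sum>k=i..min (j - 1) n. real (a k))" if "(i, j) \<in> S" for i j
    \<comment> \<open>For the antidiagonal segment the folded equation is twice its own hook
      equation; subtracting the latter from the folded equation of \<open>(i, j)\<close> isolates
      the hook of \<open>(i, j)\<close>.\<close>
    proof (cases "n < j")
      case True
      have "j \<le> 2*n" using that by (auto simp: S_def index_C_def)
      then show ?thesis using hookA[OF that] hookA[OF anti[OF that True]] True by (simp add: min.absorb2)
    next
      case False
      then show ?thesis using hookA[OF that] by simp
    qed
    show "j < k" if "(i, j) \<in> S" "(k, l) \<in> S" "i < k" "j < l" for i j k l
    proof (rule ccontr)
      assume "\<not> j < k"
      then have "k \<in> {i..j} \<inter> {k..l}" using that by auto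
      moreover have "i < j" "k < l" using that by (auto simp: S_def index_C_def)
      ultimately show False using nest[OF that(1,2)] that(3,4) by auto
    qed
  qed (use pos anti in auto)
  obtain B where "lattice_basis B (int_lattice (index_C n))" "tangent_cone (FFLV_C n a) v = convex_cone hull B"
    by (rule unimodular)
  then show ?thesis
    using v by (auto simp: simple_vertex_def simplicial_cone_def unimodular_cone_def lattice_basis_def)
qed

theorem theorem5p3:
  fixes n :: nat and a :: "nat \<Rightarrow> nat" and v :: point
  assumes "1 \<le> n"
    and "\<And>i. i \<in> {1..n} \<Longrightarrow> 0 < a i"
    and "v extreme_point_of FFLV_C n a"
  shows "simple_vertex (int_lattice (index_C n)) (FFLV_C n a) v \<longleftrightarrow>
    (\<exists>E \<in> R_s_C n. phi n v = x_of n a E)"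
  using simple_vertex_imp_x_of[of n a v] x_of_imp_simple_vertex[of n a v] assms(2,3) by blast

end
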